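(* Let $T:X\to X$, $X=[0,1]^2$, be the baker's transformation with parameter $\gamma\in(0,1/2)$ defined in the context, and let $\mu$ be its SRB measure. Let $\tau>0$, let $z\in X$ be a point for which the limit $$\lim_{r\to0^+}\frac{\log\mu(B(z,r))}{\log r}=d$$ exists ($d$ as in the context), and let $(u_n)$ be a sequence of real numbers such that $n\,\mu(B_n)\to\tau$ as $n\to\infty$, where $B_n=B(z,e^{-u_n})$. Consider the counting function $$N^{\tau}_{B_n}(x)=\sum_{i=0}^{\lfloor \tau/\mu(B_n)\rfloor}\mathbf 1_{B_n}(T^i x),\qquad x\in X.$$ (1) If $z$ is not a periodic point of $T$ and the balls $B_n$ are taken in the Euclidean metric, then for every integer $k\ge0$, $$\mu(N^{\tau}_{B_n}=k)\to\frac{e^{-\tau}\tau^k}{k!},\qquad n\to\infty.$$ (2) If $z$ is a periodic point of $T$ of minimal period $p$ and the balls $B_n$ are taken in the $\ell^\infty$ metric, then, with $\Theta=1-\lim_{n\to\infty}\frac{\mu(T^{-p}B_n\cap B_n)}{\mu(B_n)}$, the variables $N^\tau_{B_n}$ converge in distribution to a Pólya–Aeppli (compound Poisson) law: for every integer $k\ge1$, $$\mu(N^{\tau}_{B_n}=k)\to e^{-\Theta\tau}\sum_{j=1}^k(1-\Theta)^{k-j}\Theta^{2j}\frac{\tau^j}{j!}\binom{k-1}{j-1},\qquad n\to\infty,$$ and $\mu(N^\tau_{B_n}=0)\to e^{-\Theta\tau}$.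
   Context: The baker's transformation: fix $\alpha=1/2$ and $\gamma\in(0,1/2)$ (so $\gamma_a=\gamma_b=\gamma$). On $X=[0,1]^2$ put $T(x,y)=(\gamma x,\,2y)$ if $y<1/2$ and $T(x,y)=((1-\gamma)+\gamma x,\,2y-1)$ if $y\ge 1/2$ (the value on the $\mu$-null line $y=1/2$ is a convention). Unstable leaves are the vertical segments $\{x\}\times[0,1]$. The SRB measure $\mu$ is the unique $T$-invariant Borel probability measure on $X$ whose conditional measures on the vertical unstable leaves are normalized Lebesgue (arclength) measure. $B(z,r)$ is the open ball in $X$ with center $z$ and radius $r$ for the metric specified (Euclidean, or $\ell^\infty$: $|(x,y)|_\infty=\max\{|x|,|y|\}$). The number $d=1+\frac{\log 2}{\log\gamma^{-1}}$ is the Hausdorff dimension of $\mu$; the limit does not depend on which of the two metrics is used. *)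

theory Defs
  imports "HOL-Probability.Probability"
begin

definition unit_square :: "(real \<times> real) set" where
  "unit_square = {0..1} \<times> {0..1}"

definition baker :: "real \<Rightarrow> real \<times> real \<Rightarrow> real \<times> real" where
  "baker \<gamma> = (\<lambda>(x, y). if y < 1/2 then (\<gamma> * x, 2 * y) else ((1 - \<gamma>) + \<gamma> * x, 2 * y - 1))"

text \<open>Arclength on the vertical leaf \<open>{x} \<times> [0,1]\<close>, as a measure on the square; the leaf has
  length 1, so this is already normalized.\<close>

definition leaf_measure :: "real \<Rightarrow> (real \<times> real) measure" where
  "leaf_measure x =
     distr (restrict_space lborel {0..1}) (restrict_space borel unit_square) (\<lambda>y. (x, y))"

text \<open>The last clause is the disintegration identity of \<open>\<mu>\<close> over the partition of the square into
  vertical leaves: the leaf through \<open>w\<close> carries the conditional measure \<open>leaf_measure (fst w)\<close>.\<close>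

definition is_SRB :: "real \<Rightarrow> (real \<times> real) measure \<Rightarrow> bool" where
  "is_SRB \<gamma> \<mu> \<longleftrightarrow>
     prob_space \<mu> \<and>
     sets \<mu> = sets (restrict_space borel unit_square) \<and>
     distr \<mu> \<mu> (baker \<gamma>) = \<mu> \<and>
     (\<forall>A\<in>sets \<mu>. emeasure \<mu> A = (\<integral>\<^sup>+ w. emeasure (leaf_measure (fst w)) A \<partial>\<mu>))"

text \<open>The product metric \<open>dist\<close> on \<open>real \<times> real\<close> is the Euclidean one.\<close>

definition euclid_ball :: "real \<times> real \<Rightarrow> real \<Rightarrow> (real \<times> real) set" where
  "euclid_ball z r = {w \<in> unit_square. dist z w < r}"

definition max_ball :: "real \<times> real \<Rightarrow> real \<Rightarrow> (real \<times> real) set" where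
  "max_ball z r = {w \<in> unit_square. max \<bar>fst w - fst z\<bar> \<bar>snd w - snd z\<bar> < r}"

definition SRB_dim :: "real \<Rightarrow> real" where
  "SRB_dim \<gamma> = 1 + ln 2 / ln (inverse \<gamma>)"

text \<open>Where the balls around a point are null, \<open>ln 0 = 0\<close> makes the quotient tend to 0; since the
  dimensions of interest are positive, such points are excluded.\<close>

definition has_local_dim ::
  "'a measure \<Rightarrow> (real \<Rightarrow> 'a set) \<Rightarrow> real \<Rightarrow> bool" where
  "has_local_dim \<mu> B d \<longleftrightarrow> ((\<lambda>r. ln (measure \<mu> (B r)) / ln r) \<longlongrightarrow> d) (at_right 0)"

definition periodic_point :: "('a \<Rightarrow> 'a) \<Rightarrow> 'a \<Rightarrow> bool" where
  "periodic_point T z \<longleftrightarrow> (\<exists>p>0. (T ^^ p) z = z)"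

definition minimal_period :: "('a \<Rightarrow> 'a) \<Rightarrow> 'a \<Rightarrow> nat \<Rightarrow> bool" where
  "minimal_period T z p \<longleftrightarrow>
     p > 0 \<and> (T ^^ p) z = z \<and> (\<forall>q. 0 < q \<and> q < p \<longrightarrow> (T ^^ q) z \<noteq> z)"

definition visit_count ::
  "'a measure \<Rightarrow> ('a \<Rightarrow> 'a) \<Rightarrow> real \<Rightarrow> 'a set \<Rightarrow> 'a \<Rightarrow> nat" where
  "visit_count \<mu> T \<tau> B x = (\<Sum>i = 0..nat \<lfloor>\<tau> / measure \<mu> B\<rfloor>. indicator B ((T ^^ i) x))"

definition polya_aeppli_mass :: "real \<Rightarrow> real \<Rightarrow> nat \<Rightarrow> real" where
  "polya_aeppli_mass \<Theta> \<tau> k =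
     (if k = 0 then exp (- \<Theta> * \<tau>)
      else exp (- \<Theta> * \<tau>) *
        (\<Sum>j = 1..k. (1 - \<Theta>) ^ (k - j) * \<Theta> ^ (2 * j) * (\<tau> ^ j / fact j) *
           real ((k - 1) choose (j - 1))))"

definition polya_aeppli_law :: "real \<Rightarrow> real \<Rightarrow> real measure" where
  "polya_aeppli_law \<Theta> \<tau> =
     distr (density (count_space UNIV) (\<lambda>k. ennreal (polya_aeppli_mass \<Theta> \<tau> k))) borel real"

end

(* Under the disintegration identity \<mu> is the product of a Cantor measure nu on the stable direction
   and of Lebesgue measure on the unstable one, and the second coordinate is driven by the doubling map.

   The set T^-m B is approximated from inside by a set that depends on 2m binary digits of the second
   coordinate; cutting the orbit into blocks of length s separated by gaps of length 2m then makes the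
   visits in the blocks exactly independent. The number of visits is, up to an event of small
   probability, a sum of K independent copies of the number of visits in one block, and its generating
   function is a K-th power, whose coefficients converge to those of a compound Poisson law.

   The one-block law comes from stationarity: if f_s(k) is the probability of k visits before time s
   and g_s(k) the probability to start in B and to return k times up to time s, then
   f_(s+1)(k) = f_s(k) + g_s(k-1) - g_s(k). Returns after a bounded time are negligible, since along a
   vertical segment a return at time i has conditional probability O(r + 2^-i). Returns within a bounded
   time do not occur near a non-periodic point; near a point of period p the map T^p is affine, of
   vertical slope 2^p, so the number of returns is geometric of parameter 2^-p, whence
   \<Theta> = 1 - 2^-p. *)

theory Submission
  imports Defs "HOL-Computational_Algebra.Formal_Power_Series" "HOL-Real_Asymp.Real_Asymp"
begin

section \<open>Coefficients of large powers of power series\<close>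

text \<open>The obstacle is that a ball restricts the first coordinate, which records the past of
  the orbit, so that visits to it are not a function of the digits of the second coordinate. Passing
  to T^(-m) B turns the past into digits at no cost, since visits to the preimage have the same law.
  Of the 2m digits, the first m fix the branches taken and hence the first coordinate up to
  \<gamma>^m, the next m fix the second up to 2^(-m); what is lost lies over a thin layer inside the
  boundary of B. The loss is paid at about \<tau>/\<mu>(B) times, so it has to be small relative to
  \<mu>(B): here the local dimension enters, through \<mu>(B) \<ge> r^3 for small r. Blocks must be
  long compared with the gaps, yet so short that s r tends to 0, which keeps late returns within one
  block negligible. In the maximum metric a ball is a product, and near a periodic point its returns
  are decided by the vertical distance alone. A Euclidean ball is not a product; its comparison with
  a rectangle rests on the doubling property of the Cantor measure.\<close>

lemma fps_nth_power_tendsto: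
  fixes F :: "nat \<Rightarrow> real fps"
  assumes "\<And>k. (\<lambda>n. fps_nth (F n) k) \<longlonglongrightarrow> fps_nth G k"
  shows "(\<lambda>n. fps_nth (F n ^ j) k) \<longlonglongrightarrow> fps_nth (G ^ j) k"
proof (induction j arbitrary: k)
  case (Suc j)
  then show ?case
    unfolding power_Suc fps_mult_nth by (intro tendsto_intros assms)
qed simp

lemma binomial_over_power_tendsto:
  assumes "filterlim K at_top sequentially"
  shows "(\<lambda>n. real (K n choose j) / real (K n) ^ j) \<longlonglongrightarrow> 1 / fact j"
proof -
  have "(\<lambda>N. real (N choose j) / real N ^ j) \<longlonglongrightarrow> 1 / fact j"
  proof (induction j)
    case (Suc j)
    have eq: "real (N choose Suc j) / real N ^ Suc j
        = (real (N choose j) / real N ^ j) * ((real N - real j) / real N) / real (Suc j)" if "N \<ge> j" for N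
    proof -
      have "real (Suc j) * real (N choose Suc j) = (real N - real j) * real (N choose j)"
        using binomial_absorb_comp[of N j] binomial_absorption[of j "N"] that
        by (metis of_nat_diff of_nat_mult)
      then have "real (N choose Suc j) = (real N - real j) * real (N choose j) / real (Suc j)"
        by (metis nonzero_mult_div_cancel_left of_nat_0_eq_iff old.nat.distinct(1))
      then show ?thesis by (simp add: mult_ac)
    qed
    have "(\<lambda>N. (real N - real j) / real N) \<longlonglongrightarrow> 1"
      by real_asymp
    then have "(\<lambda>N. (real (N choose j) / real N ^ j) * ((real N - real j) / real N) / real (Suc j))
        \<longlonglongrightarrow> (1 / fact j) * 1 / real (Suc j)"
      by (intro tendsto_intros Suc) simp_all
    moreover have "eventually (\<lambda>N. (real (N choose j) / real N ^ j) * ((real N - real j) / real N) / real (Suc j)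
        = real (N choose Suc j) / real N ^ Suc j) sequentially"
      using eventually_ge_at_top[of j] by eventually_elim (simp only: eq)
    ultimately have "(\<lambda>N. real (N choose Suc j) / real N ^ Suc j) \<longlonglongrightarrow> (1 / fact j) * 1 / real (Suc j)"
      by (rule Lim_transform_eventually)
    then show ?case by (simp add: field_simps)
  qed (simp)
  then show ?thesis
    using assms by (rule filterlim_compose)
qed

text \<open>Convergence of \<open>K n * (1 - c n)\<close> forces \<open>c n\<close> to 1, and the
  bounds 1 - 1/c \<le> ln c \<le> c - 1 then squeeze \<open>K n * ln (c n)\<close>.\<close>

lemma power_tendsto_exp:
  fixes c :: "nat \<Rightarrow> real"
  assumes K: "filterlim K at_top sequentially"
    and lim: "(\<lambda>n. real (K n) * (1 - c n)) \<longlonglongrightarrow> l0"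
  shows "(\<lambda>n. c n ^ K n) \<longlonglongrightarrow> exp (- l0)" and "c \<longlonglongrightarrow> 1"
proof -
  have Kr: "filterlim (\<lambda>n. real (K n)) at_top sequentially"
    using K by (rule filterlim_compose[OF filterlim_real_sequentially])
  have "(\<lambda>n. real (K n) * (1 - c n) / real (K n)) \<longlonglongrightarrow> 0"
    by (rule real_tendsto_divide_at_top[OF lim Kr])
  moreover have "eventually (\<lambda>n. real (K n) * (1 - c n) / real (K n) = 1 - c n) sequentially"
    using filterlim_at_top_dense[THEN iffD1, OF Kr, rule_format, of 0] by eventually_elim simp
  ultimately have x0: "(\<lambda>n. 1 - c n) \<longlonglongrightarrow> 0"
    by (rule Lim_transform_eventually)
  then show c1: "c \<longlonglongrightarrow> 1"
    using tendsto_diff[OF tendsto_const[of 1] x0] by simp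
  have pos: "eventually (\<lambda>n. c n > 0) sequentially"
    using c1 by (rule order_tendstoD) simp
  have l1: "(\<lambda>n. - (real (K n) * (1 - c n)) / c n) \<longlonglongrightarrow> - l0 / 1"
    by (intro tendsto_intros lim c1) simp
  have l2: "(\<lambda>n. - (real (K n) * (1 - c n))) \<longlonglongrightarrow> - l0"
    by (intro tendsto_intros lim)
  have "(\<lambda>n. real (K n) * ln (c n)) \<longlonglongrightarrow> - l0"
  proof (rule tendsto_sandwich[OF _ _ _ l2])
    show "eventually (\<lambda>n. - (real (K n) * (1 - c n)) / c n \<le> real (K n) * ln (c n)) sequentially"
      using pos
    proof eventually_elim
      case (elim n)
      have "ln (inverse (c n)) \<le> inverse (c n) - 1"
        using elim by (intro ln_le_minus_one) simp
      then have "1 - 1 / c n \<le> ln (c n)"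
        using elim by (simp add: ln_inverse inverse_eq_divide[symmetric])
      then have "real (K n) * (1 - 1 / c n) \<le> real (K n) * ln (c n)"
        by (intro mult_left_mono) simp_all
      then show ?case using elim by (simp add: field_simps)
    qed
    show "eventually (\<lambda>n. real (K n) * ln (c n) \<le> - (real (K n) * (1 - c n))) sequentially"
      using pos
    proof eventually_elim
      case (elim n)
      have "real (K n) * ln (c n) \<le> real (K n) * (c n - 1)"
        using elim ln_le_minus_one by (intro mult_left_mono) simp_all
      then show ?case by (simp add: algebra_simps)
    qed
  qed (use l1 in simp)
  then have "(\<lambda>n. exp (real (K n) * ln (c n))) \<longlonglongrightarrow> exp (- l0)"
    by (rule tendsto_exp)
  moreover have "eventually (\<lambda>n. exp (real (K n) * ln (c n)) = c n ^ K n) sequentially"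
    using pos by eventually_elim (simp add: exp_of_nat_mult)
  ultimately show "(\<lambda>n. c n ^ K n) \<longlonglongrightarrow> exp (- l0)"
    by (rule Lim_transform_eventually)
qed

text \<open>Only finitely many coefficients of the base enter each coefficient of the power, so the
  convergence of the large coefficients alone suffices and no tightness is required.\<close>

lemma fps_nth_large_power_tendsto:
  fixes a :: "nat \<Rightarrow> nat \<Rightarrow> real" and l :: "nat \<Rightarrow> real"
  assumes K: "filterlim K at_top sequentially"
    and a0: "(\<lambda>n. real (K n) * (1 - a n 0)) \<longlonglongrightarrow> l0"
    and a: "\<And>k. k \<ge> 1 \<Longrightarrow> (\<lambda>n. real (K n) * a n k) \<longlonglongrightarrow> l k"
  shows "(\<lambda>n. fps_nth (Abs_fps (a n) ^ K n) k) \<longlonglongrightarrow>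
    exp (- l0) * (\<Sum>j\<le>k. fps_nth (Abs_fps (\<lambda>k. if k = 0 then 0 else l k) ^ j) k / fact j)"
proof -
  define G where "G = Abs_fps (\<lambda>k. if k = 0 then 0 else l k)"
  \<comment> \<open>Splitting off the constant coefficient leaves \<open>R n\<close> divisible by X,
    so \<open>R n ^ j\<close> has no term of degree below \<open>j\<close> and the binomial
    expansion stops at \<open>j = k\<close>. The factor \<open>K n\<close> moved into
    \<open>KR n\<close> makes its coefficients converge.\<close>
  define R where "R n = Abs_fps (\<lambda>k. if k = 0 then 0 else a n k)" for n
  define KR where "KR n = fps_const (real (K n)) * R n" for n
  have dec: "Abs_fps (a n) = R n + fps_const (a n 0)" for n
    by (rule fps_ext) (simp add: R_def)
  have KRlim: "(\<lambda>n. fps_nth (KR n) k) \<longlonglongrightarrow> fps_nth G k" for k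
    using a[of k] by (auto simp: KR_def R_def G_def)
  have vanish: "fps_nth (R n ^ j) k = 0" if "k < j" for n j
    using startsby_zero_power_prefix[of "R n" j] that by (auto simp: R_def)
  note pe = power_tendsto_exp[OF K a0]
  have Kk: "eventually (\<lambda>n. K n \<ge> k \<and> K n > 0) sequentially"
    using filterlim_at_top[THEN iffD1, OF K, rule_format, of "Suc k"] by eventually_elim simp
  have a0pos: "eventually (\<lambda>n. a n 0 > 0) sequentially"
    using pe(2) by (rule order_tendstoD) simp
  have summand: "(\<lambda>n. (real (K n choose j) / real (K n) ^ j) * (a n 0 ^ K n / a n 0 ^ j) * fps_nth (KR n ^ j) k)
      \<longlonglongrightarrow> (1 / fact j) * (exp (- l0) / 1 ^ j) * fps_nth (G ^ j) k" for j
    by (intro tendsto_intros binomial_over_power_tendsto K pe fps_nth_power_tendsto KRlim) simp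
  have "(\<lambda>n. \<Sum>j\<le>k. (real (K n choose j) / real (K n) ^ j) * (a n 0 ^ K n / a n 0 ^ j) * fps_nth (KR n ^ j) k)
      \<longlonglongrightarrow> (\<Sum>j\<le>k. (1 / fact j) * (exp (- l0) / 1 ^ j) * fps_nth (G ^ j) k)"
    by (intro tendsto_sum summand)
  moreover have "eventually (\<lambda>n. (\<Sum>j\<le>k. (real (K n choose j) / real (K n) ^ j) * (a n 0 ^ K n / a n 0 ^ j)
      * fps_nth (KR n ^ j) k) = fps_nth (Abs_fps (a n) ^ K n) k) sequentially"
    using Kk a0pos
  proof eventually_elim
    case (elim n)
    have "fps_nth (Abs_fps (a n) ^ K n) k
        = (\<Sum>j\<le>K n. fps_nth (of_nat (K n choose j) * R n ^ j * fps_const (a n 0) ^ (K n - j)) k)"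
      unfolding dec binomial_ring fps_sum_nth ..
    also have "\<dots> = (\<Sum>j\<le>K n. real (K n choose j) * fps_nth (R n ^ j) k * a n 0 ^ (K n - j))"
      by (simp add: fps_const_power mult.assoc fps_of_nat[symmetric] del: fps_of_nat fps_const_mult)
    also have "\<dots> = (\<Sum>j\<le>k. real (K n choose j) * fps_nth (R n ^ j) k * a n 0 ^ (K n - j))"
      using elim by (intro sum.mono_neutral_right) (auto simp: vanish)
    also have "\<dots> = (\<Sum>j\<le>k. (real (K n choose j) / real (K n) ^ j) * (a n 0 ^ K n / a n 0 ^ j)
      * fps_nth (KR n ^ j) k)"
    proof (rule sum.cong)
      fix j assume "j \<in> {..k}"
      then have "a n 0 ^ (K n - j) = a n 0 ^ K n / a n 0 ^ j"
        using elim by (simp add: power_diff)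
      moreover have "fps_nth (KR n ^ j) k = real (K n) ^ j * fps_nth (R n ^ j) k"
        by (simp add: KR_def power_mult_distrib fps_const_power)
      ultimately show "real (K n choose j) * fps_nth (R n ^ j) k * a n 0 ^ (K n - j) =
        (real (K n choose j) / real (K n) ^ j) * (a n 0 ^ K n / a n 0 ^ j) * fps_nth (KR n ^ j) k"
        using elim by simp
    qed simp
    finally show ?case by simp
  qed
  ultimately have "(\<lambda>n. fps_nth (Abs_fps (a n) ^ K n) k)
      \<longlonglongrightarrow> (\<Sum>j\<le>k. (1 / fact j) * (exp (- l0) / 1 ^ j) * fps_nth (G ^ j) k)"
    by (rule Lim_transform_eventually)
  then show ?thesis
    by (simp add: G_def sum_distrib_left)
qed

text \<open>The base is the expansion of c X / (1 - q X). The binomial counts the ways to write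
  \<open>k\<close> as a sum of \<open>j + 1\<close> positive parts; each part contributes a factor
  \<open>c\<close>, and the powers of \<open>q\<close> multiply up to
  \<open>k - Suc j\<close>.\<close>

lemma fps_nth_power_geometric:
  fixes c q :: real
  shows "fps_nth (Abs_fps (\<lambda>k. if k = 0 then 0 else c * q ^ (k - 1)) ^ Suc j) k =
    (if k \<le> j then 0 else c ^ Suc j * q ^ (k - Suc j) * real ((k - 1) choose j))"
proof -
  define G where "G = Abs_fps (\<lambda>k. if k = 0 then 0 else c * q ^ (k - 1))"
  have G0: "fps_nth G 0 = 0" and G1: "k > 0 \<Longrightarrow> fps_nth G k = c * q ^ (k - 1)" for k
    by (auto simp: G_def)
  have "fps_nth (G ^ Suc j) k =
    (if k \<le> j then 0 else c ^ Suc j * q ^ (k - Suc j) * real ((k - 1) choose j))"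
  proof (induction j arbitrary: k)
    case 0
    then show ?case using G0 G1[of k] by auto
  next
    case (Suc j)
    show ?case
    proof (cases "k \<le> Suc j")
      case True
      have "fps_nth (G ^ Suc (Suc j)) k = 0"
        using startsby_zero_power_prefix[of G "Suc (Suc j)"] True G0 by auto
      then show ?thesis using True by simp
    next
      case False
      then obtain d where k: "k = Suc (Suc j) + d"
        using le_Suc_ex[of "Suc (Suc j)" k] by auto
      have "fps_nth (G ^ Suc (Suc j)) k = (\<Sum>i=0..k. fps_nth (G ^ Suc j) i * fps_nth G (k - i))"
        unfolding power_Suc2[of G "Suc j"] fps_mult_nth ..
      also have "\<dots> = (\<Sum>i=Suc j..Suc j + d. c ^ Suc j * q ^ (i - Suc j) * real ((i - 1) choose j) * (c * q ^ (k - i - 1)))"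
        by (intro sum.mono_neutral_cong_right) (auto simp: Suc.IH G0 G1 k simp del: power_Suc)
      also have "\<dots> = (\<Sum>i=Suc j..Suc j + d. c ^ Suc (Suc j) * q ^ d * real ((i - 1) choose j))"
      proof (rule sum.cong)
        fix i assume "i \<in> {Suc j..Suc j + d}"
        then have "q ^ d = q ^ (i - Suc j) * q ^ (k - i - 1)"
          by (simp add: k flip: power_add)
        then show "c ^ Suc j * q ^ (i - Suc j) * real ((i - 1) choose j) * (c * q ^ (k - i - 1)) =
            c ^ Suc (Suc j) * q ^ d * real ((i - 1) choose j)"
          by simp
      qed simp
      also have "\<dots> = c ^ Suc (Suc j) * q ^ d * real (\<Sum>i=Suc j..Suc j + d. (i - 1) choose j)"
        by (simp only: sum_distrib_left of_nat_sum)
      \<comment> \<open>What remains is the hockey-stick identity; the summands with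
        \<open>i < j\<close> that it includes vanish.\<close>
      also have "(\<Sum>i=Suc j..Suc j + d. (i - 1) choose j) = (\<Sum>i=j..j + d. i choose j)"
        using sum.shift_bounds_cl_Suc_ivl[of "\<lambda>i. (i - 1) choose j" j "j + d"] by simp
      also have "\<dots> = (\<Sum>i\<le>j + d. i choose j)"
        by (intro sum.mono_neutral_left) (auto simp: binomial_eq_0)
      also have "\<dots> = Suc (j + d) choose Suc j"
        using sum_choose_upper[of j "j + d"] by simp
      finally show ?thesis using False by (simp add: k)
    qed
  qed
  then show ?thesis by (simp only: G_def)
qed

section \<open>Counting visits of a measure-preserving map\<close>

text \<open>Arbitrary index sets serve for initial segments, for return times from 1 on, and for
  unions of separated blocks.\<close>

definition visits :: "('a \<Rightarrow> 'a) \<Rightarrow> 'a set \<Rightarrow> nat set \<Rightarrow> 'a \<Rightarrow> nat" where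
  "visits T A I x = (\<Sum>i\<in>I. indicator A ((T ^^ i) x))"

lemma visits_eq_card: "finite I \<Longrightarrow> visits T A I x = card {i \<in> I. (T ^^ i) x \<in> A}"
  unfolding visits_def indicator_def
  by (simp add: sum.If_cases Int_def)

lemma visits_shift: "visits T A ((+) c ` I) x = visits T A I ((T ^^ c) x)"
  unfolding visits_def by (subst sum.reindex) (auto simp: funpow_add add.commute[of c])

lemma visits_lessThan_Suc: "visits T A {..<Suc s} x = indicator A x + visits T A {1..s} x"
proof -
  have "{..<Suc s} = insert 0 {1..s}" by auto
  then show ?thesis unfolding visits_def by simp
qed

lemma visits_1: "visits T A {1..s} x = visits T A {..<s} (T x)"
proof -
  have "{1..s} = (+) 1 ` {..<s}" by (simp add: image_Suc_lessThan flip: Suc_eq_plus1_left)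
  then show ?thesis using visits_shift[of T A 1 "{..<s}" x] by simp
qed

text \<open>The recursion peels off the first block and shifts the others by \<open>L\<close>, so
  that an induction on \<open>K\<close> needs only the independence of one block from everything
  after time \<open>L\<close>.\<close>

primrec blocks :: "nat \<Rightarrow> nat \<Rightarrow> nat \<Rightarrow> nat set" where
  "blocks s L 0 = {}"
| "blocks s L (Suc K) = {..<s} \<union> (+) L ` blocks s L K"

lemma finite_blocks [simp]: "finite (blocks s L K)"
  by (induction K) auto

lemma blocks_subset: "s \<le> L \<Longrightarrow> blocks s L K \<subseteq> {..<K * L}"
  by (induction K) (auto simp: subset_iff)

lemma card_blocks: "s \<le> L \<Longrightarrow> card (blocks s L K) = K * s"
  by (induction K) (simp, subst blocks.simps, subst card_Un_disjoint, auto simp: card_image)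

lemma visits_blocks_Suc:
  "s \<le> L \<Longrightarrow> visits T A (blocks s L (Suc K)) x
    = visits T A {..<s} x + visits T A (blocks s L K) ((T ^^ L) x)"
  using visits_shift[of T A L "blocks s L K" x]
  by (simp add: visits_def) (subst sum.union_disjoint, auto)

locale mpt = prob_space M for M :: "'a measure" +
  fixes T :: "'a \<Rightarrow> 'a"
  assumes T_measurable [measurable]: "T \<in> measurable M M"
    and T_invariant: "distr M M T = M"
begin

lemma funpow_measurable [measurable]: "(T ^^ i) \<in> measurable M M"
proof (induction i)
  case (Suc i)
  then show ?case using measurable_comp[OF Suc T_measurable] by simp
qed (simp add: id_def)

lemma prob_vimage_funpow:
  assumes "S \<in> sets M"
  shows "prob ((T ^^ i) -` S \<inter> space M) = prob S"
proof (induction i)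
  case 0
  show ?case using assms by (simp add: sets.Int_space_eq2)
next
  case (Suc i)
  have "prob ((T ^^ Suc i) -` S \<inter> space M) = measure M (T -` ((T ^^ i) -` S \<inter> space M) \<inter> space M)"
    using measurable_space[OF T_measurable]
    by (intro arg_cong[where f = prob]) (auto simp: funpow_swap1)
  also have "\<dots> = measure (distr M M T) ((T ^^ i) -` S \<inter> space M)"
    using assms by (subst measure_distr) auto
  finally show ?case using Suc T_invariant by (simp del: funpow.simps)
qed

lemma prob_funpow:
  assumes "{x \<in> space M. P x} \<in> sets M"
  shows "prob {x \<in> space M. P ((T ^^ i) x)} = prob {x \<in> space M. P x}"
proof -
  have "{x \<in> space M. P ((T ^^ i) x)} = (T ^^ i) -` {x \<in> space M. P x} \<inter> space M"
    using measurable_space[OF funpow_measurable] by auto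
  then show ?thesis using prob_vimage_funpow[OF assms] by simp
qed

lemma visits_sets [measurable]:
  assumes [measurable]: "A \<in> sets M"
  shows "{x \<in> space M. visits T A I x = k} \<in> sets M"
proof -
  have "(visits T A I x = k) \<longleftrightarrow> (\<Sum>i\<in>I. indicat_real A ((T ^^ i) x)) = real k" for x
  proof -
    have "(\<Sum>i\<in>I. indicat_real A ((T ^^ i) x)) = real (visits T A I x)"
      unfolding visits_def of_nat_sum by (intro sum.cong) (auto simp: indicator_def)
    then show ?thesis by simp
  qed
  then show ?thesis by simp measurable
qed

lemma visits_return_sets [measurable]:
  assumes [measurable]: "A \<in> sets M"
  shows "{x \<in> A. visits T A I x = k} \<in> sets M"
proof -
  have "{x \<in> A. visits T A I x = k} = A \<inter> {x \<in> space M. visits T A I x = k}"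
    using sets.sets_into_space[OF assms] by auto
  then show ?thesis by simp
qed

text \<open>Replacing the target by its preimage under \<open>m\<close> steps only delays the
  visits, and invariance of the measure absorbs the delay. This allows the past coordinate of a ball
  to be traded for digits.\<close>

lemma prob_visits_vimage:
  assumes "A \<in> sets M"
  shows "prob {x \<in> space M. visits T ((T ^^ m) -` A \<inter> space M) I x = k} = prob {x \<in> space M. visits T A I x = k}"
proof -
  have "visits T ((T ^^ m) -` A \<inter> space M) I x = visits T A I ((T ^^ m) x)" if "x \<in> space M" for x
    using that measurable_space[OF funpow_measurable that] unfolding visits_def
    by (intro sum.cong) (auto simp: indicator_def funpow_add[symmetric] add.commute
        simp flip: comp_apply[of "T ^^ _" "T ^^ _"])
  then have "{x \<in> space M. visits T ((T ^^ m) -` A \<inter> space M) I x = k}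
    = {x \<in> space M. visits T A I ((T ^^ m) x) = k}" by auto
  then show ?thesis using prob_funpow[of "\<lambda>x. visits T A I x = k" m] assms by simp
qed

text \<open>A union bound: the counts agree unless a time in \<open>J\<close> falls into the
  symmetric difference or a discarded time in \<open>I - J\<close> visits \<open>B\<close>. By
  invariance the probabilities of these events do not depend on the time.\<close>

lemma prob_visits_diff:
  assumes [measurable]: "A \<in> sets M" "B \<in> sets M" and "finite I" "J \<subseteq> I"
  shows "\<bar>prob {x \<in> space M. visits T B I x = k} - prob {x \<in> space M. visits T A J x = k}\<bar>
    \<le> card J * prob ((A - B) \<union> (B - A)) + card (I - J) * prob B"
proof -
  let ?U = "{x \<in> space M. visits T B I x = k}" and ?V = "{x \<in> space M. visits T A J x = k}"
  define D where "D i = (T ^^ i) -` ((A - B) \<union> (B - A)) \<inter> space M" for i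
  define E where "E i = (T ^^ i) -` B \<inter> space M" for i
  define X where "X = (\<Union>i\<in>J. D i) \<union> (\<Union>i\<in>I - J. E i)"
  have fJ: "finite J" using assms finite_subset by blast
  have [measurable]: "D i \<in> sets M" "E i \<in> sets M" for i
    unfolding D_def E_def by measurable
  have Xs: "X \<in> sets M" unfolding X_def using fJ \<open>finite I\<close> by auto
  have eq: "visits T B I x = visits T A J x" if "x \<in> space M" "x \<notin> X" for x
  proof -
    have "visits T B I x = visits T B J x"
      unfolding visits_def using assms that
      by (intro sum.mono_neutral_right) (auto simp: X_def E_def indicator_def)
    also have "\<dots> = visits T A J x"
      unfolding visits_def using that
      by (intro sum.cong) (auto simp: X_def D_def indicator_def)
    finally show ?thesis .
  qed
  have "prob ?U \<le> prob (?V \<union> X)" "prob ?V \<le> prob (?U \<union> X)"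
    using eq Xs by (auto intro!: finite_measure_mono)
  moreover have "prob (?V \<union> X) \<le> prob ?V + prob X" "prob (?U \<union> X) \<le> prob ?U + prob X"
    using Xs by (auto intro!: measure_Un_le)
  moreover have "prob X \<le> (\<Sum>i\<in>J. prob (D i)) + (\<Sum>i\<in>I - J. prob (E i))"
    unfolding X_def using fJ \<open>finite I\<close>
    by (intro order_trans[OF measure_Un_le] add_mono finite_measure_subadditive_finite) auto
  moreover have "prob (D i) = prob ((A - B) \<union> (B - A))" "prob (E i) = prob B" for i
    unfolding D_def E_def by (rule prob_vimage_funpow; measurable)+
  ultimately show ?thesis by simp
qed

text \<open>The windows from 0 to \<open>s\<close> and from 1 to \<open>s\<close> differ only for a
  start in \<open>B\<close>, where the former counts one visit more; by invariance the latter has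
  the law of \<open>{..<s}\<close>. The case \<open>k = 0\<close> is set apart because
  \<open>k - 1\<close> would be truncated to 0.\<close>

lemma prob_visits_Suc:
  assumes [measurable]: "B \<in> sets M"
  shows "prob {x \<in> space M. visits T B {..<Suc s} x = k} = prob {x \<in> space M. visits T B {..<s} x = k}
     + (if k = 0 then 0 else prob {x \<in> B. visits T B {1..s} x = k - 1}) - prob {x \<in> B. visits T B {1..s} x = k}"
proof -
  define R where "R = {x \<in> space M. visits T B {1..s} x = k} - B"
  have [measurable]: "R \<in> sets M" unfolding R_def by measurable
  have sub: "x \<in> B \<Longrightarrow> x \<in> space M" for x using sets.sets_into_space[OF assms] by auto
  have "prob {x \<in> space M. visits T B {..<s} x = k} = prob {x \<in> space M. visits T B {1..s} x = k}"
    unfolding visits_1 using prob_funpow[of "\<lambda>x. visits T B {..<s} x = k" 1] by simp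
  also have "\<dots> = prob ({x \<in> B. visits T B {1..s} x = k} \<union> R)"
    by (intro arg_cong[where f = prob]) (auto simp: R_def sub)
  also have "\<dots> = prob {x \<in> B. visits T B {1..s} x = k} + prob R"
    by (intro finite_measure_Union) (auto simp: R_def)
  finally have 1: "prob {x \<in> space M. visits T B {..<s} x = k} = prob {x \<in> B. visits T B {1..s} x = k} + prob R" .
  have "prob {x \<in> space M. visits T B {..<Suc s} x = k}
    = prob (R \<union> (if k = 0 then {} else {x \<in> B. visits T B {1..s} x = k - 1}))"
    unfolding visits_lessThan_Suc
    by (intro arg_cong[where f = prob]) (auto simp: R_def sub indicator_def split: if_splits)
  also have "\<dots> = prob R + (if k = 0 then 0 else prob {x \<in> B. visits T B {1..s} x = k - 1})"
    by (subst finite_measure_Union) (auto simp: R_def)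
  finally show ?thesis using 1 by simp
qed

lemma prob_visits_eq_sum:
  assumes "B \<in> sets M"
  shows "prob {x \<in> space M. visits T B {..<s} x = k} = (if k = 0 then 1 else 0)
     + (if k = 0 then 0 else (\<Sum>t<s. prob {x \<in> B. visits T B {1..t} x = k - 1}))
     - (\<Sum>t<s. prob {x \<in> B. visits T B {1..t} x = k})"
proof (induction s)
  case 0
  show ?case by (simp add: visits_def prob_space)
next
  case (Suc s)
  show ?case unfolding prob_visits_Suc[OF assms, of s k] Suc by simp
qed

text \<open>Summing over the number \<open>a\<close> of visits in the first block gives a Cauchy
  product, so every further block multiplies the generating function by the same factor.\<close>

lemma visits_blocks_fps:
  assumes [measurable]: "A \<in> sets M" and "s \<le> L"
    and indep: "\<And>a I b. finite I \<Longrightarrow>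
      prob {x \<in> space M. visits T A {..<s} x = a \<and> visits T A I ((T ^^ L) x) = b}
      = prob {x \<in> space M. visits T A {..<s} x = a} * prob {x \<in> space M. visits T A I x = b}"
  shows "Abs_fps (\<lambda>k. prob {x \<in> space M. visits T A (blocks s L K) x = k})
    = Abs_fps (\<lambda>k. prob {x \<in> space M. visits T A {..<s} x = k}) ^ K"
proof (induction K)
  case 0
  show ?case by (rule fps_ext) (auto simp: visits_def prob_space)
next
  case (Suc K)
  let ?X = "\<lambda>k a. {x \<in> space M. visits T A {..<s} x = a \<and> visits T A (blocks s L K) ((T ^^ L) x) = k - a}"
  show ?case
  proof (rule fps_ext)
    fix k
    have [measurable]: "?X k a \<in> sets M" for a
    proof -
      have "?X k a = {x \<in> space M. visits T A {..<s} x = a}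
          \<inter> ((T ^^ L) -` {x \<in> space M. visits T A (blocks s L K) x = k - a} \<inter> space M)"
        using measurable_space[OF funpow_measurable] by auto
      then show ?thesis by simp
    qed
    have "prob {x \<in> space M. visits T A (blocks s L (Suc K)) x = k} = prob (\<Union>a\<in>{0..k}. ?X k a)"
      unfolding visits_blocks_Suc[OF \<open>s \<le> L\<close>] by (intro arg_cong[where f = prob]) auto
    also have "\<dots> = (\<Sum>a=0..k. prob (?X k a))"
      by (intro finite_measure_finite_Union) (auto simp: disjoint_family_on_def)
    also have "\<dots> = (\<Sum>a=0..k. prob {x \<in> space M. visits T A {..<s} x = a}
        * prob {x \<in> space M. visits T A (blocks s L K) x = k - a})"
      by (simp add: indep)
    finally have fin: "prob {x \<in> space M. visits T A (blocks s L (Suc K)) x = k} = (\<Sum>a=0..k. prob {x \<in> space M. visits T A {..<s} x = a}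
        * prob {x \<in> space M. visits T A (blocks s L K) x = k - a})" .
    show "fps_nth (Abs_fps (\<lambda>k. prob {x \<in> space M. visits T A (blocks s L (Suc K)) x = k})) k =
      fps_nth (Abs_fps (\<lambda>k. prob {x \<in> space M. visits T A {..<s} x = k}) ^ Suc K) k"
      unfolding power_Suc Suc[symmetric] fps_mult_nth fps_nth_Abs_fps by (rule fin)
  qed
qed

end

section \<open>The compound Poisson limit\<close>

text \<open>The coefficient of X^k in exp (G - \<tau> \<Theta>), where G has the coefficients \<tau>
  \<Theta> times the geometric weights \<Theta> (1 - \<Theta>)^(k - 1): clusters arrive at rate
  \<tau> \<Theta> and have geometric size. The exponential series may stop at \<open>j = k\<close>
  because G has no constant term.\<close>

definition compound_poisson_mass :: "real \<Rightarrow> real \<Rightarrow> nat \<Rightarrow> real" where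
  "compound_poisson_mass \<Theta> \<tau> k = exp (- (\<tau> * \<Theta>)) *
    (\<Sum>j\<le>k. fps_nth (Abs_fps (\<lambda>k. if k = 0 then 0 else (\<tau> * \<Theta>\<^sup>2) * (1 - \<Theta>) ^ (k - 1)) ^ j) k / fact j)"

lemma compound_poisson_mass_eq_polya_aeppli: "compound_poisson_mass \<Theta> \<tau> k = polya_aeppli_mass \<Theta> \<tau> k"
proof (cases k)
  case 0
  then show ?thesis by (simp add: compound_poisson_mass_def polya_aeppli_mass_def mult.commute)
next
  case (Suc k')
  let ?G = "Abs_fps (\<lambda>k. if k = 0 then 0 else (\<tau> * \<Theta>\<^sup>2) * (1 - \<Theta>) ^ (k - 1))"
  have "(\<Sum>j\<le>k. fps_nth (?G ^ j) k / fact j) = (\<Sum>j=1..k. fps_nth (?G ^ j) k / fact j)"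
    using Suc by (intro sum.mono_neutral_right) (auto simp: not_le)
  also have "\<dots> = (\<Sum>j=1..k. (1 - \<Theta>) ^ (k - j) * \<Theta> ^ (2 * j) * (\<tau> ^ j / fact j) * real ((k - 1) choose (j - 1)))"
  proof (rule sum.cong)
    fix j assume j: "j \<in> {1..k}"
    then obtain i where i: "j = Suc i" by (cases j) auto
    have "fps_nth (?G ^ j) k = (\<tau> * \<Theta>\<^sup>2) ^ j * (1 - \<Theta>) ^ (k - j) * real ((k - 1) choose (j - 1))"
      unfolding i fps_nth_power_geometric using j i by simp
    then show "fps_nth (?G ^ j) k / fact j
      = (1 - \<Theta>) ^ (k - j) * \<Theta> ^ (2 * j) * (\<tau> ^ j / fact j) * real ((k - 1) choose (j - 1))"
      by (simp add: power_mult_distrib power_mult[symmetric])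
  qed simp
  finally show ?thesis
    using Suc by (simp add: compound_poisson_mass_def polya_aeppli_mass_def mult.commute)
qed

text \<open>\<open>A n\<close> replaces the preimage of \<open>B n\<close> with an error that is
  o(\<open>b n\<close>), as it is incurred at about \<open>\<tau> / b n\<close> times. The limit of
  \<open>L / s\<close> makes the gaps negligible, and that of \<open>s b\<close> makes the number of
  blocks tend to infinity. The assumption \<open>local\<close> says that, given a start in
  \<open>B n\<close>, the number of returns is nearly geometric for all horizons between a fixed
  \<open>P\<close> and \<open>s n\<close>.\<close>

lemma (in mpt) visits_compound_poisson_limit:
  fixes B A :: "nat \<Rightarrow> 'a set" and m s L :: "nat \<Rightarrow> nat" and \<Theta> \<tau> :: real
  defines "b n \<equiv> prob (B n)"
  assumes [measurable]: "\<And>n. A n \<in> sets M" "\<And>n. B n \<in> sets M"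
    and b_pos: "\<And>n. 0 < b n" and b0: "b \<longlonglongrightarrow> 0"
    and s_top: "filterlim s at_top sequentially" and sL: "\<And>n. s n \<le> L n"
    and Ls: "(\<lambda>n. real (L n) / real (s n)) \<longlonglongrightarrow> 1"
    and sb: "(\<lambda>n. real (s n) * b n) \<longlonglongrightarrow> 0"
    and err: "(\<lambda>n. prob ((A n - ((T ^^ m n) -` B n \<inter> space M)) \<union> (((T ^^ m n) -` B n \<inter> space M) - A n)) / b n) \<longlonglongrightarrow> 0"
    and indep: "\<And>n a I b. finite I \<Longrightarrow>
      prob {x \<in> space M. visits T (A n) {..<s n} x = a \<and> visits T (A n) I ((T ^^ L n) x) = b}
      = prob {x \<in> space M. visits T (A n) {..<s n} x = a} * prob {x \<in> space M. visits T (A n) I x = b}"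
    and local: "\<And>k \<epsilon>. \<epsilon> > 0 \<Longrightarrow> \<exists>P. eventually (\<lambda>n. \<forall>t. P \<le> t \<and> t \<le> s n \<longrightarrow>
      \<bar>prob {x \<in> B n. visits T (B n) {1..t} x = k} - \<Theta> * (1 - \<Theta>) ^ k * b n\<bar> \<le> \<epsilon> * b n) sequentially"
    and \<Theta>: "0 \<le> \<Theta>" "\<Theta> \<le> 1" and \<tau>: "\<tau> > 0"
  shows "(\<lambda>n. prob {x \<in> space M. visits T (B n) {0..nat \<lfloor>\<tau> / b n\<rfloor>} x = k})
    \<longlonglongrightarrow> compound_poisson_mass \<Theta> \<tau> k"
proof -
  define B' where "B' n = (T ^^ m n) -` B n \<inter> space M" for n
  define e where "e n = prob ((A n - B' n) \<union> (B' n - A n))" for n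
  define g where "g n t k = prob {x \<in> B n. visits T (B n) {1..t} x = k}" for n t k
  define N where "N n = nat \<lfloor>\<tau> / b n\<rfloor>" for n
  \<comment> \<open>The sum over \<open>0..N n\<close> has \<open>Suc (N n)\<close> times, of which
    \<open>K n\<close> complete periods of length \<open>L n\<close> are kept.\<close>
  define K where "K n = Suc (N n) div L n" for n
  define J where "J n = blocks (s n) (L n) (K n)" for n
  define a where "a n k = prob {x \<in> space M. visits T (A n) {..<s n} x = k}" for n k
  define f where "f n k = prob {x \<in> space M. visits T (B n) {..<s n} x = k}" for n k
  define \<theta> where "\<theta> k = \<Theta> * (1 - \<Theta>) ^ k" for k
  have [measurable]: "B' n \<in> sets M" for n
    unfolding B'_def by measurable
  have s_pos: "eventually (\<lambda>n. s n > 0) sequentially"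
    using filterlim_at_top[THEN iffD1, OF s_top, rule_format, of "Suc 0"] by (simp add: Suc_le_eq)
  have sr: "filterlim (\<lambda>n. real (s n)) at_top sequentially"
    using s_top by (rule filterlim_compose[OF filterlim_real_sequentially])
  have eb: "(\<lambda>n. e n / b n) \<longlonglongrightarrow> 0"
    using err by (simp add: e_def B'_def)

  have Nb: "(\<lambda>n. real (Suc (N n)) * b n) \<longlonglongrightarrow> \<tau>"
  proof (rule tendsto_sandwich)
    have N: "\<tau> / b n \<le> real (N n) + 1" "real (N n) \<le> \<tau> / b n" for n
      using b_pos[of n] \<tau> unfolding N_def by (auto simp: le_floor_iff)
    show "eventually (\<lambda>n. \<tau> \<le> real (Suc (N n)) * b n) sequentially"
      using N(1) b_pos by (intro always_eventually) (auto simp: field_simps)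
    show "eventually (\<lambda>n. real (Suc (N n)) * b n \<le> \<tau> + b n) sequentially"
      using N(2) b_pos by (intro always_eventually) (auto simp: field_simps)
    show "(\<lambda>n. \<tau> + b n) \<longlonglongrightarrow> \<tau>" using tendsto_add[OF tendsto_const b0, of \<tau>] by simp
  qed simp
  have Lb: "(\<lambda>n. real (L n) * b n) \<longlonglongrightarrow> 0"
  proof -
    have "(\<lambda>n. (real (L n) / real (s n)) * (real (s n) * b n)) \<longlonglongrightarrow> 1 * 0"
      by (intro tendsto_mult Ls sb)
    moreover have "eventually (\<lambda>n. (real (L n) / real (s n)) * (real (s n) * b n) = real (L n) * b n) sequentially"
      using s_pos by eventually_elim simp
    ultimately show ?thesis using Lim_transform_eventually by fastforce
  qed
  have KL: "K n * L n \<le> Suc (N n)" for n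
    unfolding K_def by simp
  have KLb: "(\<lambda>n. real (K n) * real (L n) * b n) \<longlonglongrightarrow> \<tau>"
  proof (rule tendsto_sandwich)
    show "eventually (\<lambda>n. real (Suc (N n)) * b n - real (L n) * b n \<le> real (K n) * real (L n) * b n) sequentially"
      using s_pos
    proof eventually_elim
      case (elim n)
      then have "L n > 0" using sL[of n] by simp
      then have "Suc (N n) \<le> K n * L n + L n"
        unfolding K_def using div_mult_mod_eq[of "Suc (N n)" "L n"] mod_less_divisor[of "L n" "Suc (N n)"] by linarith
      then have "real (Suc (N n)) \<le> real (K n) * real (L n) + real (L n)"
        by (metis of_nat_add of_nat_le_iff of_nat_mult)
      then have "real (Suc (N n)) * b n \<le> (real (K n) * real (L n) + real (L n)) * b n"
        using b_pos[of n] by (intro mult_right_mono) auto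
      then show ?case by (simp add: algebra_simps)
    qed
    show "eventually (\<lambda>n. real (K n) * real (L n) * b n \<le> real (Suc (N n)) * b n) sequentially"
    proof (intro always_eventually allI mult_right_mono)
      show "real (K n) * real (L n) \<le> real (Suc (N n))" for n
        using KL[of n] by (metis of_nat_le_iff of_nat_mult)
    qed (simp add: b_pos less_imp_le)
    show "(\<lambda>n. real (Suc (N n)) * b n - real (L n) * b n) \<longlonglongrightarrow> \<tau>"
      using tendsto_diff[OF Nb Lb] by simp
  qed (rule Nb)
  have Ksb: "(\<lambda>n. real (K n) * real (s n) * b n) \<longlonglongrightarrow> \<tau>"
  proof -
    have "(\<lambda>n. (real (K n) * real (L n) * b n) / (real (L n) / real (s n))) \<longlonglongrightarrow> \<tau> / 1"
      by (intro tendsto_divide KLb Ls) simp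
    moreover have "eventually (\<lambda>n. (real (K n) * real (L n) * b n) / (real (L n) / real (s n))
        = real (K n) * real (s n) * b n) sequentially"
      using s_pos
    proof eventually_elim
      case (elim n)
      then have "L n > 0" using sL[of n] by simp
      then show ?case using elim by simp
    qed
    ultimately show ?thesis using Lim_transform_eventually by fastforce
  qed
  have K_top: "filterlim K at_top sequentially"
  proof -
    have "eventually (\<lambda>n. 0 < real (L n) * b n) sequentially"
      using s_pos
    proof eventually_elim
      case (elim n)
      then have "L n > 0" using sL[of n] by simp
      then show ?case using b_pos[of n] by simp
    qed
    then have "filterlim (\<lambda>n. inverse (real (L n) * b n)) at_top sequentially"
      by (intro filterlim_inverse_at_top Lb)
    then have "filterlim (\<lambda>n. (real (K n) * real (L n) * b n) * inverse (real (L n) * b n)) at_top sequentially"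
      by (rule filterlim_tendsto_pos_mult_at_top[OF KLb \<tau>])
    moreover have *: "eventually (\<lambda>n. (real (K n) * real (L n) * b n) * inverse (real (L n) * b n) = real (K n)) sequentially"
      using s_pos
    proof eventually_elim
      case (elim n)
      then have "L n > 0" using sL[of n] by simp
      then show ?case using b_pos[of n] by (simp add: field_simps)
    qed
    ultimately have "filterlim (\<lambda>n. real (K n)) at_top sequentially"
      using filterlim_cong[OF refl refl *] by blast
    then show ?thesis
      by (simp add: filterlim_sequentially_iff_filterlim_real)
  qed

  have g_le: "0 \<le> g n t k" "g n t k \<le> b n" for n t k
    unfolding g_def b_def by (auto intro!: finite_measure_mono)
  have \<theta>_le: "0 \<le> \<theta> k" "\<theta> k \<le> 1" for k
    using \<Theta> by (auto simp: \<theta>_def intro!: mult_le_one power_le_one)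
  \<comment> \<open>In the average over the horizons \<open>t < s n\<close>, the first
    \<open>P\<close> terms contribute at most \<open>P / s n\<close>, and the others are uniformly
    close to the limit.\<close>
  have cesaro: "(\<lambda>n. (\<Sum>t<s n. g n t k) / (real (s n) * b n)) \<longlonglongrightarrow> \<theta> k" for k
  proof (rule LIMSEQ_I)
    fix r :: real assume r: "r > 0"
    obtain P where P: "eventually (\<lambda>n. \<forall>t. P \<le> t \<and> t \<le> s n \<longrightarrow> \<bar>g n t k - \<theta> k * b n\<bar> \<le> r / 3 * b n) sequentially"
      using local[of "r / 3" k] r unfolding g_def \<theta>_def by auto
    have "(\<lambda>n. real P / real (s n)) \<longlonglongrightarrow> 0"
      by (rule real_tendsto_divide_at_top[OF tendsto_const sr])
    then have "eventually (\<lambda>n. real P / real (s n) < r / 3) sequentially"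
      using r by (intro order_tendstoD) auto
    with P s_pos have "eventually (\<lambda>n. norm ((\<Sum>t<s n. g n t k) / (real (s n) * b n) - \<theta> k) < r) sequentially"
    proof eventually_elim
      case (elim n)
      have "\<bar>(\<Sum>t<s n. g n t k) - real (s n) * \<theta> k * b n\<bar> = \<bar>\<Sum>t<s n. (g n t k - \<theta> k * b n)\<bar>"
        by (simp add: sum_subtractf)
      also have "\<dots> \<le> (\<Sum>t<s n. \<bar>g n t k - \<theta> k * b n\<bar>)" by (rule sum_abs)
      also have "\<dots> \<le> (\<Sum>t<s n. (if t < P then b n else 0) + r / 3 * b n)"
      proof (rule sum_mono)
        fix t assume t: "t \<in> {..<s n}"
        have "\<theta> k * b n \<le> b n" "0 \<le> \<theta> k * b n"
          using \<theta>_le[of k] b_pos[of n] by (auto intro: mult_left_le_one_le)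
        moreover have "0 \<le> r / 3 * b n" using r b_pos[of n] by simp
        ultimately show "\<bar>g n t k - \<theta> k * b n\<bar> \<le> (if t < P then b n else 0) + r / 3 * b n"
          using elim(1)[rule_format, of t] t g_le[of n t k] by (cases "t < P") auto
      qed
      also have "\<dots> = real (card ({..<s n} \<inter> {..<P})) * b n + real (s n) * (r / 3 * b n)"
        by (simp add: sum.distrib sum.If_cases lessThan_def)
      also have "\<dots> \<le> real P * b n + real (s n) * (r / 3 * b n)"
        using b_pos[of n] card_mono[of "{..<P}" "{..<s n} \<inter> {..<P}"] r by (intro add_mono mult_right_mono) auto
      finally have "\<bar>(\<Sum>t<s n. g n t k) - real (s n) * \<theta> k * b n\<bar> / (real (s n) * b n)
          \<le> (real P * b n + real (s n) * (r / 3 * b n)) / (real (s n) * b n)"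
        using b_pos[of n] by (intro divide_right_mono) auto
      also have "\<dots> = real P / real (s n) + r / 3"
        using b_pos[of n] elim by (simp add: field_simps)
      also have "\<dots> < r" using elim r by linarith
      also have "\<bar>(\<Sum>t<s n. g n t k) - real (s n) * \<theta> k * b n\<bar> / (real (s n) * b n)
          = \<bar>((\<Sum>t<s n. g n t k) - real (s n) * \<theta> k * b n) / (real (s n) * b n)\<bar>"
        using b_pos[of n] by (simp add: abs_mult)
      also have "((\<Sum>t<s n. g n t k) - real (s n) * \<theta> k * b n) / (real (s n) * b n) = (\<Sum>t<s n. g n t k) / (real (s n) * b n) - \<theta> k"
        using b_pos[of n] elim by (simp add: diff_divide_distrib)
      finally show ?case by simp
    qed
    then show "\<exists>no. \<forall>n\<ge>no. norm ((\<Sum>t<s n. g n t k) / (real (s n) * b n) - \<theta> k) < r"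
      by (simp add: eventually_sequentially)
  qed
  have Kg: "(\<lambda>n. real (K n) * (\<Sum>t<s n. g n t k)) \<longlonglongrightarrow> \<tau> * \<theta> k" for k
  proof -
    have "(\<lambda>n. (real (K n) * real (s n) * b n) * ((\<Sum>t<s n. g n t k) / (real (s n) * b n))) \<longlonglongrightarrow> \<tau> * \<theta> k"
      by (intro tendsto_mult Ksb cesaro)
    moreover have "eventually (\<lambda>n. (real (K n) * real (s n) * b n) * ((\<Sum>t<s n. g n t k) / (real (s n) * b n))
        = real (K n) * (\<Sum>t<s n. g n t k)) sequentially"
      using s_pos
    proof eventually_elim
      case (elim n)
      then show ?case using b_pos[of n] by simp
    qed
    ultimately show ?thesis by (rule Lim_transform_eventually)
  qed
  have f_eq: "f n k = (if k = 0 then 1 else 0) + (if k = 0 then 0 else (\<Sum>t<s n. g n t (k - 1))) - (\<Sum>t<s n. g n t k)" for n k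
    unfolding f_def g_def by (rule prob_visits_eq_sum) simp

  have Kse: "(\<lambda>n. real (K n) * real (s n) * e n) \<longlonglongrightarrow> 0"
  proof -
    have "(\<lambda>n. (real (K n) * real (s n) * b n) * (e n / b n)) \<longlonglongrightarrow> \<tau> * 0"
      by (intro tendsto_mult Ksb eb)
    moreover have "(real (K n) * real (s n) * b n) * (e n / b n) = real (K n) * real (s n) * e n" for n
      using b_pos[of n] by simp
    ultimately show ?thesis by simp
  qed
  \<comment> \<open>Both counts run over the same times, so only the symmetric difference matters;
    the count for \<open>B' n\<close> has the law of the count for \<open>B n\<close>.\<close>
  have fa: "\<bar>f n k - a n k\<bar> \<le> real (s n) * e n" for n k
    using prob_visits_diff[of "A n" "B' n" "{..<s n}" "{..<s n}" k]
      prob_visits_vimage[of "B n" "m n" "{..<s n}" k]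
    by (simp add: f_def a_def e_def B'_def)
  have Kfa: "(\<lambda>n. real (K n) * (f n k - a n k)) \<longlonglongrightarrow> 0" for k
  proof (rule Lim_null_comparison[OF always_eventually Kse], intro allI)
    show "norm (real (K n) * (f n k - a n k)) \<le> real (K n) * real (s n) * e n" for n
      using mult_left_mono[OF fa[of n k], of "real (K n)"] by (simp add: abs_mult mult.assoc)
  qed
  \<comment> \<open>By \<open>f_eq\<close>, the probability that a block is visited is the sum of
    the \<open>g n t 0\<close>, the probabilities of a visit without a return: each cluster is
    counted once, at its last visit.\<close>
  have a0: "(\<lambda>n. real (K n) * (1 - a n 0)) \<longlonglongrightarrow> \<tau> * \<Theta>"
  proof -
    have "(\<lambda>n. real (K n) * (\<Sum>t<s n. g n t 0) + real (K n) * (f n 0 - a n 0)) \<longlonglongrightarrow> \<tau> * \<theta> 0 + 0"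
      by (intro tendsto_add Kg Kfa)
    moreover have "real (K n) * (\<Sum>t<s n. g n t 0) + real (K n) * (f n 0 - a n 0) = real (K n) * (1 - a n 0)" for n
      unfolding f_eq by (simp add: algebra_simps)
    ultimately show ?thesis by (simp add: \<theta>_def)
  qed
  \<comment> \<open>The second factor \<Theta> of the limit arises from
    \<open>\<theta> (k - 1) - \<theta> k = \<Theta> * \<theta> (k - 1)\<close>.\<close>
  have ak: "(\<lambda>n. real (K n) * a n k) \<longlonglongrightarrow> (\<tau> * \<Theta>\<^sup>2) * (1 - \<Theta>) ^ (k - 1)" if k: "k \<ge> 1" for k
  proof -
    have "(\<lambda>n. real (K n) * (\<Sum>t<s n. g n t (k - 1)) - real (K n) * (\<Sum>t<s n. g n t k) - real (K n) * (f n k - a n k))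
        \<longlonglongrightarrow> \<tau> * \<theta> (k - 1) - \<tau> * \<theta> k - 0"
      by (intro tendsto_diff Kg Kfa)
    moreover have "real (K n) * (\<Sum>t<s n. g n t (k - 1)) - real (K n) * (\<Sum>t<s n. g n t k) - real (K n) * (f n k - a n k)
        = real (K n) * a n k" for n
      using k unfolding f_eq by (simp add: algebra_simps)
    moreover have "\<tau> * \<theta> (k - 1) - \<tau> * \<theta> k - 0 = (\<tau> * \<Theta>\<^sup>2) * (1 - \<Theta>) ^ (k - 1)"
      using k by (cases k) (auto simp: \<theta>_def power2_eq_square algebra_simps)
    ultimately show ?thesis by simp
  qed
  define h where "h n k = prob {x \<in> space M. visits T (A n) (J n) x = k}" for n k
  have "(\<lambda>n. fps_nth (Abs_fps (a n) ^ K n) k) \<longlonglongrightarrow> compound_poisson_mass \<Theta> \<tau> k"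
    unfolding compound_poisson_mass_def
    by (rule fps_nth_large_power_tendsto[where a = a and k = k, OF K_top a0 ak])
  moreover have "Abs_fps (h n) = Abs_fps (a n) ^ K n" for n
    unfolding h_def a_def J_def by (intro visits_blocks_fps sL indep) auto
  then have "fps_nth (Abs_fps (a n) ^ K n) k = h n k" for n
    by (metis fps_nth_Abs_fps)
  ultimately have h_lim: "(\<lambda>n. h n k) \<longlonglongrightarrow> compound_poisson_mass \<Theta> \<tau> k"
    by simp

  define F where "F n = prob {x \<in> space M. visits T (B n) {0..N n} x = k}" for n
  have J: "J n \<subseteq> {0..N n}" "card (J n) = K n * s n" for n
    using blocks_subset[OF sL, of n "K n"] card_blocks[OF sL, of n "K n"] KL[of n]
    unfolding J_def by force+
  \<comment> \<open>There are \<open>Suc (N n) - K n * s n\<close> times outside the blocks, each a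
    visit with probability \<open>b n\<close>. As \<open>Suc (N n) * b n\<close> and
    \<open>K n * s n * b n\<close> have the same limit \<tau>, these times do not count in the
    end.\<close>
  have F_h: "\<bar>F n - h n k\<bar> \<le> real (K n) * real (s n) * e n + (real (Suc (N n)) * b n - real (K n) * real (s n) * b n)" for n
  proof -
    have "card ({0..N n} - J n) = Suc (N n) - K n * s n"
      using J[of n] finite_subset[OF J(1)] by (subst card_Diff_subset) auto
    moreover have "K n * s n \<le> Suc (N n)"
      using J[of n] card_mono[OF _ J(1), of n] by simp
    ultimately have c: "real (card ({0..N n} - J n)) = real (Suc (N n)) - real (K n) * real (s n)"
      by (simp add: of_nat_diff)
    have "prob (B' n) = b n"
      unfolding B'_def b_def by (rule prob_vimage_funpow) simp
    moreover have "\<bar>F n - h n k\<bar> \<le> real (card (J n)) * e n + real (card ({0..N n} - J n)) * prob (B' n)"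
      using prob_visits_diff[of "A n" "B' n" "{0..N n}" "J n" k] J(1)
        prob_visits_vimage[of "B n" "m n" "{0..N n}" k]
      by (simp add: F_def h_def e_def B'_def)
    ultimately show ?thesis
      unfolding c J(2) by (simp add: algebra_simps)
  qed
  have "(\<lambda>n. F n - h n k) \<longlonglongrightarrow> 0"
  proof (rule Lim_null_comparison[OF always_eventually])
    show "\<forall>n. norm (F n - h n k) \<le> real (K n) * real (s n) * e n + (real (Suc (N n)) * b n - real (K n) * real (s n) * b n)"
      using F_h by simp
    show "(\<lambda>n. real (K n) * real (s n) * e n + (real (Suc (N n)) * b n - real (K n) * real (s n) * b n)) \<longlonglongrightarrow> 0"
      using tendsto_add[OF Kse tendsto_diff[OF Nb Ksb]] by simp
  qed
  then have "F \<longlonglongrightarrow> compound_poisson_mass \<Theta> \<tau> k"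
    using tendsto_add[OF _ h_lim, of "\<lambda>n. F n - h n k" 0] by simp
  then show ?thesis
    unfolding F_def N_def .
qed

section \<open>The doubling map\<close>

definition doubling :: "real \<Rightarrow> real" where
  "doubling y = (if y < 1/2 then 2 * y else 2 * y - 1)"

lemma doubling_range: "y \<in> {0..<1} \<Longrightarrow> doubling y \<in> {0..<1}"
  by (auto simp: doubling_def)

lemma doubling_measurable [measurable]: "doubling \<in> borel_measurable borel"
  unfolding doubling_def by measurable

lemma doubling_funpow_measurable [measurable]: "(doubling ^^ i) \<in> borel_measurable borel"
proof (induction i)
  case (Suc i)
  then show ?case using measurable_comp[OF Suc doubling_measurable] by simp
qed (simp add: id_def)

lemma doubling_funpow_range: "y \<in> {0..<1} \<Longrightarrow> (doubling ^^ i) y \<in> {0..<1}"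
  by (induction i) (auto simp: doubling_range simp del: atLeastLessThan_iff)

lemma floor_less_half_iff: "\<lfloor>2 ^ Suc q * y\<rfloor> < 2 ^ q \<longleftrightarrow> y < (1/2 :: real)"
proof -
  have "\<lfloor>2 ^ Suc q * y\<rfloor> < 2 ^ q \<longleftrightarrow> 2 ^ Suc q * y < 2 ^ q"
    by (simp add: floor_less_iff)
  also have "\<dots> \<longleftrightarrow> 2 ^ q * (2 * y) < 2 ^ q * 1" by (simp add: mult_ac)
  also have "\<dots> \<longleftrightarrow> 2 * y < 1" by (rule mult_less_cancel_left_pos) simp
  finally show ?thesis by auto
qed

text \<open>For \<open>y\<close> in the half-open unit interval, the floor of
  \<open>2 ^ q * y\<close> is the integer formed by the first \<open>q\<close> binary digits, and
  \<open>doubling\<close> deletes the leading digit.\<close>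

lemma floor_doubling: "\<lfloor>2 ^ q * doubling y\<rfloor> = \<lfloor>2 ^ Suc q * y\<rfloor> - (if y < 1/2 then 0 else 2 ^ q)"
proof -
  have "2 ^ q * (2 * y - 1) = 2 ^ Suc q * y - real_of_int (2 ^ q)" by (simp add: algebra_simps)
  then show ?thesis by (auto simp: doubling_def mult_ac floor_diff_of_int simp del: of_int_power)
qed

lemma same_dyadic_doubling:
  assumes "\<lfloor>2 ^ Suc q * y\<rfloor> = \<lfloor>2 ^ Suc q * y'\<rfloor>"
  shows "\<lfloor>2 ^ q * doubling y\<rfloor> = \<lfloor>2 ^ q * doubling y'\<rfloor>" and "y < 1/2 \<longleftrightarrow> y' < 1/2"
proof -
  show *: "y < 1/2 \<longleftrightarrow> y' < 1/2" using floor_less_half_iff assms by metis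
  show "\<lfloor>2 ^ q * doubling y\<rfloor> = \<lfloor>2 ^ q * doubling y'\<rfloor>"
    unfolding floor_doubling using * assms by simp
qed

lemma same_dyadic_funpow:
  assumes "\<lfloor>2 ^ (i + q) * y\<rfloor> = \<lfloor>2 ^ (i + q) * y'\<rfloor>"
  shows "\<lfloor>2 ^ q * (doubling ^^ i) y\<rfloor> = \<lfloor>2 ^ q * (doubling ^^ i) y'\<rfloor>"
  using assms
proof (induction i arbitrary: y y')
  case (Suc i)
  have "\<lfloor>2 ^ (i + q) * doubling y\<rfloor> = \<lfloor>2 ^ (i + q) * doubling y'\<rfloor>"
    using Suc.prems by (intro same_dyadic_doubling) simp
  from Suc.IH[OF this] show ?case by (simp add: funpow_swap1)
qed simp

lemma same_dyadic_coarsen: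
  fixes y y' :: real
  assumes "\<lfloor>2 ^ (i + q) * y\<rfloor> = \<lfloor>2 ^ (i + q) * y'\<rfloor>"
  shows "\<lfloor>2 ^ q * y\<rfloor> = \<lfloor>2 ^ q * y'\<rfloor>"
proof -
  have "\<lfloor>2 ^ q * t\<rfloor> = \<lfloor>2 ^ (i + q) * t\<rfloor> div 2 ^ i" for t :: real
  proof -
    have "2 ^ q * t = (2 ^ (i + q) * t) / real_of_int (2 ^ i)" by (simp add: power_add)
    then show ?thesis using floor_divide_real_eq_div[of "2 ^ i" "2 ^ (i + q) * t"] by simp
  qed
  then show ?thesis using assms by simp
qed

lemma same_dyadic_dist:
  fixes y y' :: real
  assumes "\<lfloor>2 ^ q * y\<rfloor> = \<lfloor>2 ^ q * y'\<rfloor>"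
  shows "\<bar>y - y'\<bar> < 1 / 2 ^ q"
proof -
  have "\<bar>2 ^ q * y - 2 ^ q * y'\<bar> < 1" using assms by linarith
  also have "2 ^ q * y - 2 ^ q * y' = 2 ^ q * (y - y')" by (simp add: algebra_simps)
  finally have "2 ^ q * \<bar>y - y'\<bar> < 1" by (simp add: abs_mult)
  then show ?thesis by (simp add: field_simps)
qed

lemma measure_lborel_affine:
  fixes A :: "real set"
  assumes [measurable]: "A \<in> sets borel" and "c \<noteq> 0"
  shows "measure lborel A = \<bar>c\<bar> * measure lborel ((\<lambda>x. t + c * x) -` A)"
proof -
  have "measure lborel A = measure (density (distr lborel borel (\<lambda>x. t + c * x)) (\<lambda>_. ennreal \<bar>c\<bar>)) A"
    using lborel_real_affine[OF \<open>c \<noteq> 0\<close>, of t] by simp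
  also have "\<dots> = \<bar>c\<bar> * measure (distr lborel borel (\<lambda>x. t + c * x)) A"
    by (subst measure_density_const) auto
  also have "measure (distr lborel borel (\<lambda>x. t + c * x)) A = measure lborel ((\<lambda>x. t + c * x) -` A)"
    by (subst measure_distr) auto
  finally show ?thesis .
qed

text \<open>The half-open interval is invariant under \<open>doubling\<close> and omits the fixed
  point 1, whose code \<open>2 ^ q\<close> would not be one of \<open>q\<close> digits.\<close>

definition leb :: "(real \<Rightarrow> bool) \<Rightarrow> real" where
  "leb Q = measure lborel {y \<in> {0..<1}. Q y}"

lemma fmeasurable_unit_interval [simp]:
  "{y. P y} \<in> sets borel \<Longrightarrow> {y \<in> {0..<1::real}. P y} \<in> fmeasurable lborel"
  by (rule fmeasurableI2[of "{0..<1}"]) (auto simp: fmeasurable_def Collect_conj_eq)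

lemma leb_halves:
  assumes [measurable]: "Measurable.pred borel P"
  shows "leb P = leb (\<lambda>y. P (y / 2)) / 2 + leb (\<lambda>y. P ((y + 1) / 2)) / 2"
proof -
  have "leb P = measure lborel ({y \<in> {0..<1}. y < 1/2 \<and> P y} \<union> {y \<in> {0..<1}. y \<ge> 1/2 \<and> P y})"
    unfolding leb_def by (intro arg_cong[where f = "measure lborel"]) auto
  also have "\<dots> = measure lborel {y \<in> {0..<1}. y < 1/2 \<and> P y} + measure lborel {y \<in> {0..<1}. y \<ge> 1/2 \<and> P y}"
    by (rule measure_Un_AE) (auto intro!: fmeasurable_unit_interval simp del: atLeastLessThan_iff)
  also have "measure lborel {y \<in> {0..<1}. y < 1/2 \<and> P y} = leb (\<lambda>y. P (y / 2)) / 2"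
    unfolding leb_def
    by (subst measure_lborel_affine[of _ "1/2" 0]) (auto intro!: arg_cong[where f = "measure lborel"])
  also have "measure lborel {y \<in> {0..<1}. y \<ge> 1/2 \<and> P y} = leb (\<lambda>y. P ((y + 1) / 2)) / 2"
    unfolding leb_def by (subst measure_lborel_affine[of _ "1/2" "1/2"])
      (auto intro!: arg_cong[where f = "measure lborel"] simp: add_divide_distrib add.commute)
  finally show ?thesis .
qed

lemma leb_cong: "(\<And>y. 0 \<le> y \<Longrightarrow> y < 1 \<Longrightarrow> P y = Q y) \<Longrightarrow> leb P = leb Q"
  unfolding leb_def by (intro arg_cong[where f = "measure lborel"]) auto

lemma leb_True [simp]: "leb (\<lambda>_. True) = 1" and leb_False [simp]: "leb (\<lambda>_. False) = 0"
proof -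
  have "{y \<in> {0..<1::real}. True} = {0..<1}" by auto
  then show "leb (\<lambda>_. True) = 1" unfolding leb_def by simp
qed (simp add: leb_def)

lemma dyadic_sets [measurable]: "Measurable.pred borel (\<lambda>y::real. \<lfloor>2 ^ q * y\<rfloor> \<in> S)"
  by measurable

text \<open>The first \<open>q\<close> digits of a uniform point are independent of its tail
  \<open>(doubling ^^ q) y\<close>. The induction goes through the two inverse branches of
  \<open>doubling\<close>; \<open>S\<close> is kept arbitrary because the right branch shifts the
  codes by \<open>2 ^ q\<close>.\<close>

lemma dyadic_indep:
  assumes [measurable]: "Measurable.pred borel F"
  shows "leb (\<lambda>y. \<lfloor>2 ^ q * y\<rfloor> \<in> S \<and> F ((doubling ^^ q) y)) = leb (\<lambda>y. \<lfloor>2 ^ q * y\<rfloor> \<in> S) * leb F"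
proof (induction q arbitrary: S)
  case 0
  have "\<lfloor>y\<rfloor> = 0" if "0 \<le> y" "y < 1" for y :: real using that by (simp add: floor_eq_iff)
  then have "leb (\<lambda>y. \<lfloor>y\<rfloor> \<in> S) = leb (\<lambda>y. 0 \<in> S)" "leb (\<lambda>y. \<lfloor>y\<rfloor> \<in> S \<and> F y) = leb (\<lambda>y. 0 \<in> S \<and> F y)"
    by (auto intro!: leb_cong)
  then show ?case by (cases "0 \<in> S") simp_all
next
  case (Suc q)
  let ?S' = "{c. c + 2 ^ q \<in> S}"
  have l: "\<lfloor>2 ^ Suc q * (y / 2)\<rfloor> = \<lfloor>2 ^ q * y\<rfloor>" for y :: real by simp
  have r: "\<lfloor>2 ^ Suc q * ((y + 1) / 2)\<rfloor> = \<lfloor>2 ^ q * y\<rfloor> + 2 ^ q" for y :: real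
  proof -
    have "2 ^ Suc q * ((y + 1) / 2) = 2 ^ q * y + real_of_int (2 ^ q)" by (simp add: algebra_simps)
    then show ?thesis by (simp only: floor_add_int)
  qed
  have dl: "doubling (y / 2) = y" and dr: "doubling ((y + 1) / 2) = y" if "0 \<le> y" "y < 1" for y
    using that by (auto simp: doubling_def field_simps)
  have "leb (\<lambda>y. \<lfloor>2 ^ Suc q * y\<rfloor> \<in> S \<and> F ((doubling ^^ Suc q) y))
    = leb (\<lambda>y. \<lfloor>2 ^ q * y\<rfloor> \<in> S \<and> F ((doubling ^^ q) y)) / 2
      + leb (\<lambda>y. \<lfloor>2 ^ q * y\<rfloor> \<in> ?S' \<and> F ((doubling ^^ q) y)) / 2"
  proof -
    have "Measurable.pred borel (\<lambda>y. \<lfloor>2 ^ Suc q * y\<rfloor> \<in> S \<and> F ((doubling ^^ Suc q) y))"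
      by measurable
    note leb_halves[OF this]
    also have "leb (\<lambda>y. \<lfloor>2 ^ Suc q * (y / 2)\<rfloor> \<in> S \<and> F ((doubling ^^ Suc q) (y / 2)))
      = leb (\<lambda>y. \<lfloor>2 ^ q * y\<rfloor> \<in> S \<and> F ((doubling ^^ q) y))"
      unfolding l funpow_Suc_right comp_def by (intro leb_cong) (simp only: dl)
    also have "leb (\<lambda>y. \<lfloor>2 ^ Suc q * ((y + 1) / 2)\<rfloor> \<in> S \<and> F ((doubling ^^ Suc q) ((y + 1) / 2)))
      = leb (\<lambda>y. \<lfloor>2 ^ q * y\<rfloor> \<in> ?S' \<and> F ((doubling ^^ q) y))"
      unfolding r funpow_Suc_right comp_def by (intro leb_cong) (simp only: dr mem_Collect_eq)
    finally show ?thesis .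
  qed
  also have "\<dots> = (leb (\<lambda>y. \<lfloor>2 ^ q * y\<rfloor> \<in> S) / 2 + leb (\<lambda>y. \<lfloor>2 ^ q * y\<rfloor> \<in> ?S') / 2) * leb F"
    unfolding Suc by (simp add: algebra_simps)
  also have "leb (\<lambda>y. \<lfloor>2 ^ q * y\<rfloor> \<in> S) / 2 + leb (\<lambda>y. \<lfloor>2 ^ q * y\<rfloor> \<in> ?S') / 2
    = leb (\<lambda>y. \<lfloor>2 ^ Suc q * y\<rfloor> \<in> S)"
    using leb_halves[OF dyadic_sets[of "Suc q" S]] unfolding r unfolding l by (simp only: mem_Collect_eq)
  finally show ?case .
qed

section \<open>The SRB measure as a product\<close>

lemma snd_baker: "snd (baker \<gamma> w) = doubling (snd w)"
  by (simp add: baker_def doubling_def split: prod.split)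

lemma snd_baker_funpow: "snd ((baker \<gamma> ^^ i) w) = (doubling ^^ i) (snd w)"
  by (induction i) (auto simp: snd_baker)

lemma fst_baker: "fst (baker \<gamma> w) = (if snd w < 1/2 then \<gamma> * fst w else (1 - \<gamma>) + \<gamma> * fst w)"
  by (simp add: baker_def split: prod.split)

lemma baker_measurable_borel [measurable]: "baker \<gamma> \<in> borel_measurable borel"
proof -
  have "baker \<gamma> = (\<lambda>w. (if snd w < 1/2 then \<gamma> * fst w else (1 - \<gamma>) + \<gamma> * fst w,
      if snd w < 1/2 then 2 * snd w else 2 * snd w - 1))"
    by (auto simp: baker_def fun_eq_iff)
  also have "\<dots> \<in> borel_measurable borel"
    unfolding borel_prod[symmetric] by measurable
  finally show ?thesis .
qed

lemma unit_square_borel [measurable]: "unit_square \<in> sets borel"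
  unfolding unit_square_def by (intro borel_closed closed_Times) auto

lemma mem_unit_square: "w \<in> unit_square \<longleftrightarrow> 0 \<le> fst w \<and> fst w \<le> 1 \<and> 0 \<le> snd w \<and> snd w \<le> 1"
  by (cases w) (auto simp: unit_square_def)

locale baker_srb =
  fixes \<gamma> :: real and \<mu> :: "(real \<times> real) measure"
  assumes \<gamma>_pos: "0 < \<gamma>" and \<gamma>_less: "\<gamma> < 1/2" and srb: "is_SRB \<gamma> \<mu>"
begin

abbreviation "T \<equiv> baker \<gamma>"

lemma sets_\<mu>: "sets \<mu> = sets (restrict_space borel unit_square)"
  using srb by (simp add: is_SRB_def)

lemma space_\<mu>: "space \<mu> = unit_square"
  using sets_eq_imp_space_eq[OF sets_\<mu>] by (simp add: space_restrict_space)

lemma sets_\<mu>_iff: "A \<in> sets \<mu> \<longleftrightarrow> A \<subseteq> unit_square \<and> A \<in> sets borel"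
  unfolding sets_\<mu> by (subst sets_restrict_space_iff) auto

lemma borel_sets_\<mu> [measurable]: "Measurable.pred borel P \<Longrightarrow> {w \<in> unit_square. P w} \<in> sets \<mu>"
  unfolding sets_\<mu>_iff by auto

lemma T_unit_square: "w \<in> unit_square \<Longrightarrow> T w \<in> unit_square"
proof -
  assume w: "w \<in> unit_square"
  then have "0 \<le> \<gamma> * fst w" "\<gamma> * fst w \<le> \<gamma> * 1"
    using \<gamma>_pos by (auto simp: mem_unit_square simp del: mult_1_right)
  then show ?thesis using w \<gamma>_less
    by (auto simp: mem_unit_square snd_baker fst_baker doubling_def)
qed

lemma T_funpow_unit_square: "w \<in> unit_square \<Longrightarrow> (T ^^ i) w \<in> unit_square"
  by (induction i) (auto intro: T_unit_square)

lemma T_measurable_\<mu>: "T \<in> measurable \<mu> \<mu>"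
proof -
  have "T \<in> measurable (restrict_space borel unit_square) (restrict_space borel unit_square)"
    by (intro measurable_restrict_space3) (auto simp: T_unit_square)
  then show ?thesis by (simp cong: measurable_cong_sets add: sets_\<mu>)
qed

sublocale mpt \<mu> T
  using srb T_measurable_\<mu> by (simp add: mpt_def mpt_axioms_def is_SRB_def)

text \<open>The marginal of \<open>\<mu>\<close> on the stable direction, a Cantor measure.\<close>

definition nu :: "real measure" where
  "nu = distr \<mu> borel fst"

lemma measurable_\<mu> [measurable (raw)]: "f \<in> borel_measurable borel \<Longrightarrow> f \<in> borel_measurable \<mu>"
  unfolding measurable_cong_sets[OF sets_\<mu> refl] by (rule measurable_restrict_space1)

lemma fst_measurable_\<mu> [measurable]: "fst \<in> borel_measurable \<mu>"
  by (rule measurable_\<mu>) (auto intro!: borel_measurable_continuous_onI continuous_intros)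

sublocale nu: prob_space nu
  unfolding nu_def by (rule prob_space_distr) simp

lemma sets_nu [simp, measurable_cong]: "sets nu = sets borel"
  by (simp add: nu_def)

lemma space_nu [simp]: "space nu = UNIV"
  by (simp add: nu_def)

lemma emeasure_leaf:
  assumes A: "A \<in> sets \<mu>" and w: "w \<in> unit_square"
  shows "emeasure (leaf_measure (fst w)) A = emeasure lborel {y \<in> {0..1}. (fst w, y) \<in> A}"
proof -
  have [measurable]: "(\<lambda>y. (fst w, y)) \<in> measurable borel borel"
    by (intro borel_measurable_continuous_onI continuous_intros)
  have m: "(\<lambda>y. (fst w, y)) \<in> measurable (restrict_space lborel {0..1}) (restrict_space borel unit_square)"
  proof (rule measurable_restrict_space3)
    show "(\<lambda>y. (fst w, y)) \<in> measurable lborel borel" by simp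
    show "(\<lambda>y. (fst w, y)) \<in> {0..1} \<rightarrow> unit_square"
      using w by (auto simp: mem_unit_square)
  qed
  have A': "A \<in> sets (restrict_space borel unit_square)" "A \<in> sets borel"
    using A sets_\<mu> sets_\<mu>_iff by blast+
  have "emeasure (leaf_measure (fst w)) A
      = emeasure (restrict_space lborel {0..1}) ((\<lambda>y. (fst w, y)) -` A \<inter> space (restrict_space lborel {0..1}))"
    unfolding leaf_measure_def by (rule emeasure_distr[OF m A'(1)])
  also have "\<dots> = emeasure lborel ((\<lambda>y. (fst w, y)) -` A \<inter> space (restrict_space lborel {0..1}))"
    by (rule emeasure_restrict_space) (auto simp: space_restrict_space)
  also have "(\<lambda>y. (fst w, y)) -` A \<inter> space (restrict_space lborel {0..1}) = {y \<in> {0..1}. (fst w, y) \<in> A}"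
    by (auto simp: space_restrict_space)
  finally show ?thesis .
qed

lemma emeasure_\<mu>_leaf:
  assumes "A \<in> sets \<mu>"
  shows "emeasure \<mu> A = (\<integral>\<^sup>+ w. emeasure lborel {y \<in> {0..1}. (fst w, y) \<in> A} \<partial>\<mu>)"
proof -
  have "emeasure \<mu> A = (\<integral>\<^sup>+ w. emeasure (leaf_measure (fst w)) A \<partial>\<mu>)"
    using srb assms by (simp add: is_SRB_def)
  also have "\<dots> = (\<integral>\<^sup>+ w. emeasure lborel {y \<in> {0..1}. (fst w, y) \<in> A} \<partial>\<mu>)"
    by (intro nn_integral_cong emeasure_leaf assms) (simp add: space_\<mu>)
  finally show ?thesis .
qed

text \<open>Meant for sets that are not products, such as Euclidean annuli: a bound valid on every
  leaf passes to \<mu> through the disintegration.\<close>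

lemma measure_\<mu>_le:
  assumes A: "A \<in> sets \<mu>" and "0 \<le> c"
    and le: "\<And>x. emeasure lborel {y \<in> {0..1}. (x, y) \<in> A} \<le> ennreal c"
  shows "measure \<mu> A \<le> c"
proof -
  have "emeasure \<mu> A \<le> (\<integral>\<^sup>+ w. ennreal c \<partial>\<mu>)"
    unfolding emeasure_\<mu>_leaf[OF A] by (intro nn_integral_mono le)
  also have "\<dots> = ennreal c" by (simp add: emeasure_space_1)
  finally show ?thesis using \<open>0 \<le> c\<close> by (simp add: emeasure_eq_measure)
qed

text \<open>Every leaf that satisfies \<open>P\<close> gives such a set the same mass, so the
  disintegration integral factors.\<close>

lemma measure_\<mu>_product:
  assumes [measurable]: "Measurable.pred borel P" "Measurable.pred borel Q"
  shows "measure \<mu> {w \<in> unit_square. P (fst w) \<and> Q (snd w)}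
    = measure nu {x. P x} * leb Q"
proof -
  let ?q = "emeasure lborel {y \<in> {0..<1}. Q y}"
  have [measurable]: "fst \<in> borel_measurable (borel :: (real \<times> real) measure)"
    "snd \<in> borel_measurable (borel :: (real \<times> real) measure)"
    by (auto intro!: borel_measurable_continuous_onI continuous_intros)
  have A: "{w \<in> unit_square. P (fst w) \<and> Q (snd w)} \<in> sets \<mu>" by measurable
  \<comment> \<open>The leaves are closed at height 1, whereas \<open>leb\<close> omits that null
    point.\<close>
  have q: "emeasure lborel {y \<in> {0..1}. Q y} = ?q"
  proof (rule emeasure_eq_AE)
    show "AE y in lborel. (y \<in> {y \<in> {0..1}. Q y}) = (y \<in> {y \<in> {0..<1}. Q y})"
      using AE_lborel_singleton[of "1::real"] by eventually_elim auto
  qed measurable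
  have fin: "?q = ennreal (leb Q)"
    unfolding leb_def using fmeasurable_unit_interval[of Q] by (intro emeasure_eq_measure2) simp
  have "emeasure \<mu> {w \<in> unit_square. P (fst w) \<and> Q (snd w)}
    = (\<integral>\<^sup>+ w. ?q * indicator {w \<in> space \<mu>. P (fst w)} w \<partial>\<mu>)"
    unfolding emeasure_\<mu>_leaf[OF A]
  proof (rule nn_integral_cong)
    fix w assume w: "w \<in> space \<mu>"
    then have "{y \<in> {0..1}. (fst w, y) \<in> {w \<in> unit_square. P (fst w) \<and> Q (snd w)}}
        = (if P (fst w) then {y \<in> {0..1}. Q y} else {})"
      by (auto simp: space_\<mu> mem_unit_square)
    then show "emeasure lborel {y \<in> {0..1}. (fst w, y) \<in> {w \<in> unit_square. P (fst w) \<and> Q (snd w)}}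
        = ?q * indicator {w \<in> space \<mu>. P (fst w)} w"
      using w q by auto
  qed
  also have "\<dots> = ?q * emeasure \<mu> {w \<in> space \<mu>. P (fst w)}"
    by (rule nn_integral_cmult_indicator) measurable
  also have "emeasure \<mu> {w \<in> space \<mu>. P (fst w)} = emeasure nu {x. P x}"
    unfolding nu_def by (subst emeasure_distr) (auto intro!: arg_cong[where f = "emeasure \<mu>"])
  finally show ?thesis
    unfolding fin emeasure_eq_measure nu.emeasure_eq_measure
    by (simp add: leb_def mult.commute flip: ennreal_mult)
qed

lemma measure_\<mu>_snd:
  assumes "Measurable.pred borel Q"
  shows "measure \<mu> {w \<in> unit_square. Q (snd w)} = leb Q"
  using measure_\<mu>_product[of "\<lambda>_. True" Q] assms nu.prob_space by simp

text \<open>Invariance of \<mu> is applied to a condition on the first coordinate. The branch is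
  chosen by the first digit of the second coordinate, which has probability 1/2 either way and is
  independent of the first coordinate.\<close>

lemma nu_self_similar:
  assumes [measurable]: "Measurable.pred borel P"
  shows "measure nu {x. P x} = measure nu {x. P (\<gamma> * x)} / 2 + measure nu {x. P (1 - \<gamma> + \<gamma> * x)} / 2"
proof -
  have [measurable]: "fst \<in> borel_measurable (borel :: (real \<times> real) measure)"
    "snd \<in> borel_measurable (borel :: (real \<times> real) measure)"
    by (auto intro!: borel_measurable_continuous_onI continuous_intros)
  have half: "leb (\<lambda>y. y < 1/2) = 1/2" "leb (\<lambda>y. \<not> y < 1/2) = 1/2"
  proof -
    have "{y \<in> {0..<1::real}. y < 1/2} = {0..<1/2}" "{y \<in> {0..<1::real}. \<not> y < 1/2} = {1/2..<1}"
      by auto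
    then show "leb (\<lambda>y. y < 1/2) = 1/2" "leb (\<lambda>y. \<not> y < 1/2) = 1/2" unfolding leb_def by simp_all
  qed
  have "measure nu {x. P x} = measure \<mu> {w \<in> unit_square. P (fst w)}"
    using measure_\<mu>_product[of P "\<lambda>_. True"] by simp
  also have "\<dots> = measure \<mu> {w \<in> space \<mu>. P (fst (T w))}"
    using prob_funpow[of "\<lambda>w. P (fst w)" 1] by (simp add: space_\<mu>)
  also have "\<dots> = measure \<mu> ({w \<in> unit_square. P (\<gamma> * fst w) \<and> snd w < 1/2}
      \<union> {w \<in> unit_square. P (1 - \<gamma> + \<gamma> * fst w) \<and> \<not> snd w < 1/2})"
    by (intro arg_cong[where f = "measure \<mu>"]) (auto simp: space_\<mu> fst_baker)
  also have "\<dots> = measure \<mu> {w \<in> unit_square. P (\<gamma> * fst w) \<and> snd w < 1/2}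
      + measure \<mu> {w \<in> unit_square. P (1 - \<gamma> + \<gamma> * fst w) \<and> \<not> snd w < 1/2}"
    by (intro finite_measure_Union borel_sets_\<mu>) (measurable, auto)
  also have "\<dots> = measure nu {x. P (\<gamma> * x)} / 2 + measure nu {x. P (1 - \<gamma> + \<gamma> * x)} / 2"
    using measure_\<mu>_product[of "\<lambda>x. P (\<gamma> * x)" "\<lambda>y. y < 1/2"]
      measure_\<mu>_product[of "\<lambda>x. P (1 - \<gamma> + \<gamma> * x)" "\<lambda>y. \<not> y < 1/2"]
    unfolding half by simp
  finally show ?thesis .
qed

end

section \<open>Return estimates for the doubling map\<close>

lemma leb_mono:
  assumes [measurable]: "Measurable.pred borel P" "Measurable.pred borel Q"
    and "\<And>y. 0 \<le> y \<Longrightarrow> y < 1 \<Longrightarrow> P y \<Longrightarrow> Q y"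
  shows "leb P \<le> leb Q"
  unfolding leb_def
proof (rule measure_mono_fmeasurable)
  show "{y \<in> {0..<1}. P y} \<in> sets lborel" by measurable
  show "{y \<in> {0..<1}. Q y} \<in> fmeasurable lborel" by (rule fmeasurable_unit_interval) measurable
qed (use assms in auto)

lemma leb_nonneg: "0 \<le> leb P"
  by (simp add: leb_def)

lemma leb_ball_le: "r \<ge> 0 \<Longrightarrow> leb (\<lambda>y. \<bar>y - y0\<bar> < r) \<le> 2 * r"
proof -
  assume r: "r \<ge> 0"
  have "leb (\<lambda>y. \<bar>y - y0\<bar> < r) \<le> measure lborel {y0 - r..y0 + r}"
    unfolding leb_def using r by (intro measure_mono_fmeasurable) (auto simp: fmeasurable_def emeasure_lborel_Icc_eq)
  then show ?thesis using r by simp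
qed

text \<open>The start is relaxed to a condition on the first \<open>i\<close> digits, which enlarges
  the radius by at most \<open>1 / 2 ^ i\<close>. The position at time \<open>i\<close> depends on
  the remaining digits and is independent of that condition.\<close>

lemma leb_return_le:
  assumes r: "r \<ge> 0"
  shows "leb (\<lambda>y. \<bar>y - y0\<bar> < r \<and> \<bar>(doubling ^^ i) y - y0\<bar> < r) \<le> (2 * r + 2 / 2 ^ i) * (2 * r)"
proof -
  define S where "S = (\<lambda>y. \<lfloor>2 ^ i * y\<rfloor>) ` {y. \<bar>y - y0\<bar> < r}"
  have "leb (\<lambda>y. \<bar>y - y0\<bar> < r \<and> \<bar>(doubling ^^ i) y - y0\<bar> < r)
    \<le> leb (\<lambda>y. \<lfloor>2 ^ i * y\<rfloor> \<in> S \<and> \<bar>(doubling ^^ i) y - y0\<bar> < r)"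
    by (rule leb_mono) (auto simp: S_def)
  also have "\<dots> = leb (\<lambda>y. \<lfloor>2 ^ i * y\<rfloor> \<in> S) * leb (\<lambda>y. \<bar>y - y0\<bar> < r)"
    by (rule dyadic_indep) simp
  also have "\<dots> \<le> (2 * (r + 1 / 2 ^ i)) * (2 * r)"
  proof (rule mult_mono)
    have "leb (\<lambda>y. \<lfloor>2 ^ i * y\<rfloor> \<in> S) \<le> leb (\<lambda>y. \<bar>y - y0\<bar> < r + 1 / 2 ^ i)"
    proof (rule leb_mono)
      fix y :: real assume "\<lfloor>2 ^ i * y\<rfloor> \<in> S"
      then obtain y' where "\<bar>y' - y0\<bar> < r" "\<lfloor>2 ^ i * y\<rfloor> = \<lfloor>2 ^ i * y'\<rfloor>" by (auto simp: S_def)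
      then show "\<bar>y - y0\<bar> < r + 1 / 2 ^ i" using same_dyadic_dist[of i y y'] by linarith
    qed measurable
    also have "\<dots> \<le> 2 * (r + 1 / 2 ^ i)" using r by (intro leb_ball_le) simp
    finally show "leb (\<lambda>y. \<lfloor>2 ^ i * y\<rfloor> \<in> S) \<le> 2 * (r + 1 / 2 ^ i)" .
  qed (use r in \<open>auto intro: leb_ball_le leb_nonneg\<close>)
  finally show ?thesis by (simp add: algebra_simps)
qed

lemma visits_doubling_measurable [measurable]:
  assumes [measurable]: "Y \<in> sets borel"
  shows "Measurable.pred borel (\<lambda>y. visits doubling Y I y = k)"
proof -
  have "(visits doubling Y I y = k) \<longleftrightarrow> (\<Sum>i\<in>I. indicat_real Y ((doubling ^^ i) y)) = real k" for y
  proof -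
    have "(\<Sum>i\<in>I. indicat_real Y ((doubling ^^ i) y)) = real (visits doubling Y I y)"
      unfolding visits_def of_nat_sum by (intro sum.cong) (auto simp: indicator_def)
    then show ?thesis by simp
  qed
  then show ?thesis by simp
qed

section \<open>Regularity of the Cantor measure\<close>

context baker_srb
begin

lemma nu_cong:
  assumes [measurable]: "Measurable.pred borel P" "Measurable.pred borel Q"
    and "\<And>x. 0 \<le> x \<Longrightarrow> x \<le> 1 \<Longrightarrow> P x = Q x"
  shows "measure nu {x. P x} = measure nu {x. Q x}"
proof -
  have "{w \<in> unit_square. P (fst w) \<and> True} = {w \<in> unit_square. Q (fst w) \<and> True}"
    using assms(3) by (auto simp: mem_unit_square)
  then show ?thesis
    using measure_\<mu>_product[of P "\<lambda>_. True"] measure_\<mu>_product[of Q "\<lambda>_. True"] by simp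
qed

lemma nu_null:
  assumes "Measurable.pred borel P" and "\<And>x. 0 \<le> x \<Longrightarrow> x \<le> 1 \<Longrightarrow> \<not> P x"
  shows "measure nu {x. P x} = 0"
  using nu_cong[of P "\<lambda>_. False"] assms by simp

lemma nu_mono:
  assumes "Measurable.pred borel P" "Measurable.pred borel Q" and "\<And>x. P x \<Longrightarrow> Q x"
  shows "measure nu {x. P x} \<le> measure nu {x. Q x}"
  using assms by (intro nu.finite_measure_mono) auto

text \<open>The two pieces of the Cantor measure live on [0, \<gamma>] and [1 - \<gamma>, 1], at
  distance \<open>1 - 2 * \<gamma>\<close>. An interval shorter than this gap charges at most one of
  them; rescaling that piece gains a factor 1/2 and uses up one power of \<gamma>.\<close>

lemma nu_interval_le:
  "b - a \<le> (1 - 2 * \<gamma>) * \<gamma> ^ k \<Longrightarrow> measure nu {x. a \<le> x \<and> x \<le> b} \<le> (1/2) ^ k"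
proof (induction k arbitrary: a b)
  case 0
  show ?case by simp
next
  case (Suc k)
  have len: "(b - c) / \<gamma> - (a - c) / \<gamma> \<le> (1 - 2 * \<gamma>) * \<gamma> ^ k" for c
    using Suc.prems \<gamma>_pos by (simp add: field_simps)
  have "\<gamma> * \<gamma> ^ k < 1 * 1"
    using \<gamma>_pos \<gamma>_less by (intro mult_less_le_imp_less power_le_one) auto
  then have "(1 - 2 * \<gamma>) * \<gamma> ^ Suc k < (1 - 2 * \<gamma>) * 1"
    using \<gamma>_less by (intro mult_strict_left_mono) auto
  with Suc.prems have gap: "b - a < 1 - 2 * \<gamma>" by simp
  have eq: "{x. a \<le> c + \<gamma> * x \<and> c + \<gamma> * x \<le> b} = {x. (a - c) / \<gamma> \<le> x \<and> x \<le> (b - c) / \<gamma>}" for c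
    using \<gamma>_pos by (auto simp: field_simps)
  have IH: "measure nu {x. a \<le> c + \<gamma> * x \<and> c + \<gamma> * x \<le> b} \<le> (1/2) ^ k" for c
    unfolding eq by (rule Suc.IH[OF len])
  have "measure nu {x. a \<le> x \<and> x \<le> b} = measure nu {x. a \<le> \<gamma> * x \<and> \<gamma> * x \<le> b} / 2
    + measure nu {x. a \<le> 1 - \<gamma> + \<gamma> * x \<and> 1 - \<gamma> + \<gamma> * x \<le> b} / 2"
    by (rule nu_self_similar) simp
  moreover have "measure nu {x. a \<le> \<gamma> * x \<and> \<gamma> * x \<le> b} = 0
    \<or> measure nu {x. a \<le> 1 - \<gamma> + \<gamma> * x \<and> 1 - \<gamma> + \<gamma> * x \<le> b} = 0"
  proof (cases "a > \<gamma>")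
    case True
    have "measure nu {x. a \<le> \<gamma> * x \<and> \<gamma> * x \<le> b} = 0"
    proof (rule nu_null)
      fix x :: real assume "x \<le> 1"
      then have "\<gamma> * x \<le> \<gamma> * 1" using \<gamma>_pos by (intro mult_left_mono) auto
      then show "\<not> (a \<le> \<gamma> * x \<and> \<gamma> * x \<le> b)" using True by simp
    qed measurable
    then show ?thesis ..
  next
    case False
    have "measure nu {x. a \<le> 1 - \<gamma> + \<gamma> * x \<and> 1 - \<gamma> + \<gamma> * x \<le> b} = 0"
    proof (rule nu_null)
      fix x :: real assume "0 \<le> x"
      then have "0 \<le> \<gamma> * x" using \<gamma>_pos by simp
      then show "\<not> (a \<le> 1 - \<gamma> + \<gamma> * x \<and> 1 - \<gamma> + \<gamma> * x \<le> b)" using False gap by linarith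
    qed measurable
    then show ?thesis ..
  qed
  ultimately show ?case using IH[of 0] IH[of "1 - \<gamma>"] by auto
qed

definition in_support :: "real \<Rightarrow> bool" where
  "in_support x \<longleftrightarrow> (\<forall>\<epsilon>>0. measure nu {t. \<bar>t - x\<bar> < \<epsilon>} > 0)"

lemma in_support_range:
  assumes "in_support x"
  shows "0 \<le> x" "x \<le> 1"
proof -
  have 0: "measure nu {t. \<bar>t - x\<bar> < \<epsilon>} > 0" if "\<epsilon> > 0" for \<epsilon>
    using assms that by (simp add: in_support_def)
  show "0 \<le> x"
  proof (rule ccontr)
    assume "\<not> 0 \<le> x"
    then have "measure nu {t. \<bar>t - x\<bar> < - x} = 0" by (intro nu_null) auto
    then show False using 0[of "- x"] \<open>\<not> 0 \<le> x\<close> by simp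
  qed
  show "x \<le> 1"
  proof (rule ccontr)
    assume "\<not> x \<le> 1"
    then have "measure nu {t. \<bar>t - x\<bar> < x - 1} = 0" by (intro nu_null) auto
    then show False using 0[of "x - 1"] \<open>\<not> x \<le> 1\<close> by simp
  qed
qed

lemma nu_ball_split:
  "measure nu {t. \<bar>t - x\<bar> < r}
    = measure nu {t. \<bar>t - x / \<gamma>\<bar> < r / \<gamma>} / 2 + measure nu {t. \<bar>t - (x - (1 - \<gamma>)) / \<gamma>\<bar> < r / \<gamma>} / 2"
proof -
  have "\<bar>c + \<gamma> * t - x\<bar> = \<gamma> * \<bar>t - (x - c) / \<gamma>\<bar>" for c t
  proof -
    have "c + \<gamma> * t - x = \<gamma> * (t - (x - c) / \<gamma>)" using \<gamma>_pos by (simp add: field_simps)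
    then show ?thesis using \<gamma>_pos by (simp add: abs_mult)
  qed
  then have eq: "{t. \<bar>c + \<gamma> * t - x\<bar> < r} = {t. \<bar>t - (x - c) / \<gamma>\<bar> < r / \<gamma>}" for c
    using \<gamma>_pos by (auto simp: field_simps)
  show ?thesis
    using nu_self_similar[of "\<lambda>t. \<bar>t - x\<bar> < r"] eq[of 0] eq[of "1 - \<gamma>"] by simp
qed

lemma in_support_step:
  assumes "in_support x"
  shows "in_support (x / \<gamma>) \<or> in_support ((x - (1 - \<gamma>)) / \<gamma>)"
proof (rule ccontr)
  assume "\<not> ?thesis"
  then obtain d e where d: "d > 0" "\<not> measure nu {t. \<bar>t - x / \<gamma>\<bar> < d} > 0"
    and e: "e > 0" "\<not> measure nu {t. \<bar>t - (x - (1 - \<gamma>)) / \<gamma>\<bar> < e} > 0"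
    by (auto simp: in_support_def)
  define r where "r = \<gamma> * min d e"
  have r: "r > 0" "r / \<gamma> \<le> d" "r / \<gamma> \<le> e"
    using d(1) e(1) \<gamma>_pos by (auto simp: r_def)
  have "measure nu {t. \<bar>t - x / \<gamma>\<bar> < r / \<gamma>} \<le> measure nu {t. \<bar>t - x / \<gamma>\<bar> < d}"
    "measure nu {t. \<bar>t - (x - (1 - \<gamma>)) / \<gamma>\<bar> < r / \<gamma>} \<le> measure nu {t. \<bar>t - (x - (1 - \<gamma>)) / \<gamma>\<bar> < e}"
    using r by (auto intro!: nu_mono)
  then have "measure nu {t. \<bar>t - x\<bar> < r} \<le> 0"
    unfolding nu_ball_split[of x r] using d e by linarith
  then show False using assms r(1) unfolding in_support_def by (metis not_le)
qed

text \<open>One of the two rescaled copies of a support point is again a support point, and its ball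
  has radius \<open>r / \<gamma>\<close>. Each such step costs at most half of the mass, and after
  \<open>j\<close> steps the ball covers the unit interval.\<close>

lemma nu_ball_ge:
  "in_support x \<Longrightarrow> \<gamma> ^ j < r \<Longrightarrow> (1/2) ^ j \<le> measure nu {t. \<bar>t - x\<bar> < r}"
proof (induction j arbitrary: x r)
  case 0
  have "measure nu {t. \<bar>t - x\<bar> < r} = measure nu {t. True}"
    using in_support_range[OF 0(1)] 0(2) by (intro nu_cong) auto
  then show ?case using nu.prob_space by simp
next
  case (Suc j)
  have r: "\<gamma> ^ j < r / \<gamma>" using Suc.prems \<gamma>_pos by (simp add: field_simps)
  have "(1/2) ^ j \<le> measure nu {t. \<bar>t - x / \<gamma>\<bar> < r / \<gamma>}
      \<or> (1/2) ^ j \<le> measure nu {t. \<bar>t - (x - (1 - \<gamma>)) / \<gamma>\<bar> < r / \<gamma>}"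
    using in_support_step[OF Suc.prems(1)] Suc.IH[OF _ r] by blast
  moreover have "0 \<le> measure nu {t. \<bar>t - x / \<gamma>\<bar> < r / \<gamma>}"
    "0 \<le> measure nu {t. \<bar>t - (x - (1 - \<gamma>)) / \<gamma>\<bar> < r / \<gamma>}" by simp_all
  ultimately show ?case by (subst nu_ball_split) (auto intro: add_increasing add_increasing2)
qed

text \<open>The upper bound for intervals and the lower bound for balls around support points are
  both powers of 1/2, and at comparable scales their exponents differ by \<open>c + 1\<close>. This
  serves for Euclidean balls, which are compared from inside with maximum balls of half the
  radius.\<close>

lemma nu_doubling:
  obtains C where "C > 0"
    and "\<And>x r. in_support x \<Longrightarrow> 0 < r \<Longrightarrow> r \<le> 1 \<Longrightarrow>
      measure nu {t. \<bar>t - x\<bar> < r} \<le> C * measure nu {t. \<bar>t - x\<bar> < r / 2}"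
proof -
  \<comment> \<open>The 4 absorbs the length of the ball, since
    \<open>r / 2 \<le> \<gamma> ^ i\<close> gives
    \<open>2 * r \<le> 4 * \<gamma> ^ i\<close>.\<close>
  obtain c where c: "\<gamma> ^ c < (1 - 2 * \<gamma>) / 4"
    using real_arch_pow_inv[of "(1 - 2 * \<gamma>) / 4" \<gamma>] \<gamma>_less by auto
  have "measure nu {t. \<bar>t - x\<bar> < r} \<le> 2 ^ Suc c * measure nu {t. \<bar>t - x\<bar> < r / 2}"
    if x: "in_support x" and r: "0 < r" "r \<le> 1" for x r
  proof -
    define j where "j = (LEAST j. \<gamma> ^ j < r / 2)"
    obtain j0 where "\<gamma> ^ j0 < r / 2"
      using real_arch_pow_inv[of "r / 2" \<gamma>] r \<gamma>_less by auto
    then have j: "\<gamma> ^ j < r / 2" unfolding j_def by (rule LeastI)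
    have "j \<noteq> 0" using j r by (intro notI) simp
    then obtain i where i: "j = Suc i" by (cases j) auto
    have ri: "r / 2 \<le> \<gamma> ^ i" using not_less_Least[of i "\<lambda>j. \<gamma> ^ j < r / 2"] i unfolding j_def by simp
    have "measure nu {t. \<bar>t - x\<bar> < r} \<le> 2 ^ Suc c * (1/2) ^ j"
    proof (cases "c \<le> i")
      case True
      then have "(x + r) - (x - r) \<le> 4 * (\<gamma> ^ c * \<gamma> ^ (i - c))"
        using ri by (simp flip: power_add)
      also have "\<dots> = (4 * \<gamma> ^ c) * \<gamma> ^ (i - c)" by simp
      also have "\<dots> \<le> (1 - 2 * \<gamma>) * \<gamma> ^ (i - c)"
        using c \<gamma>_pos by (intro mult_right_mono) auto
      finally have "measure nu {t. x - r \<le> t \<and> t \<le> x + r} \<le> (1/2) ^ (i - c)"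
        by (rule nu_interval_le)
      moreover have "measure nu {t. \<bar>t - x\<bar> < r} \<le> measure nu {t. x - r \<le> t \<and> t \<le> x + r}"
        by (intro nu_mono) auto
      moreover have "(1/2 :: real) ^ (i - c) = 2 ^ Suc c * (1/2) ^ j"
      proof -
        have "(2::real) ^ Suc c * (1/2) ^ j = 2 ^ Suc c * ((1/2) ^ Suc c * (1/2) ^ (i - c))"
          using True i by (simp flip: power_add)
        then show ?thesis by (simp add: power_one_over)
      qed
      ultimately show ?thesis by simp
    next
      case False
      have "(1::real) = 2 ^ j * (1/2) ^ j" by (simp add: power_one_over)
      also have "\<dots> \<le> 2 ^ Suc c * (1/2) ^ j" using False i by (intro mult_right_mono power_increasing) auto
      finally show ?thesis using nu.prob_le_1 order_trans by blast
    qed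
    also have "\<dots> \<le> 2 ^ Suc c * measure nu {t. \<bar>t - x\<bar> < r / 2}"
      using nu_ball_ge[OF x j] by (intro mult_left_mono) auto
    finally show ?thesis .
  qed
  then show ?thesis using that[of "2 ^ Suc c"] by simp
qed

section \<open>Late returns, and approximation by finitely many digits\<close>

lemma fst_snd_borel [measurable]:
  "fst \<in> borel_measurable (borel :: (real \<times> real) measure)"
  "snd \<in> borel_measurable (borel :: (real \<times> real) measure)"
  by (auto intro!: borel_measurable_continuous_onI continuous_intros)

text \<open>The horizontal condition at the return time is dropped; what remains is a product
  set.\<close>

lemma measure_return_le:
  assumes B: "B \<in> sets \<mu>" "B \<subseteq> max_ball z r" and r: "r \<ge> 0"
  shows "measure \<mu> {w \<in> B. (T ^^ i) w \<in> B} \<le> measure nu {t. \<bar>t - fst z\<bar> < r} * ((2 * r + 2 / 2 ^ i) * (2 * r))"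
proof -
  have "measure \<mu> {w \<in> B. (T ^^ i) w \<in> B} \<le> measure \<mu> {w \<in> unit_square. \<bar>fst w - fst z\<bar> < r \<and>
      (\<bar>snd w - snd z\<bar> < r \<and> \<bar>(doubling ^^ i) (snd w) - snd z\<bar> < r)}"
  proof (intro finite_measure_mono)
    show "{w \<in> B. (T ^^ i) w \<in> B} \<subseteq> {w \<in> unit_square. \<bar>fst w - fst z\<bar> < r \<and>
      (\<bar>snd w - snd z\<bar> < r \<and> \<bar>(doubling ^^ i) (snd w) - snd z\<bar> < r)}"
    proof
      fix w assume "w \<in> {w \<in> B. (T ^^ i) w \<in> B}"
      then have "w \<in> max_ball z r" "(T ^^ i) w \<in> max_ball z r" using B(2) by auto
      then show "w \<in> {w \<in> unit_square. \<bar>fst w - fst z\<bar> < r \<and>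
          (\<bar>snd w - snd z\<bar> < r \<and> \<bar>(doubling ^^ i) (snd w) - snd z\<bar> < r)}"
        by (simp add: max_ball_def snd_baker_funpow)
    qed
  qed (rule borel_sets_\<mu>, measurable)
  also have "\<dots> = measure nu {t. \<bar>t - fst z\<bar> < r} *
      leb (\<lambda>y. \<bar>y - snd z\<bar> < r \<and> \<bar>(doubling ^^ i) y - snd z\<bar> < r)"
    by (rule measure_\<mu>_product) measurable
  also have "\<dots> \<le> measure nu {t. \<bar>t - fst z\<bar> < r} * ((2 * r + 2 / 2 ^ i) * (2 * r))"
    by (intro mult_left_mono leb_return_le r) simp
  finally show ?thesis .
qed

text \<open>Equal leading digits select the same branch at each of the \<open>i\<close> steps, and
  both branches contract horizontally by \<gamma>.\<close>

lemma fst_funpow_diff: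
  assumes "\<lfloor>2 ^ (i + q) * snd w\<rfloor> = \<lfloor>2 ^ (i + q) * snd w'\<rfloor>"
  shows "fst ((T ^^ i) w) - fst ((T ^^ i) w') = \<gamma> ^ i * (fst w - fst w')"
  using assms
proof (induction i arbitrary: w w')
  case (Suc i)
  note s = same_dyadic_doubling[of "i + q" "snd w" "snd w'"]
  have "fst ((T ^^ i) (T w)) - fst ((T ^^ i) (T w')) = \<gamma> ^ i * (fst (T w) - fst (T w'))"
    using s(1) Suc.prems by (intro Suc.IH) (simp add: snd_baker)
  also have "fst (T w) - fst (T w') = \<gamma> * (fst w - fst w')"
    using s(2) Suc.prems by (simp add: fst_baker algebra_simps)
  finally show ?case by (simp add: funpow_swap1)
qed simp

text \<open>The points all of whose companions, those sharing the first \<open>2 m\<close> binary digits of the second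
  coordinate, are in \<open>B\<close> after \<open>m\<close> steps: an inner approximation of \<open>T\<^sup>-\<^sup>m B\<close> that depends
  on finitely many digits. The image of the set of companions is a rectangle of width at most
  \<open>\<gamma> ^ m\<close> and height at most \<open>(1/2) ^ m\<close>.\<close>

definition approx_codes :: "(real \<times> real) set \<Rightarrow> nat \<Rightarrow> int set" where
  "approx_codes B m =
    {c. \<forall>w\<in>unit_square. snd w < 1 \<and> \<lfloor>2 ^ (m + m) * snd w\<rfloor> = c \<longrightarrow> (T ^^ m) w \<in> B}"

definition approx :: "(real \<times> real) set \<Rightarrow> nat \<Rightarrow> (real \<times> real) set" where
  "approx B m = {w \<in> unit_square. snd w < 1 \<and> \<lfloor>2 ^ (m + m) * snd w\<rfloor> \<in> approx_codes B m}"

lemma approx_sets [measurable]: "approx B m \<in> sets \<mu>"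
  unfolding approx_def by measurable

lemma approx_subset: "approx B m \<subseteq> (T ^^ m) -` B \<inter> space \<mu>"
  unfolding approx_def approx_codes_def space_\<mu> by auto

text \<open>A point that reaches \<open>B\<close> at time \<open>m\<close> without belonging to the
  approximation has a companion whose image misses \<open>B\<close>. Its own image is then close to
  the complement of \<open>B\<close>, hence in the layer \<open>G\<close>, and by invariance the
  preimage of \<open>G\<close> has the measure of \<open>G\<close>.\<close>

lemma approx_error:
  assumes [measurable]: "B \<in> sets \<mu>" "G \<in> sets \<mu>"
    and G: "\<And>b b'. b \<in> B \<Longrightarrow> b' \<in> unit_square \<Longrightarrow> b' \<notin> B \<Longrightarrow> \<bar>fst b - fst b'\<bar> \<le> \<gamma> ^ m \<Longrightarrow>
      \<bar>snd b - snd b'\<bar> \<le> (1/2) ^ m \<Longrightarrow> b \<in> G"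
  shows "measure \<mu> ((approx B m - ((T ^^ m) -` B \<inter> space \<mu>)) \<union> (((T ^^ m) -` B \<inter> space \<mu>) - approx B m))
    \<le> measure \<mu> G"
proof -
  \<comment> \<open>On the top edge the approximation is empty, but that edge is null.\<close>
  define Z where "Z = {w \<in> unit_square. snd w = 1}"
  have [measurable]: "Z \<in> sets \<mu>" unfolding Z_def by measurable
  have "measure \<mu> Z = leb (\<lambda>y. y = 1)" unfolding Z_def by (rule measure_\<mu>_snd) simp
  also have "\<dots> = leb (\<lambda>_. False)" by (rule leb_cong) auto
  finally have Z0: "measure \<mu> Z = 0" by simp
  have "(approx B m - ((T ^^ m) -` B \<inter> space \<mu>)) \<union> (((T ^^ m) -` B \<inter> space \<mu>) - approx B m)
    \<subseteq> ((T ^^ m) -` G \<inter> space \<mu>) \<union> Z"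
  proof
    fix w assume "w \<in> (approx B m - ((T ^^ m) -` B \<inter> space \<mu>)) \<union> (((T ^^ m) -` B \<inter> space \<mu>) - approx B m)"
    then have w: "w \<in> unit_square" "(T ^^ m) w \<in> B" "w \<notin> approx B m"
      using approx_subset[of B m] by (auto simp: space_\<mu>)
    show "w \<in> ((T ^^ m) -` G \<inter> space \<mu>) \<union> Z"
    proof (cases "snd w < 1")
      case False
      then show ?thesis using w(1) by (auto simp: Z_def mem_unit_square)
    next
      case True
      then obtain w' where w': "w' \<in> unit_square" "\<lfloor>2 ^ (m + m) * snd w\<rfloor> = \<lfloor>2 ^ (m + m) * snd w'\<rfloor>"
        "(T ^^ m) w' \<notin> B"
        using w unfolding approx_def approx_codes_def by auto
      have "(T ^^ m) w \<in> G"
      proof (rule G[OF w(2) _ w'(3)])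
        show "(T ^^ m) w' \<in> unit_square" using w' by (intro T_funpow_unit_square)
        have "\<bar>\<gamma> ^ m * (fst w - fst w')\<bar> \<le> \<gamma> ^ m * 1"
          unfolding abs_mult using w(1) w'(1) \<gamma>_pos
          by (intro mult_mono) (auto simp: mem_unit_square abs_le_iff)
        then show "\<bar>fst ((T ^^ m) w) - fst ((T ^^ m) w')\<bar> \<le> \<gamma> ^ m"
          unfolding fst_funpow_diff[OF w'(2)] by simp
        show "\<bar>snd ((T ^^ m) w) - snd ((T ^^ m) w')\<bar> \<le> (1/2) ^ m"
          using same_dyadic_dist[OF same_dyadic_funpow[OF w'(2)]]
          by (simp add: snd_baker_funpow power_one_over)
      qed
      then show ?thesis using w by (simp add: space_\<mu>)
    qed
  qed
  then have "measure \<mu> ((approx B m - ((T ^^ m) -` B \<inter> space \<mu>)) \<union> (((T ^^ m) -` B \<inter> space \<mu>) - approx B m))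
    \<le> measure \<mu> (((T ^^ m) -` G \<inter> space \<mu>) \<union> Z)"
    by (intro finite_measure_mono) measurable
  also have "\<dots> \<le> measure \<mu> ((T ^^ m) -` G \<inter> space \<mu>) + measure \<mu> Z"
    by (intro measure_Un_le) measurable
  also have "\<dots> = measure \<mu> G" using Z0 prob_vimage_funpow[of G m] by simp
  finally show ?thesis .
qed

text \<open>Membership at a time \<open>i < s\<close> reads digits up to \<open>i + (m + m)\<close>,
  all among the first \<open>L\<close>, while the visits counted from time \<open>L\<close> on read
  later digits: the gap makes the independence exact. In the proof, \<open>S\<close> collects the
  codes of \<open>L\<close> digits for which the first window has \<open>a\<close> visits.\<close>

lemma approx_indep:
  assumes L: "L = s + (m + m)"
  shows "measure \<mu> {w \<in> space \<mu>. visits T (approx B m) {..<s} w = a \<and> visits T (approx B m) I ((T ^^ L) w) = b}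
    = measure \<mu> {w \<in> space \<mu>. visits T (approx B m) {..<s} w = a} * measure \<mu> {w \<in> space \<mu>. visits T (approx B m) I w = b}"
proof -
  define Y where "Y = {y::real. y < 1 \<and> \<lfloor>2 ^ (m + m) * y\<rfloor> \<in> approx_codes B m}"
  have [measurable]: "Y \<in> sets borel" unfolding Y_def by measurable
  have v: "visits T (approx B m) I w = visits doubling Y I (snd w)" if "w \<in> unit_square" for w I
    unfolding visits_def using T_funpow_unit_square[OF that]
    by (intro sum.cong) (auto simp: approx_def Y_def indicator_def snd_baker_funpow)
  define S where "S = (\<lambda>y. \<lfloor>2 ^ L * y\<rfloor>) ` {y. 0 \<le> y \<and> y < 1 \<and> visits doubling Y {..<s} y = a}"
  have S: "visits doubling Y {..<s} y = a \<longleftrightarrow> \<lfloor>2 ^ L * y\<rfloor> \<in> S" if y: "0 \<le> y" "y < 1" for y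
  proof
    assume "\<lfloor>2 ^ L * y\<rfloor> \<in> S"
    then obtain y' where y': "0 \<le> y'" "y' < 1" "visits doubling Y {..<s} y' = a" "\<lfloor>2 ^ L * y\<rfloor> = \<lfloor>2 ^ L * y'\<rfloor>"
      by (auto simp: S_def)
    have "visits doubling Y {..<s} y = visits doubling Y {..<s} y'"
      unfolding visits_def
    proof (rule sum.cong)
      fix i assume i: "i \<in> {..<s}"
      have "\<lfloor>2 ^ ((s - i) + (i + (m + m))) * y\<rfloor> = \<lfloor>2 ^ ((s - i) + (i + (m + m))) * y'\<rfloor>"
        using y'(4) i by (simp add: L)
      then have "\<lfloor>2 ^ (i + (m + m)) * y\<rfloor> = \<lfloor>2 ^ (i + (m + m)) * y'\<rfloor>"
        by (rule same_dyadic_coarsen)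
      then have "\<lfloor>2 ^ (m + m) * (doubling ^^ i) y\<rfloor> = \<lfloor>2 ^ (m + m) * (doubling ^^ i) y'\<rfloor>"
        by (rule same_dyadic_funpow)
      moreover have "(doubling ^^ i) y < 1" "(doubling ^^ i) y' < 1"
        using doubling_funpow_range[of y i] doubling_funpow_range[of y' i] y y' by auto
      ultimately show "indicator Y ((doubling ^^ i) y) = (indicator Y ((doubling ^^ i) y') :: nat)"
        by (simp add: Y_def indicator_def)
    qed simp
    then show "visits doubling Y {..<s} y = a" using y' by simp
  qed (use y in \<open>auto simp: S_def\<close>)
  have V: "leb (\<lambda>y. visits doubling Y J y = c) = measure \<mu> {w \<in> space \<mu>. visits T (approx B m) J w = c}" for J c
  proof -
    have "{w \<in> space \<mu>. visits T (approx B m) J w = c} = {w \<in> unit_square. visits doubling Y J (snd w) = c}"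
      by (auto simp: space_\<mu> v)
    then show ?thesis using measure_\<mu>_snd[of "\<lambda>y. visits doubling Y J y = c"] by simp
  qed
  have "measure \<mu> {w \<in> space \<mu>. visits T (approx B m) {..<s} w = a \<and> visits T (approx B m) I ((T ^^ L) w) = b}
    = measure \<mu> {w \<in> unit_square. visits doubling Y {..<s} (snd w) = a \<and> visits doubling Y I ((doubling ^^ L) (snd w)) = b}"
    by (intro arg_cong[where f = "measure \<mu>"]) (auto simp: space_\<mu> v T_funpow_unit_square snd_baker_funpow
        simp del: split_paired_All split_paired_Ex)
  also have "\<dots> = leb (\<lambda>y. visits doubling Y {..<s} y = a \<and> visits doubling Y I ((doubling ^^ L) y) = b)"
    by (rule measure_\<mu>_snd) measurable
  also have "\<dots> = leb (\<lambda>y. \<lfloor>2 ^ L * y\<rfloor> \<in> S \<and> visits doubling Y I ((doubling ^^ L) y) = b)"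
    by (rule leb_cong) (simp add: S)
  also have "\<dots> = leb (\<lambda>y. \<lfloor>2 ^ L * y\<rfloor> \<in> S) * leb (\<lambda>y. visits doubling Y I y = b)"
    by (rule dyadic_indep) measurable
  also have "leb (\<lambda>y. \<lfloor>2 ^ L * y\<rfloor> \<in> S) = leb (\<lambda>y. visits doubling Y {..<s} y = a)"
    by (rule leb_cong) (simp add: S)
  finally show ?thesis unfolding V .
qed

end

section \<open>Visits to shrinking balls\<close>

text \<open>The cube matches the lower bound \<open>r ^ 3\<close> for the measure of a ball. As
  r^(-1/4) is at most m + 1, its inverse is bounded by (m + 1)^12, which the exponential
  beats.\<close>

lemma exp_beats_power_floor:
  fixes r :: "nat \<Rightarrow> real" and \<kappa> :: real
  assumes r: "\<And>n. 0 < r n" "r \<longlonglongrightarrow> 0" and \<kappa>: "0 < \<kappa>" "\<kappa> < 1"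
  defines "m n \<equiv> nat \<lfloor>r n powr (- 1/4)\<rfloor>"
  shows "filterlim m at_top sequentially" and "(\<lambda>n. \<kappa> ^ m n / r n ^ 3) \<longlonglongrightarrow> 0"
    and "(\<lambda>n. real (m n) ^ 2 * r n) \<longlonglongrightarrow> 0"
proof -
  have r0: "filterlim r (at_right 0) sequentially"
    using r by (intro tendsto_imp_filterlim_at_right) auto
  have "filterlim (\<lambda>t::real. nat \<lfloor>t powr (- 1/4)\<rfloor>) at_top (at_right 0)"
    by real_asymp
  then show m_top: "filterlim m at_top sequentially"
    unfolding m_def using r0 by (rule filterlim_compose)
  have le: "real (m n) \<le> r n powr (- 1/4)" "r n powr (- 1/4) \<le> real (m n) + 1" for n
  proof -
    have "0 \<le> r n powr (- 1/4)" by simp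
    then show "real (m n) \<le> r n powr (- 1/4)" "r n powr (- 1/4) \<le> real (m n) + 1"
      unfolding m_def by linarith+
  qed
  have "(\<lambda>k::nat. \<kappa> ^ k * (real k + 1) ^ 12) \<longlonglongrightarrow> 0"
    using \<kappa> by real_asymp
  then have lim: "(\<lambda>n. \<kappa> ^ m n * (real (m n) + 1) ^ 12) \<longlonglongrightarrow> 0"
    using m_top by (rule filterlim_compose)
  show "(\<lambda>n. \<kappa> ^ m n / r n ^ 3) \<longlonglongrightarrow> 0"
  proof (rule tendsto_sandwich[OF _ _ tendsto_const lim])
    show "eventually (\<lambda>n. 0 \<le> \<kappa> ^ m n / r n ^ 3) sequentially"
      using r(1) \<kappa> by (intro always_eventually) (simp add: less_imp_le)
    show "eventually (\<lambda>n. \<kappa> ^ m n / r n ^ 3 \<le> \<kappa> ^ m n * (real (m n) + 1) ^ 12) sequentially"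
    proof (intro always_eventually allI)
      fix n
      have "1 / r n ^ 3 = (r n powr (- 1/4)) ^ 12"
      proof -
        have "(r n powr (- 1/4)) ^ 12 = r n powr (- 3)" using r(1)[of n] by (subst powr_power) auto
        then show ?thesis using r(1)[of n] by (simp add: powr_minus inverse_eq_divide)
      qed
      also have "\<dots> \<le> (real (m n) + 1) ^ 12" using le by (intro power_mono) auto
      finally show "\<kappa> ^ m n / r n ^ 3 \<le> \<kappa> ^ m n * (real (m n) + 1) ^ 12"
        using mult_left_mono[of "1 / r n ^ 3" _ "\<kappa> ^ m n"] \<kappa> by simp
    qed
  qed
  have "((\<lambda>t::real. (t powr (- 1/4)) ^ 2 * t) \<longlongrightarrow> 0) (at_right 0)" by real_asymp
  then have lim2: "(\<lambda>n. (r n powr (- 1/4)) ^ 2 * r n) \<longlonglongrightarrow> 0"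
    using r0 by (rule filterlim_compose)
  show "(\<lambda>n. real (m n) ^ 2 * r n) \<longlonglongrightarrow> 0"
  proof (rule tendsto_sandwich[OF _ _ tendsto_const lim2])
    show "eventually (\<lambda>n. 0 \<le> real (m n) ^ 2 * r n) sequentially"
      using r(1) by (intro always_eventually) (simp add: less_imp_le)
    show "eventually (\<lambda>n. real (m n) ^ 2 * r n \<le> (r n powr (- 1/4)) ^ 2 * r n) sequentially"
      using r(1) le by (intro always_eventually allI mult_right_mono power_mono) (auto simp: less_imp_le)
  qed
qed

lemma sum_half_powers_le: "(\<Sum>i\<in>{P<..t}. 1 / 2 ^ i) \<le> (1 / 2 ^ P :: real)"
proof (cases "P \<le> t")
  case True
  then have "(\<Sum>i\<in>{P<..t}. 1 / 2 ^ i) = (1 / 2 ^ P - 1 / 2 ^ t :: real)"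
  proof (induction t rule: dec_induct)
    case (step t)
    then have "{P<..Suc t} = insert (Suc t) {P<..t}" by auto
    with step show ?case by simp
  qed simp
  then show ?thesis by simp
qed simp

text \<open>Returns up to a fixed horizon \<open>P\<close> are computed exactly from the geometry;
  this controls the effect of prolonging the horizon to the length of a block.\<close>

lemma (in mpt) return_visits_diff:
  assumes B[measurable]: "B \<in> sets M" and "P \<le> t"
  shows "\<bar>prob {x \<in> B. visits T B {1..t} x = k} - prob {x \<in> B. visits T B {1..P} x = k}\<bar>
    \<le> (\<Sum>i\<in>{P<..t}. prob {x \<in> B. (T ^^ i) x \<in> B})"
proof -
  define X where "X = (\<Union>i\<in>{P<..t}. {x \<in> B. (T ^^ i) x \<in> B})"
  have m[measurable]: "{x \<in> B. (T ^^ i) x \<in> B} \<in> sets M" for i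
  proof -
    have "{x \<in> B. (T ^^ i) x \<in> B} = B \<inter> ((T ^^ i) -` B \<inter> space M)"
      using sets.sets_into_space[OF B] by auto
    then show ?thesis by simp
  qed
  have [measurable]: "X \<in> sets M" unfolding X_def by auto
  let ?U = "{x \<in> B. visits T B {1..t} x = k}" and ?V = "{x \<in> B. visits T B {1..P} x = k}"
  have eq: "visits T B {1..t} x = visits T B {1..P} x" if "x \<in> B" "x \<notin> X" for x
    unfolding visits_def using that \<open>P \<le> t\<close>
    by (intro sum.mono_neutral_right) (auto simp: X_def indicator_def)
  have "prob ?U \<le> prob (?V \<union> X)" "prob ?V \<le> prob (?U \<union> X)"
    using eq by (auto intro!: finite_measure_mono)
  moreover have "prob (?V \<union> X) \<le> prob ?V + prob X" "prob (?U \<union> X) \<le> prob ?U + prob X"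
    by (auto intro!: measure_Un_le)
  moreover have "prob X \<le> (\<Sum>i\<in>{P<..t}. prob {x \<in> B. (T ^^ i) x \<in> B})"
    unfolding X_def by (intro finite_measure_subadditive_finite) auto
  ultimately show ?thesis by simp
qed

context baker_srb
begin

lemma max_ball_sets: "max_ball z r \<in> sets \<mu>"
  unfolding max_ball_def by (rule borel_sets_\<mu>) measurable

lemma measure_max_ball:
  "measure \<mu> (max_ball z r) = measure nu {t. \<bar>t - fst z\<bar> < r} * leb (\<lambda>y. \<bar>y - snd z\<bar> < r)"
  using measure_\<mu>_product[of "\<lambda>t. \<bar>t - fst z\<bar> < r" "\<lambda>y. \<bar>y - snd z\<bar> < r"]
  by (simp add: max_ball_def)

text \<open>The scales are \<open>m \<approx> r\<^sup>-\<^sup>1\<^sup>/\<^sup>4\<close> for the number of digits and \<open>m\<^sup>2\<close> for the length of the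
  blocks: then \<open>m\<^sup>2 r \<rightarrow> 0\<close>, whereas the error of the approximation, exponentially small in \<open>m\<close>, is
  negligible with respect to any power of \<open>r\<close>.\<close>

lemma ball_visits_limit:
  fixes Ball :: "real \<Rightarrow> (real \<times> real) set" and r :: "nat \<Rightarrow> real"
  assumes Ball [measurable]: "\<And>r. Ball r \<in> sets \<mu>" and sub: "\<And>r. Ball r \<subseteq> max_ball z r"
    and lower: "\<And>r. 0 < r \<Longrightarrow> r \<le> 1/2 \<Longrightarrow> measure nu {t. \<bar>t - fst z\<bar> < r} * r \<le> C * measure \<mu> (Ball r)"
    and annulus: "\<And>r m. 0 < r \<Longrightarrow> r \<le> 1/2 \<Longrightarrow> \<exists>G\<in>sets \<mu>. measure \<mu> G \<le> C' * \<kappa> ^ m \<and>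
      (\<forall>b b'. b \<in> Ball r \<and> b' \<in> unit_square \<and> b' \<notin> Ball r \<and> \<bar>fst b - fst b'\<bar> \<le> \<gamma> ^ m \<and>
        \<bar>snd b - snd b'\<bar> \<le> (1/2) ^ m \<longrightarrow> b \<in> G)"
    and \<kappa>: "0 < \<kappa>" "\<kappa> < 1"
    and pos: "\<And>r. 0 < r \<Longrightarrow> 0 < measure \<mu> (Ball r)"
    and cube: "eventually (\<lambda>r. r ^ 3 \<le> measure \<mu> (Ball r)) (at_right 0)"
    and returns: "\<And>k. \<exists>P0. \<forall>P\<ge>P0. eventually (\<lambda>r. measure \<mu> {w \<in> Ball r. visits T (Ball r) {1..P} w = k}
      = \<Theta> * (1 - \<Theta>) ^ k * measure \<mu> (Ball r)) (at_right 0)"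
    and \<Theta>: "0 \<le> \<Theta>" "\<Theta> \<le> 1" and \<tau>: "\<tau> > 0"
    and r: "\<And>n. 0 < r n" "r \<longlonglongrightarrow> 0"
  shows "(\<lambda>n. measure \<mu> {w \<in> space \<mu>. visits T (Ball (r n)) {0..nat \<lfloor>\<tau> / measure \<mu> (Ball (r n))\<rfloor>} w = k})
    \<longlonglongrightarrow> compound_poisson_mass \<Theta> \<tau> k"
proof -
  define m where "m n = nat \<lfloor>r n powr (- 1/4)\<rfloor>" for n
  define s where "s n = m n ^ 2" for n
  define L where "L n = s n + (m n + m n)" for n
  define b where "b n = measure \<mu> (Ball (r n))" for n
  note scales = exp_beats_power_floor[OF r \<kappa>, folded m_def]
  have r0: "filterlim r (at_right 0) sequentially"
    using r by (intro tendsto_imp_filterlim_at_right) auto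
  have small: "eventually (\<lambda>n. r n \<le> 1/2) sequentially"
    using order_tendstoD(2)[OF r(2), of "1/2"] by (auto elim: eventually_mono)
  have mr: "filterlim (\<lambda>n. real (m n)) at_top sequentially"
    using scales(1) by (rule filterlim_compose[OF filterlim_real_sequentially])
  have m_pos: "eventually (\<lambda>n. m n > 0) sequentially"
    using filterlim_at_top[THEN iffD1, OF scales(1), rule_format, of "Suc 0"] by (simp add: Suc_le_eq)
  have b_le: "b n \<le> 2 * r n" for n
  proof -
    have "b n \<le> measure \<mu> (max_ball z (r n))"
      unfolding b_def by (intro finite_measure_mono sub max_ball_sets)
    also have "\<dots> \<le> 1 * (2 * r n)"
      unfolding measure_max_ball using r(1)[of n] by (intro mult_mono leb_ball_le) (auto simp: leb_nonneg)
    finally show ?thesis by simp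
  qed
  have b_pos: "0 < b n" for n
    unfolding b_def using pos r by simp
  have sr: "(\<lambda>n. real (s n) * r n) \<longlonglongrightarrow> 0"
    using scales(3) by (simp add: s_def)
  have C_pos: "0 \<le> C"
  proof -
    have "0 \<le> C * measure \<mu> (Ball (1/2))"
      using lower[of "1/2"] by (intro order_trans[OF _ lower[of "1/2"]]) auto
    then show ?thesis using pos[of "1/2"] by (simp add: zero_le_mult_iff)
  qed
  have "(\<lambda>n. prob {x \<in> space \<mu>. visits T (Ball (r n)) {0..nat \<lfloor>\<tau> / prob (Ball (r n))\<rfloor>} x = k})
    \<longlonglongrightarrow> compound_poisson_mass \<Theta> \<tau> k"
  proof (rule visits_compound_poisson_limit[where s = s and L = L and m = m and A = "\<lambda>n. approx (Ball (r n)) (m n)"])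
    show "(\<lambda>n. prob (Ball (r n))) \<longlonglongrightarrow> 0"
    proof (rule tendsto_sandwich[of "\<lambda>_. 0"])
      show "eventually (\<lambda>n. prob (Ball (r n)) \<le> 2 * r n) sequentially"
        using b_le by (simp add: b_def)
      show "(\<lambda>n. 2 * r n) \<longlonglongrightarrow> 0" using tendsto_mult_left[OF r(2), of 2] by simp
    qed auto
    show "filterlim s at_top sequentially"
    proof (rule filterlim_at_top_mono[OF scales(1)])
      show "eventually (\<lambda>n. m n \<le> s n) sequentially"
        by (simp add: s_def power2_nat_le_imp_le power2_eq_square)
    qed
    show "s n \<le> L n" for n by (simp add: L_def)
    have "(\<lambda>n. 1 + 2 / real (m n)) \<longlonglongrightarrow> 1 + 0"
      by (intro tendsto_add tendsto_const real_tendsto_divide_at_top[OF tendsto_const mr])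
    moreover have "eventually (\<lambda>n. 1 + 2 / real (m n) = real (L n) / real (s n)) sequentially"
      using m_pos by eventually_elim (simp add: L_def s_def field_simps power2_eq_square)
    ultimately show "(\<lambda>n. real (L n) / real (s n)) \<longlonglongrightarrow> 1"
      using Lim_transform_eventually by fastforce
    show "(\<lambda>n. real (s n) * prob (Ball (r n))) \<longlonglongrightarrow> 0"
    proof (rule tendsto_sandwich[of "\<lambda>_. 0"])
      show "eventually (\<lambda>n. real (s n) * prob (Ball (r n)) \<le> 2 * (real (s n) * r n)) sequentially"
        using mult_left_mono[OF b_le, of "real (s _)"] by (intro always_eventually) (simp add: b_def mult_ac)
      show "(\<lambda>n. 2 * (real (s n) * r n)) \<longlonglongrightarrow> 0" using tendsto_mult_left[OF sr, of 2] by simp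
    qed auto
    have "(\<lambda>n. C' * (\<kappa> ^ m n / r n ^ 3)) \<longlonglongrightarrow> C' * 0"
      by (intro tendsto_mult_left scales)
    then have lim: "(\<lambda>n. C' * (\<kappa> ^ m n / r n ^ 3)) \<longlonglongrightarrow> 0" by simp
    show "(\<lambda>n. prob ((approx (Ball (r n)) (m n) - ((T ^^ m n) -` Ball (r n) \<inter> space \<mu>)) \<union>
        (((T ^^ m n) -` Ball (r n) \<inter> space \<mu>) - approx (Ball (r n)) (m n))) / prob (Ball (r n))) \<longlonglongrightarrow> 0"
    proof (rule tendsto_sandwich[OF _ _ tendsto_const lim])
      show "eventually (\<lambda>n. prob ((approx (Ball (r n)) (m n) - ((T ^^ m n) -` Ball (r n) \<inter> space \<mu>)) \<union>
        (((T ^^ m n) -` Ball (r n) \<inter> space \<mu>) - approx (Ball (r n)) (m n))) / prob (Ball (r n))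
        \<le> C' * (\<kappa> ^ m n / r n ^ 3)) sequentially"
        using small eventually_compose_filterlim[OF cube r0]
      proof eventually_elim
        case (elim n)
        obtain G where G: "G \<in> sets \<mu>" "prob G \<le> C' * \<kappa> ^ m n"
          "\<And>b b'. b \<in> Ball (r n) \<Longrightarrow> b' \<in> unit_square \<Longrightarrow> b' \<notin> Ball (r n) \<Longrightarrow> \<bar>fst b - fst b'\<bar> \<le> \<gamma> ^ m n \<Longrightarrow>
            \<bar>snd b - snd b'\<bar> \<le> (1/2) ^ m n \<Longrightarrow> b \<in> G"
          using annulus[OF r(1) elim(1), of "m n"] by blast
        have "prob ((approx (Ball (r n)) (m n) - ((T ^^ m n) -` Ball (r n) \<inter> space \<mu>)) \<union>
          (((T ^^ m n) -` Ball (r n) \<inter> space \<mu>) - approx (Ball (r n)) (m n))) \<le> C' * \<kappa> ^ m n"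
          using approx_error[OF Ball G(1,3)] G(2) by (rule order_trans)
        moreover have "0 \<le> C' * \<kappa> ^ m n" using G(2) measure_nonneg[of \<mu> G] by linarith
        ultimately have "prob ((approx (Ball (r n)) (m n) - ((T ^^ m n) -` Ball (r n) \<inter> space \<mu>)) \<union>
          (((T ^^ m n) -` Ball (r n) \<inter> space \<mu>) - approx (Ball (r n)) (m n))) / prob (Ball (r n))
          \<le> C' * \<kappa> ^ m n / r n ^ 3"
          using elim r(1)[of n] by (intro frac_le) auto
        then show ?case by simp
      qed
    qed auto
    show "prob {x \<in> space \<mu>. visits T (approx (Ball (r n)) (m n)) {..<s n} x = a \<and>
          visits T (approx (Ball (r n)) (m n)) I ((T ^^ L n) x) = b} =
        prob {x \<in> space \<mu>. visits T (approx (Ball (r n)) (m n)) {..<s n} x = a} *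
        prob {x \<in> space \<mu>. visits T (approx (Ball (r n)) (m n)) I x = b}" for n a b I
      by (rule approx_indep) (simp add: L_def)
    show "\<exists>P. eventually (\<lambda>n. \<forall>t. P \<le> t \<and> t \<le> s n \<longrightarrow>
        \<bar>prob {x \<in> Ball (r n). visits T (Ball (r n)) {1..t} x = k} - \<Theta> * (1 - \<Theta>) ^ k * prob (Ball (r n))\<bar>
        \<le> \<epsilon> * prob (Ball (r n))) sequentially" if \<epsilon>: "\<epsilon> > 0" for k \<epsilon>
    proof -
      obtain P0 where P0: "\<And>P. P \<ge> P0 \<Longrightarrow> eventually (\<lambda>r. measure \<mu> {w \<in> Ball r. visits T (Ball r) {1..P} w = k}
        = \<Theta> * (1 - \<Theta>) ^ k * measure \<mu> (Ball r)) (at_right 0)"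
        using returns[of k] by blast
      \<comment> \<open>The geometric tail of the late returns contributes at most
        \<open>4 * C / 2 ^ P\<close> relative to \<open>b n\<close>, which has to be at most
        \<epsilon>/2; \<open>C + 1\<close> keeps the denominator positive when
        \<open>C = 0\<close>.\<close>
      obtain P1 where P1: "(1/2) ^ P1 < \<epsilon> / (8 * (C + 1))"
        using real_arch_pow_inv[of "\<epsilon> / (8 * (C + 1))" "1/2"] \<epsilon> C_pos by auto
      define P where "P = max P0 P1"
      have "(1/2 :: real) ^ P \<le> (1/2) ^ P1" unfolding P_def by (intro power_decreasing) auto
      then have "(1/2) ^ P < \<epsilon> / (8 * (C + 1))" by (rule le_less_trans[OF _ P1])
      then have "(1/2) ^ P * (8 * (C + 1)) < \<epsilon>"
        using C_pos by (subst (asm) pos_less_divide_eq) auto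
      moreover have "(1/2) ^ P * (8 * (C + 1)) = 8 * C * (1 / 2 ^ P) + 8 * (1 / 2 ^ P)"
        unfolding power_one_over by (simp only: distrib_left distrib_right mult_ac mult_1_right)
      moreover have "0 < (1 / 2 ^ P :: real)" by simp
      ultimately have P2: "4 * C * (1 / 2 ^ P) \<le> \<epsilon> / 2" by linarith
      have "(\<lambda>n. 4 * C * (real (s n) * r n)) \<longlonglongrightarrow> 0" using tendsto_mult_left[OF sr, of "4 * C"] by simp
      then have "eventually (\<lambda>n. 4 * C * (real (s n) * r n) < \<epsilon> / 2) sequentially"
        using \<epsilon> by (intro order_tendstoD) auto
      moreover have "eventually (\<lambda>n. measure \<mu> {w \<in> Ball (r n). visits T (Ball (r n)) {1..P} w = k}
        = \<Theta> * (1 - \<Theta>) ^ k * measure \<mu> (Ball (r n))) sequentially"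
        by (rule eventually_compose_filterlim[OF P0 r0]) (simp add: P_def)
      ultimately have "eventually (\<lambda>n. \<forall>t. P \<le> t \<and> t \<le> s n \<longrightarrow>
        \<bar>prob {x \<in> Ball (r n). visits T (Ball (r n)) {1..t} x = k} - \<Theta> * (1 - \<Theta>) ^ k * prob (Ball (r n))\<bar>
        \<le> \<epsilon> * prob (Ball (r n))) sequentially"
        using small
      proof eventually_elim
        case (elim n)
        show ?case
        proof (intro allI impI)
          fix t assume t: "P \<le> t \<and> t \<le> s n"
          have rn: "0 < r n" by (rule r)
          have "\<bar>prob {x \<in> Ball (r n). visits T (Ball (r n)) {1..t} x = k} - \<Theta> * (1 - \<Theta>) ^ k * prob (Ball (r n))\<bar>
            \<le> (\<Sum>i\<in>{P<..t}. prob {x \<in> Ball (r n). (T ^^ i) x \<in> Ball (r n)})"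
            using return_visits_diff[OF Ball, of P t "r n" k] t elim(2) by simp
          also have "\<dots> \<le> (\<Sum>i\<in>{P<..t}. (4 * r n + 4 * (1 / 2 ^ i)) * (C * b n))"
          proof (rule sum_mono)
            fix i
            have "prob {x \<in> Ball (r n). (T ^^ i) x \<in> Ball (r n)}
              \<le> measure nu {t. \<bar>t - fst z\<bar> < r n} * ((2 * r n + 2 / 2 ^ i) * (2 * r n))"
              using rn by (intro measure_return_le Ball sub) auto
            also have "\<dots> = (4 * r n + 4 * (1 / 2 ^ i)) * (measure nu {t. \<bar>t - fst z\<bar> < r n} * r n)"
              by (simp add: algebra_simps)
            \<comment> \<open>The estimate was made on the rectangle around the ball;
              \<open>lower\<close> relates it to the measure of the ball itself, so that it bounds a
              conditional probability given a start in the ball.\<close>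
            also have "\<dots> \<le> (4 * r n + 4 * (1 / 2 ^ i)) * (C * b n)"
              unfolding b_def using rn elim by (intro mult_left_mono lower) auto
            finally show "prob {x \<in> Ball (r n). (T ^^ i) x \<in> Ball (r n)} \<le> (4 * r n + 4 * (1 / 2 ^ i)) * (C * b n)" .
          qed
          also have "\<dots> = (4 * r n * real (card {P<..t}) + 4 * (\<Sum>i\<in>{P<..t}. 1 / 2 ^ i)) * (C * b n)"
            by (simp only: sum_distrib_right[symmetric] sum.distrib sum_distrib_left[symmetric] sum_constant mult_ac)
          also have "\<dots> \<le> (4 * r n * real (s n) + 4 * (1 / 2 ^ P)) * (C * b n)"
            using t rn C_pos b_pos[of n]
            by (intro mult_right_mono add_mono mult_left_mono sum_half_powers_le) auto
          also have "\<dots> = (4 * C * (real (s n) * r n) + 4 * C * (1 / 2 ^ P)) * b n"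
            by (simp add: algebra_simps)
          also have "\<dots> \<le> \<epsilon> * b n"
            using elim(1) P2 b_pos[of n] by (intro mult_right_mono) linarith+
          finally show "\<bar>prob {x \<in> Ball (r n). visits T (Ball (r n)) {1..t} x = k} - \<Theta> * (1 - \<Theta>) ^ k * prob (Ball (r n))\<bar>
            \<le> \<epsilon> * prob (Ball (r n))" by (simp add: b_def)
        qed
      qed
      then show ?thesis ..
    qed
  qed (use \<Theta> \<tau> b_pos in \<open>auto simp: b_def\<close>)
  then show ?thesis .
qed

end

section \<open>Geometry of the balls and of short returns\<close>

lemma doubling_funpow_0 [simp]: "(doubling ^^ i) 0 = 0"
  by (induction i) (auto simp: doubling_def)

lemma doubling_funpow_1 [simp]: "(doubling ^^ i) 1 = 1"
  by (induction i) (auto simp: doubling_def)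

lemma leb_ball_ge:
  assumes "0 \<le> y0" "y0 \<le> 1" "0 < r" "r \<le> 1/2"
  shows "r \<le> leb (\<lambda>y. \<bar>y - y0\<bar> < r)"
proof -
  \<comment> \<open>A one-sided interval of length \<open>r\<close> that stays in the unit interval:
    to the right of \<open>y0\<close> in the lower half, to the left of it in the upper
    half.\<close>
  define a where "a = (if y0 \<le> 1/2 then y0 else y0 - r)"
  have "measure lborel {a<..<a + r} \<le> leb (\<lambda>y. \<bar>y - y0\<bar> < r)"
    unfolding leb_def using assms
    by (intro measure_mono_fmeasurable fmeasurable_unit_interval) (auto simp: a_def split: if_splits)
  then show ?thesis using assms by simp
qed

text \<open>The slope is 2 in the interior and 1 at the two endpoints. Exact linearity makes the
  later ratios of measures eventually constant, with \<open>c\<close> cancelling.\<close>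

lemma leb_small_ball:
  assumes "0 \<le> y0" "y0 \<le> 1"
  obtains c \<rho> where "0 < c" "0 < \<rho>" "\<And>r. 0 \<le> r \<Longrightarrow> r \<le> \<rho> \<Longrightarrow> leb (\<lambda>y. \<bar>y - y0\<bar> < r) = c * r"
proof (cases "0 < y0 \<and> y0 < 1")
  case True
  have "leb (\<lambda>y. \<bar>y - y0\<bar> < r) = 2 * r" if "0 \<le> r" "r \<le> min y0 (1 - y0)" for r
  proof -
    have "{y \<in> {0..<1}. \<bar>y - y0\<bar> < r} = {y0 - r<..<y0 + r}" using that by (auto simp: abs_less_iff)
    then show ?thesis using that unfolding leb_def by simp
  qed
  then show ?thesis using True by (intro that[of 2 "min y0 (1 - y0)"]) auto
next
  case False
  then have y0: "y0 = 0 \<or> y0 = 1" using assms by auto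
  have "leb (\<lambda>y. \<bar>y - y0\<bar> < r) = 1 * r" if "0 \<le> r" "r \<le> 1/2" for r
  proof (cases "y0 = 0")
    case True
    have "{y \<in> {0..<1}. \<bar>y - y0\<bar> < r} = {0..<r}" using that True by auto
    then show ?thesis using that unfolding leb_def by simp
  next
    case False
    have "{y \<in> {0..<1}. \<bar>y - y0\<bar> < r} = {1 - r<..<1}" using that False y0 by auto
    then show ?thesis using that unfolding leb_def by simp
  qed
  then show ?thesis by (intro that[of 1 "1/2"]) auto
qed

definition max_dist :: "real \<times> real \<Rightarrow> real \<times> real \<Rightarrow> real" where
  "max_dist v w = max \<bar>fst v - fst w\<bar> \<bar>snd v - snd w\<bar>"

lemma max_dist_less_iff: "max_dist v w < r \<longleftrightarrow> \<bar>fst v - fst w\<bar> < r \<and> \<bar>snd v - snd w\<bar> < r"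
  by (auto simp: max_dist_def)

lemma mem_max_ball: "w \<in> max_ball z r \<longleftrightarrow> w \<in> unit_square \<and> max_dist w z < r"
  by (simp add: max_ball_def max_dist_def)

lemma max_dist_pos: "v \<noteq> w \<Longrightarrow> 0 < max_dist v w"
  by (auto simp: max_dist_def prod_eq_iff less_max_iff_disj)

lemma max_dist_triangle: "max_dist u w \<le> max_dist v u + max_dist v w"
  unfolding max_dist_def by linarith

context baker_srb
begin

text \<open>A point near \<open>z\<close> that is separated from \<open>z\<close> by the discontinuity comes close to the
  invariant line \<open>y = 1\<close>, and stays there.\<close>

lemma funpow_close:
  assumes z: "z \<in> unit_square" and "\<epsilon> > 0"
  shows "\<exists>\<delta>>0. \<forall>w. w \<in> unit_square \<and> max_dist w z < \<delta> \<longrightarrow>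
    max_dist ((T ^^ i) w) ((T ^^ i) z) < \<epsilon> \<or> (snd z < 1 \<and> \<bar>snd ((T ^^ i) w) - 1\<bar> < \<epsilon>)"
  using \<open>\<epsilon> > 0\<close>
proof (induction i arbitrary: \<epsilon>)
  case 0
  then show ?case by auto
next
  case (Suc i)
  define c where "c = (T ^^ i) z"
  \<comment> \<open>The bound \<epsilon>/2 allows for the vertical expansion by 2, the bound 1/2
    keeps points near height 1 on the upper branch, and the last one keeps neighbours of
    \<open>c\<close> on its side of the discontinuity, unless \<open>c\<close> lies on it; then 1 is
    only a neutral value.\<close>
  define \<eta> where "\<eta> = min (min (\<epsilon> / 2) (1/2)) (if snd c = 1/2 then 1 else \<bar>snd c - 1/2\<bar>)"
  have \<eta>: "\<eta> > 0" "\<eta> \<le> \<epsilon> / 2" "\<eta> \<le> 1/2" "snd c \<noteq> 1/2 \<Longrightarrow> \<eta> \<le> \<bar>snd c - 1/2\<bar>"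
    using Suc.prems by (auto simp: \<eta>_def)
  obtain \<delta> where \<delta>: "\<delta> > 0" "\<And>w. w \<in> unit_square \<Longrightarrow> max_dist w z < \<delta> \<Longrightarrow>
      max_dist ((T ^^ i) w) c < \<eta> \<or> (snd z < 1 \<and> \<bar>snd ((T ^^ i) w) - 1\<bar> < \<eta>)"
    using Suc.IH[OF \<eta>(1)] unfolding c_def by blast
  have "max_dist (T v) (T c) < \<epsilon> \<or> (snd z < 1 \<and> \<bar>snd (T v) - 1\<bar> < \<epsilon>)"
    if v: "v \<in> unit_square" and alt: "max_dist v c < \<eta> \<or> (snd z < 1 \<and> \<bar>snd v - 1\<bar> < \<eta>)" for v
    using alt
  proof
    assume vc: "max_dist v c < \<eta>"
    have same: "max_dist (T v) (T c) < \<epsilon>" if "snd v < 1/2 \<longleftrightarrow> snd c < 1/2"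
    proof -
      have eqs: "fst (T v) - fst (T c) = \<gamma> * (fst v - fst c)" "snd (T v) - snd (T c) = 2 * (snd v - snd c)"
        using that by (auto simp: fst_baker snd_baker doubling_def algebra_simps)
      moreover have "\<gamma> * \<bar>fst v - fst c\<bar> \<le> 1 * \<bar>fst v - fst c\<bar>"
        using \<gamma>_less by (intro mult_right_mono) auto
      moreover have "\<bar>\<gamma> * (fst v - fst c)\<bar> = \<gamma> * \<bar>fst v - fst c\<bar>" "\<bar>2 * (snd v - snd c)\<bar> = 2 * \<bar>snd v - snd c\<bar>"
        using \<gamma>_pos by (simp_all only: abs_mult abs_numeral abs_of_pos)
      moreover have "\<bar>fst v - fst c\<bar> < \<eta>" "\<bar>snd v - snd c\<bar> < \<eta>"
        using vc by (auto simp: max_dist_less_iff)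
      ultimately show ?thesis
        using \<eta>(2) Suc.prems unfolding max_dist_less_iff eqs by (intro conjI; linarith)
    qed
    show ?thesis
    proof (cases "snd v < 1/2 \<longleftrightarrow> snd c < 1/2")
      case True
      then show ?thesis using same by blast
    next
      case False
      have c: "snd c = 1/2"
      proof (rule ccontr)
        assume n: "snd c \<noteq> 1/2"
        have "\<bar>snd v - snd c\<bar> < \<eta>" using vc by (simp add: max_dist_less_iff)
        then show False using False \<eta>(4)[OF n] by linarith
      qed
      \<comment> \<open>The lower branch sends heights just below 1/2 to heights just below
        1.\<close>
      have v2: "snd v < 1/2" using False c by simp
      have "\<bar>snd v - 1/2\<bar> < \<eta>" using vc c by (simp add: max_dist_less_iff)
      then have "\<bar>snd (T v) - 1\<bar> < \<epsilon>" using v2 \<eta> by (simp add: snd_baker doubling_def)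
      \<comment> \<open>From height 1 the orbit never leaves the line y = 1, so it could not meet
        the discontinuity.\<close>
      moreover have "snd z < 1"
      proof (rule ccontr)
        assume "\<not> snd z < 1"
        then have "snd z = 1" using z by (simp add: mem_unit_square)
        then show False using c by (simp add: c_def snd_baker_funpow)
      qed
      ultimately show ?thesis by blast
    qed
  next
    assume z1: "snd z < 1 \<and> \<bar>snd v - 1\<bar> < \<eta>"
    then have "\<not> snd v < 1/2" using \<eta>(3) by linarith
    then have "snd (T v) = 2 * snd v - 1" by (simp add: snd_baker doubling_def)
    then have "\<bar>snd (T v) - 1\<bar> < \<epsilon>" using z1 \<eta>(2) by linarith
    then show ?thesis using z1 by blast
  qed
  then show ?case using \<delta> T_funpow_unit_square by (intro exI[of _ \<delta>]) (auto simp: c_def)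
qed

text \<open>A neighbour of \<open>z\<close> either follows the orbit of \<open>z\<close>, which at
  time \<open>i\<close> is away from \<open>z\<close>, or has been cut off by the discontinuity. In
  the latter case it is near height 1, also away from \<open>z\<close>, since this happens only for
  \<open>snd z < 1\<close>.\<close>

lemma no_early_return:
  assumes z: "z \<in> unit_square" and nz: "(T ^^ i) z \<noteq> z"
  shows "eventually (\<lambda>r. \<forall>w\<in>max_ball z r. (T ^^ i) w \<notin> max_ball z r) (at_right 0)"
proof -
  define D where "D = max_dist ((T ^^ i) z) z"
  define \<epsilon> where "\<epsilon> = min (D / 2) (if snd z < 1 then (1 - snd z) / 2 else 1)"
  have D: "D > 0" unfolding D_def by (rule max_dist_pos[OF nz])
  have \<epsilon>: "\<epsilon> > 0" "\<epsilon> \<le> D / 2" using D by (auto simp: \<epsilon>_def)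
  have \<epsilon>3: "\<epsilon> \<le> (1 - snd z) / 2" if "snd z < 1"
    using that unfolding \<epsilon>_def by (simp only: if_True min.cobounded2)
  obtain \<delta> where \<delta>: "\<delta> > 0" "\<And>w. w \<in> unit_square \<Longrightarrow> max_dist w z < \<delta> \<Longrightarrow>
    max_dist ((T ^^ i) w) ((T ^^ i) z) < \<epsilon> \<or> (snd z < 1 \<and> \<bar>snd ((T ^^ i) w) - 1\<bar> < \<epsilon>)"
    using funpow_close[OF z \<epsilon>(1)] by blast
  show ?thesis
    unfolding eventually_at_right_field
  proof (intro exI[of _ "min \<delta> \<epsilon>"] conjI allI impI ballI notI)
    show "min \<delta> \<epsilon> > 0" using \<delta> \<epsilon> by simp
    fix r w assume "r < min \<delta> \<epsilon>" "w \<in> max_ball z r" "(T ^^ i) w \<in> max_ball z r"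
    then have w: "max_dist w z < min \<delta> \<epsilon>" "w \<in> unit_square" and ret: "max_dist ((T ^^ i) w) z < min \<delta> \<epsilon>"
      by (auto simp: mem_max_ball)
    from \<delta>(2)[OF w(2)] w(1) consider "max_dist ((T ^^ i) w) ((T ^^ i) z) < \<epsilon>"
      | "snd z < 1" "\<bar>snd ((T ^^ i) w) - 1\<bar> < \<epsilon>" by auto
    then show False
    proof cases
      case 1
      then show False using ret \<epsilon> max_dist_triangle[of "(T ^^ i) z" z "(T ^^ i) w"] unfolding D_def by simp
    next
      case 2
      have "\<bar>snd ((T ^^ i) w) - snd z\<bar> < \<epsilon>" using ret by (simp add: max_dist_less_iff)
      then show False using 2 \<epsilon>3[OF 2(1)] by (simp add: abs_less_iff)
    qed
  qed
qed

text \<open>Height 1/2 is mapped to the fixed height 0, so an orbit that passes through 1/2 never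
  comes back to it.\<close>

lemma periodic_orbit_avoids_discontinuity:
  assumes "(T ^^ p) z = z" "p > 0"
  shows "snd ((T ^^ j) z) \<noteq> 1/2"
proof
  assume half: "snd ((T ^^ j) z) = 1/2"
  obtain q where q: "p = Suc q" using \<open>p > 0\<close> by (cases p) auto
  have "(T ^^ (j + p)) z = (T ^^ j) z" using assms(1) by (simp add: funpow_add)
  moreover have "(T ^^ (q + Suc j)) z = (T ^^ q) (T ((T ^^ j) z))" by (simp add: funpow_add funpow_swap1)
  moreover have "j + p = q + Suc j" by (simp add: q)
  ultimately have "(T ^^ j) z = (T ^^ q) (T ((T ^^ j) z))" by metis
  from arg_cong[OF this, of snd] have "snd ((T ^^ j) z) = (doubling ^^ q) (doubling (snd ((T ^^ j) z)))"
    by (simp only: snd_baker_funpow snd_baker)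
  also have "\<dots> = 0" unfolding half by (simp add: doubling_def)
  finally show False using half by simp
qed

lemma funpow_locally_affine:
  assumes "\<And>j. j < i \<Longrightarrow> snd ((T ^^ j) z) \<noteq> 1/2"
  shows "\<exists>\<delta>>0. \<forall>w. max_dist w z < \<delta> \<longrightarrow> fst ((T ^^ i) w) - fst ((T ^^ i) z) = \<gamma> ^ i * (fst w - fst z)
    \<and> snd ((T ^^ i) w) - snd ((T ^^ i) z) = 2 ^ i * (snd w - snd z)"
  using assms
proof (induction i)
  case 0
  show ?case by (auto intro: exI[of _ 1])
next
  case (Suc i)
  define c where "c = (T ^^ i) z"
  have c: "snd c \<noteq> 1/2" using Suc.prems[of i] by (simp add: c_def)
  obtain \<delta> where \<delta>: "\<delta> > 0" "\<And>w. max_dist w z < \<delta> \<Longrightarrow> fst ((T ^^ i) w) - fst c = \<gamma> ^ i * (fst w - fst z)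
    \<and> snd ((T ^^ i) w) - snd c = 2 ^ i * (snd w - snd z)"
    using Suc.IH Suc.prems unfolding c_def by force
  \<comment> \<open>The division by \<open>2 ^ i\<close> compensates the vertical expansion up to
    time \<open>i\<close>, so that \<open>w\<close> and \<open>z\<close> still take the same branch
    at the next step.\<close>
  define \<eta> where "\<eta> = min \<delta> (\<bar>snd c - 1/2\<bar> / 2 ^ i)"
  have \<eta>: "\<eta> > 0" using \<delta>(1) c by (simp add: \<eta>_def)
  have "fst (T v) - fst (T c) = \<gamma> ^ Suc i * (fst w - fst z)
    \<and> snd (T v) - snd (T c) = 2 ^ Suc i * (snd w - snd z)"
    if w: "max_dist w z < \<eta>" and v: "v = (T ^^ i) w" for w v
  proof -
    have d: "fst v - fst c = \<gamma> ^ i * (fst w - fst z)" "snd v - snd c = 2 ^ i * (snd w - snd z)"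
      using \<delta>(2)[of w] w by (auto simp: \<eta>_def v)
    have "\<bar>snd w - snd z\<bar> < \<bar>snd c - 1/2\<bar> / 2 ^ i" using w by (simp add: \<eta>_def max_dist_less_iff)
    then have "2 ^ i * \<bar>snd w - snd z\<bar> < \<bar>snd c - 1/2\<bar>" by (simp add: field_simps)
    then have "\<bar>snd v - snd c\<bar> < \<bar>snd c - 1/2\<bar>" unfolding d by (simp add: abs_mult)
    then have "snd v < 1/2 \<longleftrightarrow> snd c < 1/2" by linarith
    then have "fst (T v) - fst (T c) = \<gamma> * (fst v - fst c)" "snd (T v) - snd (T c) = 2 * (snd v - snd c)"
      by (auto simp: fst_baker snd_baker doubling_def algebra_simps)
    then show ?thesis unfolding d by simp
  qed
  then show ?case using \<eta> by (intro exI[of _ \<eta>]) (auto simp: c_def)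
qed

section \<open>Boundary layers of the balls\<close>

lemma nu_annulus_le:
  "\<exists>K. \<forall>x r m. measure nu {t. r - \<gamma> ^ m \<le> \<bar>t - x\<bar> \<and> \<bar>t - x\<bar> \<le> r} \<le> K * (1/2) ^ m"
proof -
  obtain c where c: "\<gamma> ^ c < 1 - 2 * \<gamma>"
    using real_arch_pow_inv[of "1 - 2 * \<gamma>" \<gamma>] \<gamma>_less by auto
  \<comment> \<open>An annulus is covered by two intervals of length \<open>\<gamma> ^ m\<close>; to
    fit such an interval under the gap condition of the interval bound costs \<open>c\<close>
    levels, hence the factor \<open>2 ^ c\<close>.\<close>
  have iv: "measure nu {t. a \<le> t \<and> t \<le> a + \<gamma> ^ m} \<le> 2 ^ c * (1/2) ^ m" for a m
  proof (cases "c \<le> m")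
    case True
    have "(a + \<gamma> ^ m) - a = \<gamma> ^ c * \<gamma> ^ (m - c)" using True by (simp flip: power_add)
    also have "\<dots> \<le> (1 - 2 * \<gamma>) * \<gamma> ^ (m - c)" using c \<gamma>_pos by (intro mult_right_mono) auto
    finally have "measure nu {t. a \<le> t \<and> t \<le> a + \<gamma> ^ m} \<le> (1/2) ^ (m - c)" by (rule nu_interval_le)
    also have "\<dots> = 2 ^ c * (1/2) ^ m" using True by (simp add: power_one_over power_diff)
    finally show ?thesis .
  next
    case False
    have "(1::real) = 2 ^ m * (1/2) ^ m" by (simp add: power_one_over)
    also have "\<dots> \<le> 2 ^ c * (1/2) ^ m" using False by (intro mult_right_mono power_increasing) auto
    finally show ?thesis using nu.prob_le_1 order_trans by blast
  qed
  have "measure nu {t. r - \<gamma> ^ m \<le> \<bar>t - x\<bar> \<and> \<bar>t - x\<bar> \<le> r} \<le> 2 * 2 ^ c * (1/2) ^ m" for x r m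
  proof -
    let ?a = "x + r - \<gamma> ^ m" and ?b = "x - r"
    have "measure nu {t. r - \<gamma> ^ m \<le> \<bar>t - x\<bar> \<and> \<bar>t - x\<bar> \<le> r}
      \<le> measure nu ({t. ?a \<le> t \<and> t \<le> ?a + \<gamma> ^ m} \<union> {t. ?b \<le> t \<and> t \<le> ?b + \<gamma> ^ m})"
      by (intro nu.finite_measure_mono) (auto simp: abs_if split: if_splits)
    also have "\<dots> \<le> measure nu {t. ?a \<le> t \<and> t \<le> ?a + \<gamma> ^ m} + measure nu {t. ?b \<le> t \<and> t \<le> ?b + \<gamma> ^ m}"
      by (intro measure_Un_le) auto
    also have "\<dots> \<le> 2 * 2 ^ c * (1/2) ^ m" using iv[of ?a m] iv[of ?b m] by linarith
    finally show ?thesis .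
  qed
  then show ?thesis by blast
qed

lemma leb_annulus_le:
  "d \<ge> 0 \<Longrightarrow> leb (\<lambda>y. r - d \<le> \<bar>y - y0\<bar> \<and> \<bar>y - y0\<bar> \<le> r) \<le> 2 * d"
proof -
  assume d: "d \<ge> 0"
  have f: "{a..b} \<in> fmeasurable lborel" for a b :: real
    by (cases "a \<le> b") (auto simp: fmeasurable_def)
  have "leb (\<lambda>y. r - d \<le> \<bar>y - y0\<bar> \<and> \<bar>y - y0\<bar> \<le> r)
    \<le> measure lborel ({y0 + r - d..y0 + r} \<union> {y0 - r..y0 - r + d})"
    unfolding leb_def by (intro measure_mono_fmeasurable fmeasurable.Un f) auto
  also have "\<dots> \<le> measure lborel {y0 + r - d..y0 + r} + measure lborel {y0 - r..y0 - r + d}"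
    by (intro measure_Un_le) auto
  finally show ?thesis using d by simp
qed

text \<open>If \<open>b\<close> is in the ball and \<open>b'\<close> is not, some coordinate of
  \<open>b'\<close> is at distance at least \<open>r\<close> from that of \<open>z\<close>. So
  \<open>b\<close> lies in the layer \<open>G1\<close> along the vertical sides or in the layer
  \<open>G2\<close> along the horizontal ones.\<close>

lemma max_ball_annulus:
  "\<exists>K. \<forall>z r m. \<exists>G\<in>sets \<mu>. measure \<mu> G \<le> K * (1/2) ^ m \<and>
      (\<forall>b b'. b \<in> max_ball z r \<and> b' \<in> unit_square \<and> b' \<notin> max_ball z r \<and> \<bar>fst b - fst b'\<bar> \<le> \<gamma> ^ m \<and>
        \<bar>snd b - snd b'\<bar> \<le> (1/2) ^ m \<longrightarrow> b \<in> G)"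
proof -
  obtain K where K: "\<And>x r m. measure nu {t. r - \<gamma> ^ m \<le> \<bar>t - x\<bar> \<and> \<bar>t - x\<bar> \<le> r} \<le> K * (1/2) ^ m"
    using nu_annulus_le by blast
  have "\<exists>G\<in>sets \<mu>. measure \<mu> G \<le> (K + 2) * (1/2) ^ m \<and>
      (\<forall>b b'. b \<in> max_ball z r \<and> b' \<in> unit_square \<and> b' \<notin> max_ball z r \<and> \<bar>fst b - fst b'\<bar> \<le> \<gamma> ^ m \<and>
        \<bar>snd b - snd b'\<bar> \<le> (1/2) ^ m \<longrightarrow> b \<in> G)" for z r m
  proof -
    define G1 where "G1 = {w \<in> unit_square. r - \<gamma> ^ m \<le> \<bar>fst w - fst z\<bar> \<and> \<bar>fst w - fst z\<bar> \<le> r}"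
    define G2 where "G2 = {w \<in> unit_square. r - (1/2) ^ m \<le> \<bar>snd w - snd z\<bar> \<and> \<bar>snd w - snd z\<bar> \<le> r}"
    have [measurable]: "G1 \<in> sets \<mu>" "G2 \<in> sets \<mu>" unfolding G1_def G2_def
      by (rule borel_sets_\<mu>; measurable)+
    have "measure \<mu> G1 = measure nu {t. r - \<gamma> ^ m \<le> \<bar>t - fst z\<bar> \<and> \<bar>t - fst z\<bar> \<le> r}"
      using measure_\<mu>_product[of "\<lambda>t. r - \<gamma> ^ m \<le> \<bar>t - fst z\<bar> \<and> \<bar>t - fst z\<bar> \<le> r" "\<lambda>_. True"]
      by (simp add: G1_def)
    moreover have "measure \<mu> G2 = leb (\<lambda>y. r - (1/2) ^ m \<le> \<bar>y - snd z\<bar> \<and> \<bar>y - snd z\<bar> \<le> r)"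
      unfolding G2_def by (rule measure_\<mu>_snd) measurable
    moreover have "leb (\<lambda>y. r - (1/2) ^ m \<le> \<bar>y - snd z\<bar> \<and> \<bar>y - snd z\<bar> \<le> r) \<le> 2 * (1/2) ^ m"
      by (rule leb_annulus_le) simp
    moreover have "measure \<mu> (G1 \<union> G2) \<le> measure \<mu> G1 + measure \<mu> G2" by (intro measure_Un_le) auto
    ultimately have "measure \<mu> (G1 \<union> G2) \<le> K * (1/2) ^ m + 2 * (1/2) ^ m"
      using K[of r m "fst z"] by linarith
    then have "measure \<mu> (G1 \<union> G2) \<le> (K + 2) * (1/2) ^ m" by (simp add: algebra_simps)
    moreover have "b \<in> G1 \<union> G2" if "b \<in> max_ball z r" "b' \<in> unit_square" "b' \<notin> max_ball z r" "\<bar>fst b - fst b'\<bar> \<le> \<gamma> ^ m"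
        "\<bar>snd b - snd b'\<bar> \<le> (1/2) ^ m" for b b'
    proof -
      have b: "b \<in> unit_square" "\<bar>fst b - fst z\<bar> < r" "\<bar>snd b - snd z\<bar> < r"
        and b': "\<not> (\<bar>fst b' - fst z\<bar> < r \<and> \<bar>snd b' - snd z\<bar> < r)"
        using that by (auto simp: mem_max_ball max_dist_less_iff)
      then show ?thesis using that(4,5) unfolding G1_def G2_def Un_iff mem_Collect_eq by linarith
    qed
    moreover have "G1 \<union> G2 \<in> sets \<mu>" by simp
    ultimately show ?thesis by blast
  qed
  then show ?thesis by (intro exI[of _ "K + 2"] allI)
qed

lemma euclid_ball_sets: "euclid_ball z r \<in> sets \<mu>"
  unfolding euclid_ball_def by (intro borel_sets_\<mu>) measurable

lemma euclid_ball_subset: "euclid_ball z r \<subseteq> max_ball z r"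
proof
  fix w assume w: "w \<in> euclid_ball z r"
  then have "dist (fst z) (fst w) < r" "dist (snd z) (snd w) < r"
    using dist_fst_le[of z w] dist_snd_le[of z w] by (auto simp: euclid_ball_def)
  then show "w \<in> max_ball z r" using w by (auto simp: euclid_ball_def mem_max_ball max_dist_less_iff dist_real_def)
qed

lemma max_ball_half_subset: "max_ball z (r / 2) \<subseteq> euclid_ball z r"
proof
  fix w assume w: "w \<in> max_ball z (r / 2)"
  then have "\<bar>fst z - fst w\<bar> + \<bar>snd z - snd w\<bar> < r"
    unfolding mem_max_ball max_dist_less_iff by linarith
  moreover have "dist z w \<le> \<bar>fst z - fst w\<bar> + \<bar>snd z - snd w\<bar>"
    unfolding dist_prod_def dist_real_def using sqrt_sum_squares_le_sum_abs by simp
  ultimately show "w \<in> euclid_ball z r" using w by (auto simp: euclid_ball_def mem_max_ball)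
qed

text \<open>A vertical leaf meets the annulus within two segments of length \<open>h - h'\<close>,
  and \<open>(h - h')\<^sup>2 \<le> h\<^sup>2 - h'\<^sup>2\<close>. The square root is the price of
  leaves tangent to the inner circle.\<close>

lemma euclid_annulus_measure:
  assumes "0 \<le> r'" "r' \<le> r"
  shows "measure \<mu> {w \<in> unit_square. r' \<le> dist z w \<and> dist z w < r} \<le> 2 * sqrt (r\<^sup>2 - r'\<^sup>2)"
proof (rule measure_\<mu>_le)
  show "{w \<in> unit_square. r' \<le> dist z w \<and> dist z w < r} \<in> sets \<mu>"
    by (intro borel_sets_\<mu>) measurable
  have r2: "r'\<^sup>2 \<le> r\<^sup>2" using assms by (intro power_mono) auto
  then show "0 \<le> 2 * sqrt (r\<^sup>2 - r'\<^sup>2)" by simp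
  fix x
  define a where "a = (fst z - x)\<^sup>2"
  \<comment> \<open>The maximum with 0 takes care of leaves that do not meet the circle.\<close>
  define h where "h = sqrt (max 0 (r\<^sup>2 - a))"
  define h' where "h' = sqrt (max 0 (r'\<^sup>2 - a))"
  have h: "0 \<le> h'" "h' \<le> h" using r2 by (auto simp: h_def h'_def)
  have "(h - h')\<^sup>2 \<le> h\<^sup>2 - h'\<^sup>2"
  proof -
    have "h' * h' \<le> h * h'" using h by (intro mult_right_mono)
    then show ?thesis by (simp add: power2_eq_square algebra_simps)
  qed
  also have "\<dots> \<le> r\<^sup>2 - r'\<^sup>2" using r2 by (auto simp: h_def h'_def max_def a_def)
  finally have diff: "h - h' \<le> sqrt (r\<^sup>2 - r'\<^sup>2)" by (rule real_le_rsqrt)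
  have "{y \<in> {0..1}. (x, y) \<in> {w \<in> unit_square. r' \<le> dist z w \<and> dist z w < r}}
    \<subseteq> {snd z + h'..snd z + h} \<union> {snd z - h..snd z - h'}"
  proof
    fix y assume "y \<in> {y \<in> {0..1}. (x, y) \<in> {w \<in> unit_square. r' \<le> dist z w \<and> dist z w < r}}"
    then have "r' \<le> sqrt (a + (snd z - y)\<^sup>2)" "sqrt (a + (snd z - y)\<^sup>2) < r"
      by (auto simp: dist_prod_def dist_real_def a_def)
    then have "r'\<^sup>2 \<le> (sqrt (a + (snd z - y)\<^sup>2))\<^sup>2" "(sqrt (a + (snd z - y)\<^sup>2))\<^sup>2 < r\<^sup>2"
      using assms by (auto intro!: power_mono power_strict_mono simp: a_def simp del: real_sqrt_pow2_iff real_sqrt_pow2)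
    then have le: "r'\<^sup>2 - a \<le> (snd z - y)\<^sup>2" "(snd z - y)\<^sup>2 \<le> r\<^sup>2 - a"
      by (auto simp: a_def)
    have "h' \<le> sqrt ((snd z - y)\<^sup>2)" "sqrt ((snd z - y)\<^sup>2) \<le> h"
      unfolding h_def h'_def using le by (intro real_sqrt_le_mono; simp)+
    then have "h' \<le> \<bar>snd z - y\<bar>" "\<bar>snd z - y\<bar> \<le> h" by simp_all
    then show "y \<in> {snd z + h'..snd z + h} \<union> {snd z - h..snd z - h'}" by auto
  qed
  then have "emeasure lborel {y \<in> {0..1}. (x, y) \<in> {w \<in> unit_square. r' \<le> dist z w \<and> dist z w < r}}
    \<le> emeasure lborel ({snd z + h'..snd z + h} \<union> {snd z - h..snd z - h'})"
    by (intro emeasure_mono) auto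
  also have "\<dots> \<le> emeasure lborel {snd z + h'..snd z + h} + emeasure lborel {snd z - h..snd z - h'}"
    by (intro emeasure_subadditive) auto
  also have "\<dots> = ennreal (2 * (h - h'))"
    using h by (simp flip: ennreal_plus)
  also have "\<dots> \<le> ennreal (2 * sqrt (r\<^sup>2 - r'\<^sup>2))" using diff by (intro ennreal_leI) simp
  finally show "emeasure lborel {y \<in> {0..1}. (x, y) \<in> {w \<in> unit_square. r' \<le> dist z w \<and> dist z w < r}}
    \<le> ennreal (2 * sqrt (r\<^sup>2 - r'\<^sup>2))" .
qed

lemma euclid_ball_annulus:
  assumes r: "0 < r" "r \<le> 1/2"
  shows "\<exists>G\<in>sets \<mu>. measure \<mu> G \<le> 4 * (sqrt (1/2)) ^ m \<and>
      (\<forall>b b'. b \<in> euclid_ball z r \<and> b' \<in> unit_square \<and> b' \<notin> euclid_ball z r \<and> \<bar>fst b - fst b'\<bar> \<le> \<gamma> ^ m \<and>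
        \<bar>snd b - snd b'\<bar> \<le> (1/2) ^ m \<longrightarrow> b \<in> G)"
proof -
  \<comment> \<open>As \<gamma> < 1/2, the two coordinates of \<open>b\<close> and \<open>b'\<close>
    differ by at most \<open>(1/2) ^ m\<close> each, so \<open>d\<close> bounds their distance. The
    square root in the annulus bound turns the rate 1/2 into \<open>sqrt (1/2)\<close>.\<close>
  define d :: real where "d = 2 * (1/2) ^ m"
  define r' where "r' = max 0 (r - d)"
  define G where "G = {w \<in> unit_square. r' \<le> dist z w \<and> dist z w < r}"
  have d: "0 < d" by (simp add: d_def)
  have r': "0 \<le> r'" "r' \<le> r" using d r by (auto simp: r'_def)
  have "r\<^sup>2 - r'\<^sup>2 \<le> 2 * d"
  proof -
    have "r\<^sup>2 - r'\<^sup>2 = (r - r') * (r + r')" by (simp add: power2_eq_square algebra_simps)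
    also have "\<dots> \<le> d * 2" using d r r' by (intro mult_mono) (auto simp: r'_def)
    finally show ?thesis by simp
  qed
  then have "2 * sqrt (r\<^sup>2 - r'\<^sup>2) \<le> 2 * sqrt (2 * d)" by simp
  also have "2 * d = 2\<^sup>2 * (1/2) ^ m" by (simp add: d_def)
  also have "2 * sqrt (2\<^sup>2 * (1/2) ^ m) = 4 * (sqrt (1/2)) ^ m"
    by (simp only: real_sqrt_mult real_sqrt_power) simp
  finally have "measure \<mu> G \<le> 4 * (sqrt (1/2)) ^ m"
    unfolding G_def using euclid_annulus_measure[OF r', of z] by linarith
  moreover have "b \<in> G" if b: "b \<in> euclid_ball z r" "b' \<in> unit_square" "b' \<notin> euclid_ball z r" "\<bar>fst b - fst b'\<bar> \<le> \<gamma> ^ m"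
        "\<bar>snd b - snd b'\<bar> \<le> (1/2) ^ m" for b b'
  proof -
    have "\<gamma> ^ m \<le> (1/2) ^ m" using \<gamma>_pos \<gamma>_less by (intro power_mono) auto
    moreover have "dist b b' \<le> \<bar>fst b - fst b'\<bar> + \<bar>snd b - snd b'\<bar>"
      unfolding dist_prod_def dist_real_def using sqrt_sum_squares_le_sum_abs by simp
    ultimately have "dist b b' \<le> d" using b(4,5) unfolding d_def by linarith
    moreover have "r \<le> dist z b'" using b by (auto simp: euclid_ball_def)
    ultimately have "r - d \<le> dist z b" using dist_triangle[of z b' b] by linarith
    then show ?thesis using b(1) by (auto simp: G_def r'_def euclid_ball_def)
  qed
  moreover have "G \<in> sets \<mu>" unfolding G_def by (intro borel_sets_\<mu>) measurable
  ultimately show ?thesis by blast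
qed

end

section \<open>Counting periodic returns, and the Polya-Aeppli law\<close>

lemma leb_diff:
  assumes [measurable]: "Measurable.pred borel P" "Measurable.pred borel Q" and "\<And>y. Q y \<Longrightarrow> P y"
  shows "leb (\<lambda>y. P y \<and> \<not> Q y) = leb P - leb Q"
proof -
  have "leb (\<lambda>y. P y \<and> \<not> Q y) = measure lborel ({y \<in> {0..<1}. P y} - {y \<in> {0..<1}. Q y})"
    unfolding leb_def by (intro arg_cong[where f = "measure lborel"]) auto
  also have "\<dots> = leb P - leb Q"
    unfolding leb_def
  proof (rule measure_Diff)
    have "{y \<in> {0..<1}. P y} \<in> fmeasurable lborel" by (rule fmeasurable_unit_interval) measurable
    then show "emeasure lborel {y \<in> {0..<1}. P y} \<noteq> \<infinity>" by (auto simp: fmeasurable_def)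
  qed (use assms(3) in auto)
  finally show ?thesis .
qed

text \<open>As \<open>2 ^ i * d\<close> grows with \<open>i\<close>, the returns of a point at
  vertical distance \<open>d\<close> form an initial run of multiples of \<open>p\<close>. The bound
  on \<open>P\<close> leaves room for the first failure, at \<open>(k + 1) * p\<close>.\<close>

lemma card_periodic_visits:
  fixes d r :: real
  assumes p: "p > 0" and d: "0 \<le> d" "d < r" and P: "(k + 1) * p \<le> P"
  shows "card {i \<in> {1..P}. p dvd i \<and> 2 ^ i * d < r} = k \<longleftrightarrow> 2 ^ (k * p) * d < r \<and> \<not> 2 ^ ((k + 1) * p) * d < r"
proof -
  let ?S = "{i \<in> {1..P}. p dvd i \<and> 2 ^ i * d < r}"
  have inj: "inj_on (\<lambda>j. j * p) A" for A using p by (auto simp: inj_on_def)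
  have mono: "2 ^ i * d < r" if "2 ^ j * d < r" "i \<le> j" for i j :: nat
  proof -
    have "2 ^ i * d \<le> 2 ^ j * d" using that d by (intro mult_right_mono power_increasing) auto
    then show ?thesis using that by linarith
  qed
  have above: "?S \<subseteq> (\<lambda>j. j * p) ` {1..<n}" if "\<not> 2 ^ (n * p) * d < r" for n
  proof
    fix i assume i: "i \<in> ?S"
    then obtain j where j: "i = j * p" by (auto simp: dvd_def mult.commute)
    have "j < n"
    proof (rule ccontr)
      assume "\<not> j < n"
      then have "n * p \<le> i" using j by simp
      then show False using mono[of i "n * p"] i that by auto
    qed
    then show "i \<in> (\<lambda>j. j * p) ` {1..<n}" using i j by (auto intro!: image_eqI[of _ _ j] simp: Suc_le_eq gr0I)
  qed
  have below: "(\<lambda>j. j * p) ` {1..<Suc n} \<subseteq> ?S" if "2 ^ (n * p) * d < r" "n \<le> k + 1" for n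
  proof (rule image_subsetI)
    fix j assume j: "j \<in> {1..<Suc n}"
    then have "j * p \<le> n * p" by (intro mult_le_mono1) simp
    also have "n * p \<le> P" using that P mult_le_mono1[of n "k + 1" p] by linarith
    finally have "j * p \<le> P" .
    moreover have "1 \<le> j * p" using j p by (simp add: Suc_le_eq)
    ultimately show "j * p \<in> ?S" using mono[OF that(1), of "j * p"] \<open>j * p \<le> n * p\<close> by auto
  qed
  show ?thesis
  proof
    assume S: "2 ^ (k * p) * d < r \<and> \<not> 2 ^ ((k + 1) * p) * d < r"
    then have "?S = (\<lambda>j. j * p) ` {1..<Suc k}"
      using above[of "k + 1"] below[of k] by (intro equalityI) auto
    then show "card ?S = k" using card_image[OF inj[of "{1..<Suc k}"]] by simp
  next
    assume c: "card ?S = k"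
    have "\<not> 2 ^ ((k + 1) * p) * d < r"
    proof
      assume "2 ^ ((k + 1) * p) * d < r"
      from card_mono[OF _ below[OF this]] have "k + 1 \<le> card ?S"
        using card_image[OF inj[of "{1..<Suc (k + 1)}"]] by simp
      then show False using c by simp
    qed
    moreover have "2 ^ (k * p) * d < r"
    proof (rule ccontr)
      assume n: "\<not> 2 ^ (k * p) * d < r"
      then have "k > 0" using d by (cases k) auto
      moreover have "card ?S \<le> k - 1"
        using card_mono[OF _ above[OF n]] card_image[OF inj[of "{1..<k}"]] by simp
      ultimately show False using c by simp
    qed
    ultimately show "2 ^ (k * p) * d < r \<and> \<not> 2 ^ ((k + 1) * p) * d < r" by blast
  qed
qed

text \<open>Without clustering only the summand \<open>j = k\<close> survives, because
  \<open>0 ^ 0 = 1\<close>.\<close>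

lemma polya_aeppli_mass_1: "polya_aeppli_mass 1 \<tau> k = exp (- \<tau>) * \<tau> ^ k / fact k"
proof (cases "k = 0")
  case False
  have "(\<Sum>j = 1..k. (1 - 1) ^ (k - j) * 1 ^ (2 * j) * (\<tau> ^ j / fact j) * real ((k - 1) choose (j - 1)))
    = (\<Sum>j\<in>{k}. \<tau> ^ j / fact j * real ((k - 1) choose (j - 1)))"
    using False by (intro sum.mono_neutral_cong_right) auto
  then show ?thesis using False by (simp add: polya_aeppli_mass_def)
qed (simp add: polya_aeppli_mass_def)

lemma polya_aeppli_mass_nonneg: "0 \<le> \<Theta> \<Longrightarrow> \<Theta> \<le> 1 \<Longrightarrow> 0 \<le> \<tau> \<Longrightarrow> 0 \<le> polya_aeppli_mass \<Theta> \<tau> k"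
  unfolding polya_aeppli_mass_def by (auto intro!: sum_nonneg mult_nonneg_nonneg)

lemma cdf_polya_aeppli_law:
  assumes "0 \<le> \<Theta>" "\<Theta> \<le> 1" "0 \<le> \<tau>"
  shows "cdf (polya_aeppli_law \<Theta> \<tau>) x = (\<Sum>k | real k \<le> x. polya_aeppli_mass \<Theta> \<tau> k)"
proof -
  let ?A = "{k :: nat. real k \<le> x}"
  have fin: "finite ?A"
    by (rule finite_subset[of _ "{..nat \<lfloor>x\<rfloor>}"]) (auto simp: le_nat_floor)
  have "emeasure (polya_aeppli_law \<Theta> \<tau>) {..x}
    = emeasure (density (count_space UNIV) (\<lambda>k. ennreal (polya_aeppli_mass \<Theta> \<tau> k))) (real -` {..x} \<inter> UNIV)"
    unfolding polya_aeppli_law_def by (subst emeasure_distr) (auto simp: measurable_density_eq1)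
  also have "\<dots> = (\<integral>\<^sup>+ k. ennreal (polya_aeppli_mass \<Theta> \<tau> k) * indicator ?A k \<partial>count_space UNIV)"
    by (subst emeasure_density) (auto simp: vimage_def)
  also have "\<dots> = (\<Sum>k\<in>?A. ennreal (polya_aeppli_mass \<Theta> \<tau> k) * indicator ?A k)"
    by (rule nn_integral_count_space') (auto simp: fin)
  also have "\<dots> = (\<Sum>k\<in>?A. ennreal (polya_aeppli_mass \<Theta> \<tau> k))"
    by (intro sum.cong) auto
  also have "\<dots> = ennreal (\<Sum>k\<in>?A. polya_aeppli_mass \<Theta> \<tau> k)"
    using polya_aeppli_mass_nonneg[OF assms] by (intro sum_ennreal) auto
  finally show ?thesis
    using polya_aeppli_mass_nonneg[OF assms] by (simp add: cdf_def measure_def sum_nonneg)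
qed

text \<open>For variables with values in the natural numbers, the distribution function at
  \<open>x\<close> is a sum of finitely many masses, so convergence of the masses gives convergence
  at every \<open>x\<close>.\<close>

lemma (in prob_space) weak_conv_polya_aeppli:
  assumes [measurable]: "\<And>n k. {w \<in> space M. X n w = k} \<in> sets M"
    and lim: "\<And>k. (\<lambda>n. prob {w \<in> space M. X n w = k}) \<longlonglongrightarrow> polya_aeppli_mass \<Theta> \<tau> k"
    and "0 \<le> \<Theta>" "\<Theta> \<le> 1" "0 \<le> \<tau>"
  shows "weak_conv_m (\<lambda>n. distr M borel (\<lambda>w. real (X n w))) (polya_aeppli_law \<Theta> \<tau>)"
  unfolding weak_conv_m_def weak_conv_def
proof (intro allI impI)
  fix x
  let ?A = "{k :: nat. real k \<le> x}"
  have fin: "finite ?A"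
    by (rule finite_subset[of _ "{..nat \<lfloor>x\<rfloor>}"]) (auto simp: le_nat_floor)
  have "cdf (distr M borel (\<lambda>w. real (X n w))) x = (\<Sum>k\<in>?A. prob {w \<in> space M. X n w = k})" for n
  proof -
    have X: "X n \<in> measurable M (count_space UNIV)"
      by (rule measurable_count_space_eq2_countable[THEN iffD2])
        (auto simp: vimage_def Int_def conj_commute)
    have m: "(\<lambda>w. real (X n w)) \<in> borel_measurable M"
      using measurable_compose[OF X, of real borel] by simp
    have "cdf (distr M borel (\<lambda>w. real (X n w))) x = prob {w \<in> space M. real (X n w) \<le> x}"
      unfolding cdf_def by (subst measure_distr[OF m]) (auto intro!: arg_cong[where f = prob])
    also have "{w \<in> space M. real (X n w) \<le> x} = (\<Union>k\<in>?A. {w \<in> space M. X n w = k})" by auto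
    also have "prob \<dots> = (\<Sum>k\<in>?A. prob {w \<in> space M. X n w = k})"
      using fin by (intro finite_measure_finite_Union) (auto simp: disjoint_family_on_def)
    finally show ?thesis .
  qed
  then show "(\<lambda>n. cdf (distr M borel (\<lambda>w. real (X n w))) x) \<longlonglongrightarrow> cdf (polya_aeppli_law \<Theta> \<tau>) x"
    using assms by (simp add: cdf_polya_aeppli_law tendsto_sum)
qed

section \<open>From the local dimension to the two limit laws\<close>

context baker_srb
begin

text \<open>Since \<gamma> < 1/2, the second summand of the dimension is below 1; the exponent 3 is
  a convenient integer above the dimension. The lower bound serves to exclude null balls, for which
  \<open>ln 0 = 0\<close> makes the quotient 0.\<close>

lemma SRB_dim_bounds: "1 < SRB_dim \<gamma>" "SRB_dim \<gamma> < 3"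
proof -
  have "ln 2 < ln (inverse \<gamma>)"
    using \<gamma>_pos \<gamma>_less by (subst ln_less_cancel_iff) (auto simp: field_simps)
  moreover have "0 < ln (2::real)" by simp
  ultimately have ln: "0 < ln (inverse \<gamma>)" "ln 2 < ln (inverse \<gamma>)" "0 < ln (2::real)" by linarith+
  have "0 < ln 2 / ln (inverse \<gamma>)" using ln(3,1) by (rule divide_pos_pos)
  moreover have "ln 2 / ln (inverse \<gamma>) < 1" using ln by (simp only: divide_less_eq_1_pos)
  ultimately show "1 < SRB_dim \<gamma>" "SRB_dim \<gamma> < 3" unfolding SRB_dim_def by linarith+
qed

text \<open>Near 0 the quotient of logarithms lies strictly between 1 and 3. As \<open>ln r\<close>
  is negative there, the upper bound on the quotient is a lower bound on the measure; monotonicity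
  then carries positivity to all radii.\<close>

lemma local_dim_consequences:
  fixes Ball :: "real \<Rightarrow> (real \<times> real) set"
  assumes Ball: "\<And>r. Ball r \<in> sets \<mu>" and sub: "\<And>r. Ball r \<subseteq> max_ball z r"
    and mono: "mono Ball"
    and dim: "has_local_dim \<mu> Ball (SRB_dim \<gamma>)"
  shows "eventually (\<lambda>r. r ^ 3 \<le> measure \<mu> (Ball r)) (at_right 0)"
    and "\<And>r. 0 < r \<Longrightarrow> 0 < measure \<mu> (Ball r)"
    and "in_support (fst z)"
proof -
  have lim: "((\<lambda>r. ln (measure \<mu> (Ball r)) / ln r) \<longlongrightarrow> SRB_dim \<gamma>) (at_right 0)"
    using dim by (simp add: has_local_dim_def)
  have "eventually (\<lambda>r. r < (1::real)) (at_right 0)" "eventually (\<lambda>r. r > (0::real)) (at_right 0)"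
    by (auto simp: eventually_at_right_less eventually_at_right_field intro: exI[of _ 1])
  then have ev: "eventually (\<lambda>r. r ^ 3 \<le> measure \<mu> (Ball r) \<and> 0 < measure \<mu> (Ball r)) (at_right 0)"
    using order_tendstoD(1)[OF lim SRB_dim_bounds(1)] order_tendstoD(2)[OF lim SRB_dim_bounds(2)]
  proof eventually_elim
    case (elim r)
    have "measure \<mu> (Ball r) \<noteq> 0"
    proof
      assume "measure \<mu> (Ball r) = 0"
      then show False using elim by simp
    qed
    then have pos: "0 < measure \<mu> (Ball r)" using measure_nonneg[of \<mu> "Ball r"] by linarith
    have "ln r < 0" using elim by simp
    then have "3 * ln r < ln (measure \<mu> (Ball r))" using elim by (simp add: neg_divide_less_eq)
    then have "ln (r ^ 3) < ln (measure \<mu> (Ball r))" using elim by (simp add: ln_realpow)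
    then show ?case using pos elim by (auto simp: ln_less_cancel_iff)
  qed
  then show "eventually (\<lambda>r. r ^ 3 \<le> measure \<mu> (Ball r)) (at_right 0)"
    by (rule eventually_mono) simp
  show pos: "0 < measure \<mu> (Ball r)" if r: "0 < r" for r
  proof -
    obtain b where b: "b > 0" "\<And>t. 0 < t \<Longrightarrow> t < b \<Longrightarrow> 0 < measure \<mu> (Ball t)"
      using ev unfolding eventually_at_right_field by auto
    define t where "t = min r (b / 2)"
    have "0 < t" "t < b" "t \<le> r" using b r by (auto simp: t_def)
    then show ?thesis using b(2)[of t] finite_measure_mono[OF monoD[OF mono] Ball, of t r] by linarith
  qed
  show "in_support (fst z)"
    unfolding in_support_def
  proof (intro allI impI)
    fix \<epsilon> :: real assume "\<epsilon> > 0"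
    then have "0 < measure \<mu> (max_ball z \<epsilon>)"
      using pos[of \<epsilon>] finite_measure_mono[OF sub max_ball_sets, of \<epsilon>] by linarith
    then show "0 < measure nu {t. \<bar>t - fst z\<bar> < \<epsilon>}"
      unfolding measure_max_ball using measure_nonneg[of nu "{t. \<bar>t - fst z\<bar> < \<epsilon>}"]
      by (cases "measure nu {t. \<bar>t - fst z\<bar> < \<epsilon>} = 0") (auto simp: zero_less_measure_iff)
  qed
qed

text \<open>The scaling forces the measures of the balls to 0, whereas radii of at least
  \<open>a\<close> would keep them above the positive measure of \<open>Ball a\<close>.\<close>

lemma radius_tendsto_0:
  fixes Ball :: "real \<Rightarrow> (real \<times> real) set"
  assumes Ball: "\<And>r. Ball r \<in> sets \<mu>" and mono: "mono Ball"
    and pos: "\<And>r. 0 < r \<Longrightarrow> 0 < measure \<mu> (Ball r)"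
    and r: "\<And>n. 0 < r n" and lim: "(\<lambda>n. real n * measure \<mu> (Ball (r n))) \<longlonglongrightarrow> \<tau>"
  shows "r \<longlonglongrightarrow> 0"
proof -
  have "(\<lambda>n. real n * measure \<mu> (Ball (r n)) / real n) \<longlonglongrightarrow> 0"
    by (rule real_tendsto_divide_at_top[OF lim filterlim_real_sequentially])
  moreover have "eventually (\<lambda>n. real n * measure \<mu> (Ball (r n)) / real n = measure \<mu> (Ball (r n))) sequentially"
    using eventually_gt_at_top[of 0] by eventually_elim simp
  ultimately have b0: "(\<lambda>n. measure \<mu> (Ball (r n))) \<longlonglongrightarrow> 0"
    by (rule Lim_transform_eventually)
  show ?thesis
  proof (rule order_tendstoI)
    fix a :: real assume "a < 0"
    then show "eventually (\<lambda>n. a < r n) sequentially" using r by (auto intro!: always_eventually intro: less_trans)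
  next
    fix a :: real assume a: "0 < a"
    have "eventually (\<lambda>n. measure \<mu> (Ball (r n)) < measure \<mu> (Ball a)) sequentially"
      using order_tendstoD(2)[OF b0 pos[OF a]] .
    then show "eventually (\<lambda>n. r n < a) sequentially"
    proof eventually_elim
      case (elim n)
      then show ?case using finite_measure_mono[OF monoD[OF mono] Ball, of a "r n"] by (cases "r n < a") auto
    qed
  qed
qed

text \<open>The right-hand side is the geometric law \<open>\<Theta> * (1 - \<Theta>) ^ k\<close> at
  \<Theta> = 1, that is, no return at all.\<close>

lemma nonperiodic_returns:
  fixes Ball :: "real \<Rightarrow> (real \<times> real) set"
  assumes z: "z \<in> unit_square" and np: "\<not> periodic_point T z" and sub: "\<And>r. Ball r \<subseteq> max_ball z r"
  shows "eventually (\<lambda>r. measure \<mu> {w \<in> Ball r. visits T (Ball r) {1..P} w = k}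
      = 1 * (1 - 1) ^ k * measure \<mu> (Ball r)) (at_right 0)"
proof -
  have "eventually (\<lambda>r. \<forall>i\<in>{1..P}. \<forall>w\<in>max_ball z r. (T ^^ i) w \<notin> max_ball z r) (at_right 0)"
  proof (intro eventually_ball_finite ballI no_early_return z)
    fix i assume "i \<in> {1..P}"
    then show "(T ^^ i) z \<noteq> z" using np by (auto simp: periodic_point_def dest: spec[of _ i])
  qed simp
  then show ?thesis
  proof eventually_elim
    case (elim r)
    have "visits T (Ball r) {1..P} w = 0" if "w \<in> Ball r" for w
      unfolding visits_def using elim sub[of r] that by (intro sum.neutral) (auto simp: indicator_def)
    then have "{w \<in> Ball r. visits T (Ball r) {1..P} w = k} = (if k = 0 then Ball r else {})" by auto
    then show ?case by simp
  qed
qed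

text \<open>At multiples of \<open>p\<close> the iterate is affine near \<open>z\<close>, and its
  horizontal contraction cannot push a point out of the horizontal range of the ball. In the maximum
  metric the vertical condition alone is therefore decisive.\<close>

lemma periodic_returns_max_ball:
  assumes z: "z \<in> unit_square" and p: "minimal_period T z p"
  shows "eventually (\<lambda>r. \<forall>w\<in>max_ball z r. (T ^^ i) w \<in> max_ball z r \<longleftrightarrow> p dvd i \<and> 2 ^ i * \<bar>snd w - snd z\<bar> < r) (at_right 0)"
proof (cases "p dvd i")
  case False
  have pz: "(T ^^ p) z = z" "p > 0" using p by (auto simp: minimal_period_def)
  have "(T ^^ i) z = (T ^^ (i mod p)) z" using pz by (simp add: funpow_mod_eq)
  moreover have "0 < i mod p" "i mod p < p" using False pz by (auto simp: mod_greater_zero_iff_not_dvd)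
  ultimately have "(T ^^ i) z \<noteq> z" using p by (auto simp: minimal_period_def)
  from no_early_return[OF z this] show ?thesis
    by (rule eventually_mono) (use False in auto)
next
  case True
  have pz: "(T ^^ p) z = z" "p > 0" using p by (auto simp: minimal_period_def)
  have iz: "(T ^^ i) z = z" using funpow_mod_eq[OF pz(1), of i] True by simp
  obtain \<delta> where \<delta>: "\<delta> > 0" "\<And>w. max_dist w z < \<delta> \<Longrightarrow> fst ((T ^^ i) w) - fst z = \<gamma> ^ i * (fst w - fst z)
    \<and> snd ((T ^^ i) w) - snd z = 2 ^ i * (snd w - snd z)"
    using funpow_locally_affine[of i z] periodic_orbit_avoids_discontinuity[OF pz] unfolding iz by blast
  show ?thesis
    unfolding eventually_at_right_field
  proof (intro exI[of _ \<delta>] conjI allI impI ballI)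
    fix r w assume r: "0 < r" "r < \<delta>" and w: "w \<in> max_ball z r"
    have a: "fst ((T ^^ i) w) - fst z = \<gamma> ^ i * (fst w - fst z)" "snd ((T ^^ i) w) - snd z = 2 ^ i * (snd w - snd z)"
      using \<delta>(2)[of w] r w by (auto simp: mem_max_ball)
    have "\<gamma> ^ i * \<bar>fst w - fst z\<bar> \<le> 1 * \<bar>fst w - fst z\<bar>"
      using \<gamma>_pos \<gamma>_less by (intro mult_right_mono power_le_one) auto
    also have "\<dots> < r" using w by (simp add: mem_max_ball max_dist_less_iff)
    finally have "\<gamma> ^ i * \<bar>fst w - fst z\<bar> < r" .
    then show "(T ^^ i) w \<in> max_ball z r \<longleftrightarrow> p dvd i \<and> 2 ^ i * \<bar>snd w - snd z\<bar> < r"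
      using True w T_funpow_unit_square[of w i] \<gamma>_pos
      unfolding mem_max_ball max_dist_less_iff a by (simp add: abs_mult)
  qed (rule \<delta>)
qed

text \<open>Exactly \<open>k\<close> returns occur when the vertical distance to \<open>z\<close> is
  at least \<open>r / 2 ^ ((k + 1) * p)\<close> and below \<open>r / 2 ^ (k * p)\<close>. As the
  length of small intervals around \<open>snd z\<close> is linear in the radius, the proportions of
  these layers are geometric.\<close>

lemma periodic_returns:
  assumes z: "z \<in> unit_square" and p: "minimal_period T z p" and P: "(k + 1) * p \<le> P"
  shows "eventually (\<lambda>r. measure \<mu> {w \<in> max_ball z r. visits T (max_ball z r) {1..P} w = k}
      = (1 - 1 / 2 ^ p) * (1 - (1 - 1 / 2 ^ p)) ^ k * measure \<mu> (max_ball z r)) (at_right 0)"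
proof -
  have p0: "p > 0" using p by (simp add: minimal_period_def)
  have zr: "0 \<le> snd z" "snd z \<le> 1" using z by (auto simp: mem_unit_square)
  obtain c \<rho> where c: "0 < c" "0 < \<rho>" "\<And>r. 0 \<le> r \<Longrightarrow> r \<le> \<rho> \<Longrightarrow> leb (\<lambda>y. \<bar>y - snd z\<bar> < r) = c * r"
    using leb_small_ball[OF zr] by blast
  have "eventually (\<lambda>r. \<forall>i\<in>{1..P}. \<forall>w\<in>max_ball z r. (T ^^ i) w \<in> max_ball z r
      \<longleftrightarrow> p dvd i \<and> 2 ^ i * \<bar>snd w - snd z\<bar> < r) (at_right 0)"
    by (intro eventually_ball_finite ballI periodic_returns_max_ball z p) auto
  moreover have "eventually (\<lambda>r. 0 < r \<and> r < \<rho>) (at_right 0)"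
    using c by (auto simp: eventually_at_right_field)
  ultimately show ?thesis
  proof eventually_elim
    case (elim r)
    let ?a = "r / 2 ^ (k * p)" and ?b = "r / 2 ^ ((k + 1) * p)"
    have le: "?b \<le> ?a" "?a \<le> r" "0 \<le> ?b" "0 \<le> ?a"
    proof -
      have "(2::real) ^ (k * p) \<le> 2 ^ ((k + 1) * p)" by (intro power_increasing) auto
      then show "?b \<le> ?a" using elim by (intro divide_left_mono) auto
      have "r / 2 ^ (k * p) \<le> r / 1" using elim by (intro divide_left_mono) auto
      then show "?a \<le> r" by simp
    qed (use elim in auto)
    have "visits T (max_ball z r) {1..P} w = k \<longleftrightarrow> \<bar>snd w - snd z\<bar> < ?a \<and> \<not> \<bar>snd w - snd z\<bar> < ?b"
      if w: "w \<in> max_ball z r" for w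
    proof -
      have "visits T (max_ball z r) {1..P} w = card {i \<in> {1..P}. p dvd i \<and> 2 ^ i * \<bar>snd w - snd z\<bar> < r}"
        using elim w by (subst visits_eq_card) (auto intro!: arg_cong[where f = card])
      moreover have "\<bar>snd w - snd z\<bar> < r" using w by (simp add: mem_max_ball max_dist_less_iff)
      ultimately have "visits T (max_ball z r) {1..P} w = k \<longleftrightarrow>
          2 ^ (k * p) * \<bar>snd w - snd z\<bar> < r \<and> \<not> 2 ^ ((k + 1) * p) * \<bar>snd w - snd z\<bar> < r"
        using card_periodic_visits[OF p0 _ _ P] by simp
      then show ?thesis by (simp add: pos_less_divide_eq mult.commute)
    qed
    then have "{w \<in> max_ball z r. visits T (max_ball z r) {1..P} w = k}
      = {w \<in> unit_square. \<bar>fst w - fst z\<bar> < r \<and> (\<bar>snd w - snd z\<bar> < ?a \<and> \<not> \<bar>snd w - snd z\<bar> < ?b)}"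
      using le by (auto simp: mem_max_ball max_dist_less_iff simp del: split_paired_All)
    then have "measure \<mu> {w \<in> max_ball z r. visits T (max_ball z r) {1..P} w = k}
      = measure nu {t. \<bar>t - fst z\<bar> < r} * leb (\<lambda>y. \<bar>y - snd z\<bar> < ?a \<and> \<not> \<bar>y - snd z\<bar> < ?b)"
      using measure_\<mu>_product[of "\<lambda>t. \<bar>t - fst z\<bar> < r" "\<lambda>y. \<bar>y - snd z\<bar> < ?a \<and> \<not> \<bar>y - snd z\<bar> < ?b"] by simp
    also have "leb (\<lambda>y. \<bar>y - snd z\<bar> < ?a \<and> \<not> \<bar>y - snd z\<bar> < ?b) = c * ?a - c * ?b"
    proof -
      have "leb (\<lambda>y. \<bar>y - snd z\<bar> < ?a \<and> \<not> \<bar>y - snd z\<bar> < ?b)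
          = leb (\<lambda>y. \<bar>y - snd z\<bar> < ?a) - leb (\<lambda>y. \<bar>y - snd z\<bar> < ?b)"
        using le by (intro leb_diff) auto
      then show ?thesis using c(3)[of ?a] c(3)[of ?b] le elim by simp
    qed
    also have "c * ?a - c * ?b = (1 - 1 / 2 ^ p) * (1 - (1 - 1 / 2 ^ p)) ^ k * (c * r)"
    proof -
      have "c * (r / X) - c * (r / (X * Y)) = (1 - 1 / Y) * (1 / X) * (c * r)" if "X > 0" "Y > 0" for X Y :: real
        using that by (simp add: field_simps)
      moreover have "(1 - (1 - 1 / 2 ^ p)) ^ k = (1 / 2 ^ (k * p) :: real)"
        by (simp add: power_one_over mult.commute flip: power_mult)
      moreover have "(2::real) ^ ((k + 1) * p) = 2 ^ (k * p) * 2 ^ p"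
        by (simp add: power_add)
      ultimately show ?thesis by simp
    qed
    also have "c * r = leb (\<lambda>y. \<bar>y - snd z\<bar> < r)" using c(3)[of r] elim by simp
    finally show ?case by (simp add: measure_max_ball)
  qed
qed

text \<open>The points that return at time \<open>p\<close> form a rectangle of the same width with
  the vertical radius divided by \<open>2 ^ p\<close>. This identifies \<Theta>.\<close>

lemma periodic_return_ratio:
  assumes z: "z \<in> unit_square" and p: "minimal_period T z p"
    and pos: "\<And>r. 0 < r \<Longrightarrow> 0 < measure \<mu> (max_ball z r)"
  shows "eventually (\<lambda>r. measure \<mu> ((T ^^ p) -` max_ball z r \<inter> max_ball z r) / measure \<mu> (max_ball z r) = 1 / 2 ^ p)
    (at_right 0)"
proof -
  have zr: "0 \<le> snd z" "snd z \<le> 1" using z by (auto simp: mem_unit_square)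
  obtain c \<rho> where c: "0 < c" "0 < \<rho>" "\<And>r. 0 \<le> r \<Longrightarrow> r \<le> \<rho> \<Longrightarrow> leb (\<lambda>y. \<bar>y - snd z\<bar> < r) = c * r"
    using leb_small_ball[OF zr] by blast
  have "eventually (\<lambda>r. 0 < r \<and> r < \<rho>) (at_right 0)"
    using c by (auto simp: eventually_at_right_field)
  then show ?thesis using periodic_returns_max_ball[OF z p, of p]
  proof eventually_elim
    case (elim r)
    have "r / 2 ^ p \<le> r / 1" using elim by (intro divide_left_mono) auto
    then have le: "r / 2 ^ p \<le> r" "0 \<le> r / 2 ^ p" using elim by auto
    have "(T ^^ p) -` max_ball z r \<inter> max_ball z r = {w \<in> unit_square. \<bar>fst w - fst z\<bar> < r \<and> \<bar>snd w - snd z\<bar> < r / 2 ^ p}"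
    proof (rule set_eqI)
      fix w :: "real \<times> real"
      have "2 ^ p * \<bar>snd w - snd z\<bar> < r \<longleftrightarrow> \<bar>snd w - snd z\<bar> < r / 2 ^ p"
        by (simp add: pos_less_divide_eq mult.commute)
      then show "w \<in> (T ^^ p) -` max_ball z r \<inter> max_ball z r
        \<longleftrightarrow> w \<in> {w \<in> unit_square. \<bar>fst w - fst z\<bar> < r \<and> \<bar>snd w - snd z\<bar> < r / 2 ^ p}"
        using elim(2) le by (auto simp: mem_max_ball max_dist_less_iff simp del: split_paired_All)
    qed
    then have "measure \<mu> ((T ^^ p) -` max_ball z r \<inter> max_ball z r) = measure nu {t. \<bar>t - fst z\<bar> < r} * (c * (r / 2 ^ p))"
      using measure_\<mu>_product[of "\<lambda>t. \<bar>t - fst z\<bar> < r" "\<lambda>y. \<bar>y - snd z\<bar> < r / 2 ^ p"] c(3)[of "r / 2 ^ p"] le elim by simp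
    moreover have "measure \<mu> (max_ball z r) = measure nu {t. \<bar>t - fst z\<bar> < r} * (c * r)"
      using c(3)[of r] elim by (simp add: measure_max_ball)
    moreover have "measure \<mu> (max_ball z r) \<noteq> 0" using pos[of r] elim by simp
    ultimately show ?case by simp
  qed
qed

lemma mono_max_ball: "mono (max_ball z)"
  by (rule monoI) (auto simp: max_ball_def)

lemma mono_euclid_ball: "mono (euclid_ball z)"
  by (rule monoI) (auto simp: euclid_ball_def)

lemma max_ball_lower:
  assumes "z \<in> unit_square" "0 < r" "r \<le> 1/2"
  shows "measure nu {t. \<bar>t - fst z\<bar> < r} * r \<le> measure \<mu> (max_ball z r)"
  unfolding measure_max_ball using assms leb_ball_ge[of "snd z" r]
  by (intro mult_left_mono) (auto simp: mem_unit_square)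

text \<open>The ball contains the maximum ball of half the radius: one factor \<open>C\<close> pays
  for halving the width and one factor 2 for halving the height.\<close>

lemma euclid_ball_lower:
  assumes z: "z \<in> unit_square" and supp: "in_support (fst z)"
  obtains C where "\<And>r. 0 < r \<Longrightarrow> r \<le> 1/2 \<Longrightarrow> measure nu {t. \<bar>t - fst z\<bar> < r} * r \<le> C * measure \<mu> (euclid_ball z r)"
proof -
  obtain C where C: "C > 0" "\<And>x r. in_support x \<Longrightarrow> 0 < r \<Longrightarrow> r \<le> 1 \<Longrightarrow>
      measure nu {t. \<bar>t - x\<bar> < r} \<le> C * measure nu {t. \<bar>t - x\<bar> < r / 2}"
    by (rule nu_doubling) blast
  have "measure nu {t. \<bar>t - fst z\<bar> < r} * r \<le> (2 * C) * measure \<mu> (euclid_ball z r)"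
    if r: "0 < r" "r \<le> 1/2" for r
  proof -
    have "measure nu {t. \<bar>t - fst z\<bar> < r} * r \<le> (C * measure nu {t. \<bar>t - fst z\<bar> < r / 2}) * r"
      using C(2)[OF supp] r by (intro mult_right_mono) auto
    also have "\<dots> = (2 * C) * (measure nu {t. \<bar>t - fst z\<bar> < r / 2} * (r / 2))" by simp
    also have "\<dots> \<le> (2 * C) * measure \<mu> (euclid_ball z r)"
    proof (rule mult_left_mono)
      have "measure nu {t. \<bar>t - fst z\<bar> < r / 2} * (r / 2) \<le> measure \<mu> (max_ball z (r / 2))"
        using z r by (intro max_ball_lower) auto
      also have "\<dots> \<le> measure \<mu> (euclid_ball z r)"
        by (intro finite_measure_mono max_ball_half_subset euclid_ball_sets)
      finally show "measure nu {t. \<bar>t - fst z\<bar> < r / 2} * (r / 2) \<le> measure \<mu> (euclid_ball z r)" .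
    qed (use C in simp)
    finally show ?thesis .
  qed
  then show ?thesis by (rule that)
qed

lemma visit_count_eq: "visit_count \<mu> T \<tau> B x = visits T B {0..nat \<lfloor>\<tau> / measure \<mu> B\<rfloor>} x"
  by (simp add: visit_count_def visits_def)

theorem nonperiodic_poisson:
  assumes z: "z \<in> unit_square" and \<tau>: "\<tau> > 0"
    and dim: "has_local_dim \<mu> (euclid_ball z) (SRB_dim \<gamma>)"
    and lim: "(\<lambda>n. real n * measure \<mu> (euclid_ball z (exp (- u n)))) \<longlonglongrightarrow> \<tau>"
    and np: "\<not> periodic_point T z"
  shows "(\<lambda>n. measure \<mu> {x \<in> space \<mu>. visit_count \<mu> T \<tau> (euclid_ball z (exp (- u n))) x = k})
    \<longlonglongrightarrow> exp (- \<tau>) * \<tau> ^ k / fact k"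
proof -
  note ld = local_dim_consequences[OF euclid_ball_sets euclid_ball_subset mono_euclid_ball dim]
  obtain C where C: "\<And>r. 0 < r \<Longrightarrow> r \<le> 1/2 \<Longrightarrow> measure nu {t. \<bar>t - fst z\<bar> < r} * r \<le> C * measure \<mu> (euclid_ball z r)"
    using euclid_ball_lower[OF z ld(3)] by blast
  have "sqrt (1/2) < (1::real)" by simp
  have r0: "(\<lambda>n. exp (- u n)) \<longlonglongrightarrow> 0"
    by (rule radius_tendsto_0[where Ball = "euclid_ball z", OF euclid_ball_sets mono_euclid_ball ld(2) _ lim]) auto
  have "(\<lambda>n. measure \<mu> {w \<in> space \<mu>. visits T (euclid_ball z (exp (- u n))) {0..nat \<lfloor>\<tau> / measure \<mu> (euclid_ball z (exp (- u n)))\<rfloor>} w = k})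
    \<longlonglongrightarrow> compound_poisson_mass 1 \<tau> k"
    by (rule ball_visits_limit[OF euclid_ball_sets euclid_ball_subset C euclid_ball_annulus _ _ ld(2,1) _ _ _ \<tau> _ r0])
      (use nonperiodic_returns[OF z np euclid_ball_subset] in auto)
  then show ?thesis
    by (simp add: visit_count_eq compound_poisson_mass_eq_polya_aeppli polya_aeppli_mass_1)
qed

theorem periodic_polya_aeppli:
  assumes z: "z \<in> unit_square" and \<tau>: "\<tau> > 0"
    and dim: "has_local_dim \<mu> (max_ball z) (SRB_dim \<gamma>)"
    and lim: "(\<lambda>n. real n * measure \<mu> (max_ball z (exp (- u n)))) \<longlonglongrightarrow> \<tau>"
    and p: "minimal_period T z p"
  shows "(\<lambda>n. measure \<mu> {x \<in> space \<mu>. visit_count \<mu> T \<tau> (max_ball z (exp (- u n))) x = k})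
      \<longlonglongrightarrow> polya_aeppli_mass (1 - 1 / 2 ^ p) \<tau> k"
    and "(\<lambda>n. measure \<mu> ((T ^^ p) -` max_ball z (exp (- u n)) \<inter> max_ball z (exp (- u n)))
      / measure \<mu> (max_ball z (exp (- u n)))) \<longlonglongrightarrow> 1 / 2 ^ p"
proof -
  note ld = local_dim_consequences[OF max_ball_sets order_refl mono_max_ball dim]
  obtain K where K: "\<And>z r m. \<exists>G\<in>sets \<mu>. measure \<mu> G \<le> K * (1/2) ^ m \<and>
      (\<forall>b b'. b \<in> max_ball z r \<and> b' \<in> unit_square \<and> b' \<notin> max_ball z r \<and> \<bar>fst b - fst b'\<bar> \<le> \<gamma> ^ m \<and>
        \<bar>snd b - snd b'\<bar> \<le> (1/2) ^ m \<longrightarrow> b \<in> G)"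
    using max_ball_annulus by metis
  have r0: "(\<lambda>n. exp (- u n)) \<longlonglongrightarrow> 0"
    by (rule radius_tendsto_0[where Ball = "max_ball z", OF max_ball_sets mono_max_ball ld(2) _ lim]) auto
  have lower: "measure nu {t. \<bar>t - fst z\<bar> < r} * r \<le> 1 * measure \<mu> (max_ball z r)" if "0 < r" "r \<le> 1/2" for r
    using max_ball_lower[OF z that] by simp
  have returns: "\<exists>P0. \<forall>P\<ge>P0. eventually (\<lambda>r. measure \<mu> {w \<in> max_ball z r. visits T (max_ball z r) {1..P} w = k}
      = (1 - 1 / 2 ^ p) * (1 - (1 - 1 / 2 ^ p)) ^ k * measure \<mu> (max_ball z r)) (at_right 0)" for k
    using periodic_returns[OF z p] by (intro exI[of _ "(k + 1) * p"]) blast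
  have "(\<lambda>n. measure \<mu> {w \<in> space \<mu>. visits T (max_ball z (exp (- u n))) {0..nat \<lfloor>\<tau> / measure \<mu> (max_ball z (exp (- u n)))\<rfloor>} w = k})
    \<longlonglongrightarrow> compound_poisson_mass (1 - 1 / 2 ^ p) \<tau> k"
    by (rule ball_visits_limit[OF max_ball_sets order_refl lower K _ _ ld(2,1) returns _ _ \<tau> _ r0]) auto
  then show "(\<lambda>n. measure \<mu> {x \<in> space \<mu>. visit_count \<mu> T \<tau> (max_ball z (exp (- u n))) x = k})
      \<longlonglongrightarrow> polya_aeppli_mass (1 - 1 / 2 ^ p) \<tau> k"
    by (simp add: visit_count_eq compound_poisson_mass_eq_polya_aeppli)
  have "filterlim (\<lambda>n. exp (- u n)) (at_right 0) sequentially"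
    using r0 by (intro tendsto_imp_filterlim_at_right) auto
  from eventually_compose_filterlim[OF periodic_return_ratio[OF z p ld(2)] this]
  show "(\<lambda>n. measure \<mu> ((T ^^ p) -` max_ball z (exp (- u n)) \<inter> max_ball z (exp (- u n)))
      / measure \<mu> (max_ball z (exp (- u n)))) \<longlonglongrightarrow> 1 / 2 ^ p"
    by (rule tendsto_eventually)
qed

end

theorem proposition7p2:
  fixes \<gamma> \<tau> :: real and \<mu> :: "(real \<times> real) measure"
    and z :: "real \<times> real" and u :: "nat \<Rightarrow> real"
  assumes "0 < \<gamma>" and "\<gamma> < 1/2"
    and "is_SRB \<gamma> \<mu>"
    and "\<tau> > 0"
    and "z \<in> unit_square"
  shows
    "(let B = (\<lambda>n. euclid_ball z (exp (- u n))) in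
        has_local_dim \<mu> (euclid_ball z) (SRB_dim \<gamma>) \<longrightarrow>
        (\<lambda>n. real n * measure \<mu> (B n)) \<longlonglongrightarrow> \<tau> \<longrightarrow>
        \<not> periodic_point (baker \<gamma>) z \<longrightarrow>
        (\<forall>k. (\<lambda>n. measure \<mu> {x \<in> space \<mu>. visit_count \<mu> (baker \<gamma>) \<tau> (B n) x = k})
               \<longlonglongrightarrow> exp (- \<tau>) * \<tau> ^ k / fact k))
     \<and>
     (let B = (\<lambda>n. max_ball z (exp (- u n))) in
        has_local_dim \<mu> (max_ball z) (SRB_dim \<gamma>) \<longrightarrow>
        (\<lambda>n. real n * measure \<mu> (B n)) \<longlonglongrightarrow> \<tau> \<longrightarrow>
        (\<forall>p. minimal_period (baker \<gamma>) z p \<longrightarrow>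
          (let q = (\<lambda>n. measure \<mu> ((baker \<gamma> ^^ p) -` B n \<inter> B n) / measure \<mu> (B n));
               \<Theta> = 1 - lim q
           in convergent q \<and>
              weak_conv_m (\<lambda>n. distr \<mu> borel (\<lambda>x. real (visit_count \<mu> (baker \<gamma>) \<tau> (B n) x)))
                (polya_aeppli_law \<Theta> \<tau>) \<and>
              (\<forall>k\<ge>1. (\<lambda>n. measure \<mu> {x \<in> space \<mu>. visit_count \<mu> (baker \<gamma>) \<tau> (B n) x = k})
                 \<longlonglongrightarrow> exp (- \<Theta> * \<tau>) *
                   (\<Sum>j = 1..k. (1 - \<Theta>) ^ (k - j) * \<Theta> ^ (2 * j) * (\<tau> ^ j / fact j) *
                      real ((k - 1) choose (j - 1)))) \<and>
              (\<lambda>n. measure \<mu> {x \<in> space \<mu>. visit_count \<mu> (baker \<gamma>) \<tau> (B n) x = 0})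
                 \<longlonglongrightarrow> exp (- \<Theta> * \<tau>))))"
proof -
  interpret baker_srb \<gamma> \<mu>
    using assms by (simp add: baker_srb_def)
  have per: "let q = (\<lambda>n. measure \<mu> ((baker \<gamma> ^^ p) -` B n \<inter> B n) / measure \<mu> (B n)); \<Theta> = 1 - lim q
       in convergent q \<and>
          weak_conv_m (\<lambda>n. distr \<mu> borel (\<lambda>x. real (visit_count \<mu> (baker \<gamma>) \<tau> (B n) x)))
            (polya_aeppli_law \<Theta> \<tau>) \<and>
          (\<forall>k\<ge>1. (\<lambda>n. measure \<mu> {x \<in> space \<mu>. visit_count \<mu> (baker \<gamma>) \<tau> (B n) x = k})
             \<longlonglongrightarrow> exp (- \<Theta> * \<tau>) *
               (\<Sum>j = 1..k. (1 - \<Theta>) ^ (k - j) * \<Theta> ^ (2 * j) * (\<tau> ^ j / fact j) *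
                  real ((k - 1) choose (j - 1)))) \<and>
          (\<lambda>n. measure \<mu> {x \<in> space \<mu>. visit_count \<mu> (baker \<gamma>) \<tau> (B n) x = 0})
             \<longlonglongrightarrow> exp (- \<Theta> * \<tau>)"
    if B: "B = (\<lambda>n. max_ball z (exp (- u n)))" and dim: "has_local_dim \<mu> (max_ball z) (SRB_dim \<gamma>)"
      and lim: "(\<lambda>n. real n * measure \<mu> (B n)) \<longlonglongrightarrow> \<tau>" and p: "minimal_period (baker \<gamma>) z p" for B p
  proof -
    define \<Theta> :: real where "\<Theta> = 1 - 1 / 2 ^ p"
    have \<Theta>: "0 \<le> \<Theta>" "\<Theta> \<le> 1" by (auto simp: \<Theta>_def)
    note pa = periodic_polya_aeppli[OF \<open>z \<in> unit_square\<close> \<open>\<tau> > 0\<close> dim lim[unfolded B] p,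
        folded \<Theta>_def, folded B]
    have mass: "(\<lambda>n. measure \<mu> {x \<in> space \<mu>. visit_count \<mu> (baker \<gamma>) \<tau> (B n) x = k})
        \<longlonglongrightarrow> polya_aeppli_mass \<Theta> \<tau> k" for k
      using pa(1)[of k] by (simp add: B)
    have q: "(\<lambda>n. measure \<mu> ((baker \<gamma> ^^ p) -` B n \<inter> B n) / measure \<mu> (B n)) \<longlonglongrightarrow> 1 / 2 ^ p"
      using pa(2) by (simp add: B)
    have weak: "weak_conv_m (\<lambda>n. distr \<mu> borel (\<lambda>x. real (visit_count \<mu> (baker \<gamma>) \<tau> (B n) x))) (polya_aeppli_law \<Theta> \<tau>)"
      using mass \<Theta> \<open>\<tau> > 0\<close>
      by (intro weak_conv_polya_aeppli) (auto intro!: visits_sets max_ball_sets simp: visit_count_eq B)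
    have pos: "(\<lambda>n. measure \<mu> {x \<in> space \<mu>. visit_count \<mu> (baker \<gamma>) \<tau> (B n) x = k})
             \<longlonglongrightarrow> exp (- \<Theta> * \<tau>) *
               (\<Sum>j = 1..k. (1 - \<Theta>) ^ (k - j) * \<Theta> ^ (2 * j) * (\<tau> ^ j / fact j) *
                  real ((k - 1) choose (j - 1)))" if "k \<ge> 1" for k
      using mass[of k] that unfolding polya_aeppli_mass_def by simp
    have zero: "(\<lambda>n. measure \<mu> {x \<in> space \<mu>. visit_count \<mu> (baker \<gamma>) \<tau> (B n) x = 0}) \<longlonglongrightarrow> exp (- \<Theta> * \<tau>)"
      using mass[of 0] unfolding polya_aeppli_mass_def by simp
    \<comment> \<open>Convergence of the ratios makes \<open>lim\<close> their actual limit, so the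
      \<Theta> of the statement is the explicit value under which the masses were computed.\<close>
    have theta: "1 - lim (\<lambda>n. measure \<mu> ((baker \<gamma> ^^ p) -` B n \<inter> B n) / measure \<mu> (B n)) = \<Theta>"
      using limI[OF q] by (simp add: \<Theta>_def)
    show ?thesis
      unfolding Let_def theta by (intro conjI allI impI convergentI[OF q] weak pos zero)
  qed
  show ?thesis
  proof (rule conjI)
    show "let B = (\<lambda>n. euclid_ball z (exp (- u n))) in
        has_local_dim \<mu> (euclid_ball z) (SRB_dim \<gamma>) \<longrightarrow>
        (\<lambda>n. real n * measure \<mu> (B n)) \<longlonglongrightarrow> \<tau> \<longrightarrow>
        \<not> periodic_point (baker \<gamma>) z \<longrightarrow>
        (\<forall>k. (\<lambda>n. measure \<mu> {x \<in> space \<mu>. visit_count \<mu> (baker \<gamma>) \<tau> (B n) x = k})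
               \<longlonglongrightarrow> exp (- \<tau>) * \<tau> ^ k / fact k)"
      unfolding Let_def using nonperiodic_poisson[OF \<open>z \<in> unit_square\<close> \<open>\<tau> > 0\<close>] by (intro impI allI)
  qed (subst Let_def, intro impI allI, rule per, rule refl)
qed

end
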